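(* The model checking problem for $ATL^*$ (respectively, for $ATL$) on imperfect-information concurrent game structures (iCGS) is polynomial-time reducible to the model checking problem for $ATL^*$ (respectively, for $ATL$) on concurrent game structures with visibility (vCGS). That is, there is a polynomial-time computable map sending each pair $(\mathcal{G},\varphi)$, with $\mathcal{G}$ a finite iCGS and $\varphi$ an $ATL^*$ (resp. $ATL$) formula, to a pair $(\Delta_{\mathcal{G}},\varphi')$, with $\Delta_{\mathcal{G}}$ a vCGS and $\varphi'$ an $ATL^*$ (resp. $ATL$) formula, such that $\mathcal{G}\models\varphi$ if and only if $\Delta_{\mathcal{G}}\models\varphi'$.
   Context: An iCGS is a tuple $\mathcal{G}=\langle Ag,\{Act_a\}_{a\in Ag},S,S_0,P,\tau,\{\sim_a\}_{a\in Ag},\pi\rangle$ where $Ag$ is a finite set of agents, $Act_a$ a finite set of actions of agent $a$, $S$ a finite set of states, $S_0\subseteq S$ the initial states, $P$ a set of atomic propositions, $\tau:S\times\prod_{a\in Ag}Act_a\to S$ the transition function, $\sim_a$ an equivalence relation on $S$ (indistinguishability for $a$), and $\pi:S\to 2^P$ a labelling. A vCGS is a multi-agent system in which each agent $a$ is given by a specification $\langle V_a,GC_a\rangle$: $V_a$ is a finite set of boolean atoms controlled by $a$ (the sets $V_a$ being pairwise disjoint), and for each $v\in V_a$ and each agent $b\neq a$ there is a boolean visibility atom $vis(v,b)$, also controlled by $a$, stating whether $b$ can see $v$. $GC_a$ is a finite set of guarded commands $\gamma::=\phi\rightsquigarrow \mathit{assignments}$, where the guard $\phi$ is a boolean formula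 over atoms and the assignments set some of $a$'s atoms (including visibility atoms) to $\top$ or $\bot$; commands are of init-type (used to produce the initial states) or update-type. A state is a valuation of all atoms; at each state every agent chooses one of its update commands whose guard is true, and the chosen commands are executed simultaneously to produce the next state. Agent $a$ cannot distinguish two states $s,s'$ iff they agree on all atoms visible to $a$ (its own atoms and every atom $v$ of another agent with $vis(v,a)$ true), and on the corresponding visibility atoms. $ATL^*$ and $ATL$ formulas (with strategy operators $\langle\langle A\rangle\rangle$ for coalitions $A$) are interpreted on both kinds of structures in the imperfect-information setting, with uniform strategies (agents must choose the same action on indistinguishable histories). *)

theory Defs
  imports Main "HOL-Library.FuncSet" "HOL-Library.List_Lexorder"
    "HOL-Computational_Algebra.Polynomial"
begin

section \<open>Syntax of ATL* and ATL\<close>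

datatype ('p, 'ag) sfm =
    Prop 'p
  | SNot "('p, 'ag) sfm"
  | SAnd "('p, 'ag) sfm" "('p, 'ag) sfm"
  | Coal "'ag set" "('p, 'ag) pfm"
and ('p, 'ag) pfm =
    St "('p, 'ag) sfm"
  | PNot "('p, 'ag) pfm"
  | PAnd "('p, 'ag) pfm" "('p, 'ag) pfm"
  | Next "('p, 'ag) pfm"
  | Until "('p, 'ag) pfm" "('p, 'ag) pfm"
  | Release "('p, 'ag) pfm" "('p, 'ag) pfm"

text \<open>Every state formula is an ATL* formula. In ATL each strategy operator is immediately
  followed by exactly one temporal operator applied to state formulas. Release is primitive
  because, although it is definable in ATL*, it is not definable from Next and Until in ATL.\<close>

fun is_ATL :: "('p, 'ag) sfm \<Rightarrow> bool" where
  "is_ATL (Prop p) = True"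
| "is_ATL (SNot \<phi>) = is_ATL \<phi>"
| "is_ATL (SAnd \<phi> \<psi>) = (is_ATL \<phi> \<and> is_ATL \<psi>)"
| "is_ATL (Coal A (Next (St \<phi>))) = is_ATL \<phi>"
| "is_ATL (Coal A (Until (St \<phi>) (St \<psi>))) = (is_ATL \<phi> \<and> is_ATL \<psi>)"
| "is_ATL (Coal A (Release (St \<phi>) (St \<psi>))) = (is_ATL \<phi> \<and> is_ATL \<psi>)"
| "is_ATL (Coal A _) = False"

datatype atl_logic = ATL_star | ATL

definition in_logic :: "atl_logic \<Rightarrow> ('p, 'ag) sfm \<Rightarrow> bool" where
  "in_logic L \<phi> \<longleftrightarrow> (case L of ATL_star \<Rightarrow> True | ATL \<Rightarrow> is_ATL \<phi>)"

primrec sfm_over :: "'p set \<Rightarrow> 'ag set \<Rightarrow> ('p, 'ag) sfm \<Rightarrow> bool"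
  and pfm_over :: "'p set \<Rightarrow> 'ag set \<Rightarrow> ('p, 'ag) pfm \<Rightarrow> bool" where
  "sfm_over P N (Prop p) = (p \<in> P)"
| "sfm_over P N (SNot \<phi>) = sfm_over P N \<phi>"
| "sfm_over P N (SAnd \<phi> \<psi>) = (sfm_over P N \<phi> \<and> sfm_over P N \<psi>)"
| "sfm_over P N (Coal A \<psi>) = (A \<subseteq> N \<and> pfm_over P N \<psi>)"
| "pfm_over P N (St \<phi>) = sfm_over P N \<phi>"
| "pfm_over P N (PNot \<psi>) = pfm_over P N \<psi>"
| "pfm_over P N (PAnd \<psi> \<chi>) = (pfm_over P N \<psi> \<and> pfm_over P N \<chi>)"
| "pfm_over P N (Next \<psi>) = pfm_over P N \<psi>"
| "pfm_over P N (Until \<psi> \<chi>) = (pfm_over P N \<psi> \<and> pfm_over P N \<chi>)"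
| "pfm_over P N (Release \<psi> \<chi>) = (pfm_over P N \<psi> \<and> pfm_over P N \<chi>)"


section \<open>Imperfect-information semantics\<close>

text \<open>The common semantic view of iCGS and vCGS: \<open>avail a s\<close> are the actions agent \<open>a\<close> may choose
  in state \<open>s\<close>.\<close>

record ('ag, 'act, 'st, 'p) game =
  players :: "'ag set"
  positions :: "'st set"
  start :: "'st set"
  avail :: "'ag \<Rightarrow> 'st \<Rightarrow> 'act set"
  move :: "'st \<Rightarrow> ('ag \<Rightarrow> 'act) \<Rightarrow> 'st"
  similar :: "'ag \<Rightarrow> ('st \<times> 'st) set"
  holds :: "'st \<Rightarrow> 'p set"

definition histories :: "('ag, 'act, 'st, 'p) game \<Rightarrow> 'st list set" where
  "histories M = {h. h \<noteq> [] \<and> set h \<subseteq> positions M}"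

definition similar_histories ::
  "('ag, 'act, 'st, 'p) game \<Rightarrow> 'ag \<Rightarrow> 'st list \<Rightarrow> 'st list \<Rightarrow> bool" where
  "similar_histories M a h h' \<longleftrightarrow> list_all2 (\<lambda>s s'. (s, s') \<in> similar M a) h h'"

definition uniform_strategy ::
  "('ag, 'act, 'st, 'p) game \<Rightarrow> 'ag \<Rightarrow> ('st list \<Rightarrow> 'act) \<Rightarrow> bool" where
  "uniform_strategy M a f \<longleftrightarrow>
     (\<forall>h\<in>histories M. f h \<in> avail M a (last h)) \<and>
     (\<forall>h\<in>histories M. \<forall>h'\<in>histories M. similar_histories M a h h' \<longrightarrow> f h = f h')"

definition outcomes ::
  "('ag, 'act, 'st, 'p) game \<Rightarrow> 'st \<Rightarrow> 'ag set \<Rightarrow> ('ag \<Rightarrow> 'st list \<Rightarrow> 'act) \<Rightarrow> (nat \<Rightarrow> 'st) set" where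
  "outcomes M s A F = {p. p 0 = s \<and>
     (\<forall>i. \<exists>\<alpha> \<in> (\<Pi>\<^sub>E a\<in>players M. avail M a (p i)).
        (\<forall>a\<in>A. \<alpha> a = F a (map p [0..<Suc i])) \<and> p (Suc i) = move M (p i) \<alpha>)}"

primrec ssat :: "('ag, 'act, 'st, 'p) game \<Rightarrow> 'st \<Rightarrow> ('p, 'ag) sfm \<Rightarrow> bool"
  and psat :: "('ag, 'act, 'st, 'p) game \<Rightarrow> (nat \<Rightarrow> 'st) \<Rightarrow> ('p, 'ag) pfm \<Rightarrow> bool" where
  "ssat M s (Prop q) = (q \<in> holds M s)"
| "ssat M s (SNot \<phi>) = (\<not> ssat M s \<phi>)"
| "ssat M s (SAnd \<phi> \<psi>) = (ssat M s \<phi> \<and> ssat M s \<psi>)"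
| "ssat M s (Coal A \<psi>) =
     (\<exists>F. (\<forall>a\<in>A. uniform_strategy M a (F a)) \<and> (\<forall>p\<in>outcomes M s A F. psat M p \<psi>))"
| "psat M p (St \<phi>) = ssat M (p 0) \<phi>"
| "psat M p (PNot \<psi>) = (\<not> psat M p \<psi>)"
| "psat M p (PAnd \<psi> \<chi>) = (psat M p \<psi> \<and> psat M p \<chi>)"
| "psat M p (Next \<psi>) = psat M (\<lambda>i. p (Suc i)) \<psi>"
| "psat M p (Until \<psi> \<chi>) =
     (\<exists>k. psat M (\<lambda>i. p (k + i)) \<chi> \<and> (\<forall>j<k. psat M (\<lambda>i. p (j + i)) \<psi>))"
| "psat M p (Release \<psi> \<chi>) =
     (\<forall>k. psat M (\<lambda>i. p (k + i)) \<chi> \<or> (\<exists>j<k. psat M (\<lambda>i. p (j + i)) \<psi>))"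

definition models :: "('ag, 'act, 'st, 'p) game \<Rightarrow> ('p, 'ag) sfm \<Rightarrow> bool" (infix "\<Turnstile>" 50) where
  "M \<Turnstile> \<phi> \<longleftrightarrow> (\<forall>s\<in>start M. ssat M s \<phi>)"


section \<open>iCGS\<close>

record ('ag, 'act, 'st, 'p) icgs =
  Ag :: "'ag set"
  Act :: "'ag \<Rightarrow> 'act set"
  States :: "'st set"
  Init :: "'st set"
  Props :: "'p set"
  \<tau> :: "'st \<Rightarrow> ('ag \<Rightarrow> 'act) \<Rightarrow> 'st"
  Indist :: "'ag \<Rightarrow> ('st \<times> 'st) set"
  \<pi> :: "'st \<Rightarrow> 'p set"

definition finite_icgs :: "('ag, 'act, 'st, 'p) icgs \<Rightarrow> bool" where
  "finite_icgs G \<longleftrightarrow>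
     finite (Ag G) \<and> (\<forall>a\<in>Ag G. finite (Act G a)) \<and> finite (States G) \<and>
     Init G \<subseteq> States G \<and> finite (Props G) \<and>
     (\<forall>s\<in>States G. \<forall>\<alpha> \<in> (\<Pi>\<^sub>E a\<in>Ag G. Act G a). \<tau> G s \<alpha> \<in> States G) \<and>
     (\<forall>a\<in>Ag G. equiv (States G) (Indist G a)) \<and>
     (\<forall>s\<in>States G. \<pi> G s \<subseteq> Props G)"

definition icgs_game :: "('ag, 'act, 'st, 'p) icgs \<Rightarrow> ('ag, 'act, 'st, 'p) game" where
  "icgs_game G = \<lparr>players = Ag G, positions = States G, start = Init G,
     avail = (\<lambda>a s. Act G a), move = \<tau> G, similar = Indist G, holds = \<pi> G\<rparr>"


section \<open>vCGS\<close>

datatype ('v, 'ag) atom = At 'v | Vis 'v 'ag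

datatype 'x bexp = BTrue | BAtom 'x | BNot "'x bexp" | BAnd "'x bexp" "'x bexp"

primrec beval :: "'x set \<Rightarrow> 'x bexp \<Rightarrow> bool" where
  "beval s BTrue = True"
| "beval s (BAtom x) = (x \<in> s)"
| "beval s (BNot b) = (\<not> beval s b)"
| "beval s (BAnd b c) = (beval s b \<and> beval s c)"

text \<open>A guard together with a list of assignments of truth values to atoms.\<close>

datatype ('v, 'ag) command =
  Command (guard: "('v, 'ag) atom bexp") (assigns: "(('v, 'ag) atom \<times> bool) list")

text \<open>A vCGS is a syntactic specification, so its finite sets are given by listing their elements;
  order and repetition do not matter for the semantics.\<close>

record ('v, 'ag) agent_spec =
  vars :: "'v list"
  init_cmds :: "('v, 'ag) command list"
  update_cmds :: "('v, 'ag) command list"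

record ('v, 'ag) vcgs =
  vAg :: "'ag list"
  spec :: "'ag \<Rightarrow> ('v, 'ag) agent_spec"

abbreviation ctrl :: "('v, 'ag) vcgs \<Rightarrow> 'ag \<Rightarrow> 'v set" where
  "ctrl D a \<equiv> set (vars (spec D a))"

definition controlled :: "('v, 'ag) vcgs \<Rightarrow> 'ag \<Rightarrow> ('v, 'ag) atom set" where
  "controlled D a = At ` ctrl D a \<union> {Vis v b | v b. v \<in> ctrl D a \<and> b \<in> set (vAg D) \<and> b \<noteq> a}"

definition atoms :: "('v, 'ag) vcgs \<Rightarrow> ('v, 'ag) atom set" where
  "atoms D = (\<Union>a\<in>set (vAg D). controlled D a)"

text \<open>A state is a valuation of all atoms, represented by the set of atoms that are true.\<close>

definition vstates :: "('v, 'ag) vcgs \<Rightarrow> ('v, 'ag) atom set set" where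
  "vstates D = Pow (atoms D)"

definition enabled ::
  "('v, 'ag) command list \<Rightarrow> ('v, 'ag) atom set \<Rightarrow> ('v, 'ag) command set" where
  "enabled cs s = {c \<in> set cs. beval s (guard c)}"

definition wf_command :: "('v, 'ag) vcgs \<Rightarrow> 'ag \<Rightarrow> ('v, 'ag) command \<Rightarrow> bool" where
  "wf_command D a c \<longleftrightarrow>
     set_bexp (guard c) \<subseteq> atoms D \<and> fst ` set (assigns c) \<subseteq> controlled D a \<and>
     distinct (map fst (assigns c))"

text \<open>The last condition says that the choice of an update command is possible for every agent in
  every state.\<close>

definition wf_vcgs :: "('v, 'ag) vcgs \<Rightarrow> bool" where
  "wf_vcgs D \<longleftrightarrow>
     (\<forall>a\<in>set (vAg D). \<forall>b\<in>set (vAg D). a \<noteq> b \<longrightarrow> ctrl D a \<inter> ctrl D b = {}) \<and>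
     (\<forall>a\<in>set (vAg D). \<forall>c \<in> set (init_cmds (spec D a)) \<union> set (update_cmds (spec D a)).
        wf_command D a c) \<and>
     (\<forall>a\<in>set (vAg D). \<forall>s\<in>vstates D. enabled (update_cmds (spec D a)) s \<noteq> {})"

text \<open>Simultaneous execution; atoms that are not assigned keep their value.\<close>

definition execute ::
  "('v, 'ag) vcgs \<Rightarrow> ('v, 'ag) atom set \<Rightarrow> ('ag \<Rightarrow> ('v, 'ag) command) \<Rightarrow> ('v, 'ag) atom set" where
  "execute D s \<alpha> =
     (s - {x. \<exists>a\<in>set (vAg D). (x, False) \<in> set (assigns (\<alpha> a))}) \<union>
     {x. \<exists>a\<in>set (vAg D). (x, True) \<in> set (assigns (\<alpha> a))}"

text \<open>Init commands are executed from the valuation in which every atom is false.\<close>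

definition vinit :: "('v, 'ag) vcgs \<Rightarrow> ('v, 'ag) atom set set" where
  "vinit D = {execute D {} \<alpha> | \<alpha>. \<alpha> \<in> (\<Pi>\<^sub>E a\<in>set (vAg D). enabled (init_cmds (spec D a)) {})}"

definition vindist ::
  "('v, 'ag) vcgs \<Rightarrow> 'ag \<Rightarrow> (('v, 'ag) atom set \<times> ('v, 'ag) atom set) set" where
  "vindist D a = {(s, s'). s \<in> vstates D \<and> s' \<in> vstates D \<and>
     (\<forall>x\<in>controlled D a. x \<in> s \<longleftrightarrow> x \<in> s') \<and>
     (\<forall>b \<in> set (vAg D) - {a}. \<forall>v\<in>ctrl D b.
        (Vis v a \<in> s \<longleftrightarrow> Vis v a \<in> s') \<and>
        (Vis v a \<in> s \<longrightarrow> (At v \<in> s \<longleftrightarrow> At v \<in> s')))}"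

definition vcgs_game ::
  "('v, 'ag) vcgs \<Rightarrow> ('ag, ('v, 'ag) command, ('v, 'ag) atom set, ('v, 'ag) atom) game" where
  "vcgs_game D = \<lparr>players = set (vAg D), positions = vstates D, start = vinit D,
     avail = (\<lambda>a. enabled (update_cmds (spec D a))), move = execute D,
     similar = vindist D, holds = (\<lambda>s. s)\<rparr>"


section \<open>Polynomial-time computability\<close>

text \<open>The model of computation is a first-order functional language with general recursion over
  binary trees (pure LISP, with tree equality). A program is a list of function bodies, the first
  one being the main function. Each evaluation step costs one unit plus the size of the value it
  produces, so the cost bounds the total size of all data ever written and the model is
  polynomially equivalent to Turing machines.\<close>

datatype data = Leaf | Node data data

primrec dhd :: "data \<Rightarrow> data" where
  "dhd Leaf = Leaf"
| "dhd (Node x y) = x"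

primrec dtl :: "data \<Rightarrow> data" where
  "dtl Leaf = Leaf"
| "dtl (Node x y) = y"

primrec enc_bool :: "bool \<Rightarrow> data" where
  "enc_bool False = Leaf"
| "enc_bool True = Node Leaf Leaf"

datatype exp =
    Var nat
  | ENil
  | ECons exp exp
  | EHd exp
  | ETl exp
  | EEq exp exp
  | EIf exp exp exp
  | ECall nat "exp list"

text \<open>\<open>eval P env e v t\<close>: in environment \<open>env\<close> the expression \<open>e\<close> evaluates to \<open>v\<close> at cost \<open>t\<close>.\<close>

inductive eval :: "exp list \<Rightarrow> data list \<Rightarrow> exp \<Rightarrow> data \<Rightarrow> nat \<Rightarrow> bool"
  and evals :: "exp list \<Rightarrow> data list \<Rightarrow> exp list \<Rightarrow> data list \<Rightarrow> nat \<Rightarrow> bool"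
  for P :: "exp list" where
  eval_Var: "i < length env \<Longrightarrow> eval P env (Var i) (env ! i) (1 + size (env ! i))"
| eval_Nil: "eval P env ENil Leaf 1"
| eval_Cons: "eval P env e1 v1 t1 \<Longrightarrow> eval P env e2 v2 t2 \<Longrightarrow>
    eval P env (ECons e1 e2) (Node v1 v2) (t1 + t2 + 1 + size (Node v1 v2))"
| eval_Hd: "eval P env e v t \<Longrightarrow> eval P env (EHd e) (dhd v) (t + 1 + size (dhd v))"
| eval_Tl: "eval P env e v t \<Longrightarrow> eval P env (ETl e) (dtl v) (t + 1 + size (dtl v))"
| eval_Eq: "eval P env e1 v1 t1 \<Longrightarrow> eval P env e2 v2 t2 \<Longrightarrow>
    eval P env (EEq e1 e2) (enc_bool (v1 = v2)) (t1 + t2 + 1 + size (enc_bool (v1 = v2)))"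
| eval_If_true: "eval P env e v t \<Longrightarrow> v \<noteq> Leaf \<Longrightarrow> eval P env e1 v1 t1 \<Longrightarrow>
    eval P env (EIf e e1 e2) v1 (t + t1 + 1 + size v1)"
| eval_If_false: "eval P env e Leaf t \<Longrightarrow> eval P env e2 v2 t2 \<Longrightarrow>
    eval P env (EIf e e1 e2) v2 (t + t2 + 1 + size v2)"
| eval_Call: "f < length P \<Longrightarrow> evals P env es vs ts \<Longrightarrow> eval P vs (P ! f) v t \<Longrightarrow>
    eval P env (ECall f es) v (ts + t + 1 + size v)"
| evals_Nil: "evals P env [] [] 0"
| evals_Cons: "eval P env e v t \<Longrightarrow> evals P env es vs ts \<Longrightarrow>
    evals P env (e # es) (v # vs) (t + ts)"

definition runs :: "exp list \<Rightarrow> data \<Rightarrow> data \<Rightarrow> nat \<Rightarrow> bool" where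
  "runs P x y t \<longleftrightarrow> eval P [x] (ECall 0 [Var 0]) y t"

definition polytime_computable ::
  "'a set \<Rightarrow> ('a \<Rightarrow> data) \<Rightarrow> ('b \<Rightarrow> data) \<Rightarrow> ('a \<Rightarrow> 'b) \<Rightarrow> bool" where
  "polytime_computable X enc enc' f \<longleftrightarrow>
     (\<exists>P (q :: nat poly). \<forall>x\<in>X. \<exists>t. runs P (enc x) (enc' (f x)) t \<and> t \<le> poly q (size (enc x)))"


section \<open>Encoding of instances\<close>

text \<open>Agents, actions, states, propositions and variables are named by bit strings. Finite sets are
  encoded by their lexicographically sorted enumeration, and the transition function by its full
  table.\<close>

type_synonym name = "bool list"

primrec enc_list :: "('a \<Rightarrow> data) \<Rightarrow> 'a list \<Rightarrow> data" where
  "enc_list e [] = Leaf"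
| "enc_list e (x # xs) = Node (e x) (enc_list e xs)"

definition enc_pair :: "('a \<Rightarrow> data) \<Rightarrow> ('b \<Rightarrow> data) \<Rightarrow> 'a \<times> 'b \<Rightarrow> data" where
  "enc_pair e e' z = Node (e (fst z)) (e' (snd z))"

definition enc_name :: "name \<Rightarrow> data" where
  "enc_name = enc_list enc_bool"

definition enc_names :: "name set \<Rightarrow> data" where
  "enc_names X = enc_list enc_name (sorted_list_of_set X)"

definition tagged :: "nat \<Rightarrow> data \<Rightarrow> data" where
  "tagged n d = Node (((\<lambda>x. Node Leaf x) ^^ n) Leaf) d"

primrec enc_sfm :: "('p \<Rightarrow> data) \<Rightarrow> ('p, name) sfm \<Rightarrow> data"
  and enc_pfm :: "('p \<Rightarrow> data) \<Rightarrow> ('p, name) pfm \<Rightarrow> data" where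
  "enc_sfm e (Prop p) = tagged 0 (e p)"
| "enc_sfm e (SNot \<phi>) = tagged 1 (enc_sfm e \<phi>)"
| "enc_sfm e (SAnd \<phi> \<psi>) = tagged 2 (Node (enc_sfm e \<phi>) (enc_sfm e \<psi>))"
| "enc_sfm e (Coal A \<psi>) = tagged 3 (Node (enc_names A) (enc_pfm e \<psi>))"
| "enc_pfm e (St \<phi>) = tagged 4 (enc_sfm e \<phi>)"
| "enc_pfm e (PNot \<psi>) = tagged 5 (enc_pfm e \<psi>)"
| "enc_pfm e (PAnd \<psi> \<chi>) = tagged 6 (Node (enc_pfm e \<psi>) (enc_pfm e \<chi>))"
| "enc_pfm e (Next \<psi>) = tagged 7 (enc_pfm e \<psi>)"
| "enc_pfm e (Until \<psi> \<chi>) = tagged 8 (Node (enc_pfm e \<psi>) (enc_pfm e \<chi>))"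
| "enc_pfm e (Release \<psi> \<chi>) = tagged 9 (Node (enc_pfm e \<psi>) (enc_pfm e \<chi>))"

type_synonym named_icgs = "(name, name, name, name) icgs"
type_synonym named_vcgs = "(name, name) vcgs"

text \<open>The joint action in which the \<open>i\<close>-th agent of \<open>as\<close> plays the \<open>i\<close>-th action of \<open>cs\<close>.\<close>

definition joint_action :: "'ag list \<Rightarrow> 'act list \<Rightarrow> 'ag \<Rightarrow> 'act" where
  "joint_action as cs = (\<lambda>a\<in>set as. the (map_of (zip as cs) a))"

definition enc_icgs :: "named_icgs \<Rightarrow> data" where
  "enc_icgs G =
     (let ags = sorted_list_of_set (Ag G);
          sts = sorted_list_of_set (States G);
          acts = (\<lambda>a. sorted_list_of_set (Act G a))
      in enc_list id
        [enc_names (Ag G),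
         enc_list (\<lambda>a. enc_names (Act G a)) ags,
         enc_names (States G),
         enc_names (Init G),
         enc_names (Props G),
         enc_list (enc_pair enc_name (enc_pair (enc_list enc_name) enc_name))
           [(s, cs, \<tau> G s (joint_action ags cs)). s \<leftarrow> sts, cs \<leftarrow> product_lists (map acts ags)],
         enc_list (\<lambda>a. enc_list (enc_pair enc_name enc_name)
           [(s, s'). s \<leftarrow> sts, s' \<leftarrow> sts, (s, s') \<in> Indist G a]) ags,
         enc_list (\<lambda>s. enc_names (\<pi> G s)) sts])"

primrec enc_atom :: "(name, name) atom \<Rightarrow> data" where
  "enc_atom (At v) = tagged 0 (enc_name v)"
| "enc_atom (Vis v a) = tagged 1 (Node (enc_name v) (enc_name a))"

primrec enc_bexp :: "('x \<Rightarrow> data) \<Rightarrow> 'x bexp \<Rightarrow> data" where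
  "enc_bexp e BTrue = tagged 0 Leaf"
| "enc_bexp e (BAtom x) = tagged 1 (e x)"
| "enc_bexp e (BNot b) = tagged 2 (enc_bexp e b)"
| "enc_bexp e (BAnd b c) = tagged 3 (Node (enc_bexp e b) (enc_bexp e c))"

definition enc_command :: "(name, name) command \<Rightarrow> data" where
  "enc_command c =
     Node (enc_bexp enc_atom (guard c)) (enc_list (enc_pair enc_atom enc_bool) (assigns c))"

definition enc_vcgs :: "named_vcgs \<Rightarrow> data" where
  "enc_vcgs D = enc_list (\<lambda>a. enc_list id
     [enc_name a,
      enc_list enc_name (vars (spec D a)),
      enc_list enc_command (init_cmds (spec D a)),
      enc_list enc_command (update_cmds (spec D a))]) (vAg D)"


section \<open>Model checking instances\<close>

definition icgs_instances :: "atl_logic \<Rightarrow> (named_icgs \<times> (name, name) sfm) set" where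
  "icgs_instances L =
     {(G, \<phi>). finite_icgs G \<and> sfm_over (Props G) (Ag G) \<phi> \<and> in_logic L \<phi>}"

definition vcgs_instances :: "atl_logic \<Rightarrow> (named_vcgs \<times> ((name, name) atom, name) sfm) set" where
  "vcgs_instances L =
     {(D, \<phi>). wf_vcgs D \<and> sfm_over (atoms D) (set (vAg D)) \<phi> \<and> in_logic L \<phi>}"

definition enc_icgs_instance :: "named_icgs \<times> (name, name) sfm \<Rightarrow> data" where
  "enc_icgs_instance = enc_pair enc_icgs (enc_sfm enc_name)"

definition enc_vcgs_instance :: "named_vcgs \<times> ((name, name) atom, name) sfm \<Rightarrow> data" where
  "enc_vcgs_instance = enc_pair enc_vcgs (enc_sfm enc_atom)"

end

theory Submission
  imports Defs
begin

text \<open>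
  Every joint move of the iCGS is simulated in two phases. In phase 0 the state of the vCGS encodes
  a state \<open>q\<close> of the iCGS, and each agent records its action in variables of its own that nobody
  else sees. In phase 1 an additional environment agent, whose guards may read all atoms, executes
  the transition determined by \<open>q\<close> and the recorded actions, one guarded command per entry of the
  transition table. Agent \<open>a\<close> learns its indistinguishability class, and nothing more, because the
  environment makes an always false dummy variable for \<open>x\<close> visible to \<open>a\<close> exactly if \<open>q \<sim>\<^sub>a x\<close>.
  Guards of the other agents only mention their own atoms, so the available commands are known to
  them even in unreachable states.

  On the formula side, \<open>Until\<close> and \<open>Release\<close> are relativised to phase 0 and \<open>Next\<close> is doubled.
  Since the move from phase 1 to phase 0 is deterministic, \<open>\<langle>\<langle>A\<rangle>\<rangle> X \<phi>\<close> can be written as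
  \<open>\<langle>\<langle>A\<rangle>\<rangle> X \<langle>\<langle>\<emptyset>\<rangle>\<rangle> X \<phi>\<close>, which stays within ATL. An agent without actions would make the vCGS
  ill-formed; in that case the iCGS has no plays, and strategy operators are replaced by constants.

  Polynomial time is handled by showing that the functions computable in polynomial time are closed
  under composition, the data constructors and destructors, and structural recursion whose results
  are polynomially bounded in size; the reduction on encodings is assembled from these.
\<close>

section \<open>Closure properties of polynomial-time functions\<close>

text \<open>Guarded commands force the two phases: an agent assigns only its own atoms, and a guard
  reads the current valuation but not the choices that others make in the same step. A successor
  that depends on all actions can only be produced one step after these have become part of the
  state. The dummy variables are needed because a vCGS derives indistinguishability from visible
  atoms, whereas \<open>Indist\<close> is an arbitrary equivalence. Since \<open>vindist\<close>
  compares visibility atoms themselves, the row of visibility bits for \<open>a\<close> can spell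
  out the class of \<open>q\<close>. Unreachable states matter because
  \<open>uniform_strategy\<close> ranges over all histories of positions, so strategies must be
  defined and uniform on valuations that no play visits. The vCGS stays small because the iCGS is
  given with its full transition table, and each command is polynomially large in the agents,
  actions and states. On the machine side the obstacle is the size of results: recursion is
  unrestricted, and a step that copies recursive results may build exponentially large trees, so
  every use of recursion comes with a size bound.\<close>

lemma poly_nat_mono: "m \<le> n \<Longrightarrow> poly p m \<le> poly p n" for p :: "nat poly"
  by (induction p) (auto intro!: add_mono mult_mono)

section \<open>Linking of programs\<close>

primrec shift_calls :: "nat \<Rightarrow> exp \<Rightarrow> exp" where
  "shift_calls k (Var i) = Var i"
| "shift_calls k ENil = ENil"
| "shift_calls k (ECons e e') = ECons (shift_calls k e) (shift_calls k e')"
| "shift_calls k (EHd e) = EHd (shift_calls k e)"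
| "shift_calls k (ETl e) = ETl (shift_calls k e)"
| "shift_calls k (EEq e e') = EEq (shift_calls k e) (shift_calls k e')"
| "shift_calls k (EIf e e' e'') = EIf (shift_calls k e) (shift_calls k e') (shift_calls k e'')"
| "shift_calls k (ECall f es) = ECall (k + f) (map (shift_calls k) es)"

lemma shift_calls_0 [simp]: "shift_calls 0 e = e"
  by (induction e) (auto simp: map_idI)

text \<open>Calls name functions by position, so placing \<open>P\<close> behind \<open>Q\<close>
  only requires relocating its calls. Costs depend on values and not on positions, hence
  \<open>t\<close> is unchanged.\<close>

lemma eval_link:
  "eval P env e v t \<Longrightarrow>
     eval (Q @ map (shift_calls (length Q)) P @ R) env (shift_calls (length Q) e) v t"
  "evals P env es vs t \<Longrightarrow>
     evals (Q @ map (shift_calls (length Q)) P @ R) env (map (shift_calls (length Q)) es) vs t"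
proof (induction rule: eval_evals.inducts)
  case (eval_Call f env es vs ts v t)
  then show ?case
    using eval_evals.eval_Call[of "length Q + f" "Q @ map (shift_calls (length Q)) P @ R"]
    by (simp add: nth_append)
qed (use eval_evals.intros in \<open>simp; metis add_Suc_right\<close>)+

lemma eval_append: "eval P env e v t \<Longrightarrow> eval (P @ R) env e v t"
  using eval_link(1)[of P env e v t "[]" R] by (simp add: map_idI)

section \<open>Evaluation within a cost bound\<close>

lemma size_value_le_cost: "eval P env e v t \<Longrightarrow> size v \<le> t"
  by (erule eval.cases) auto

text \<open>Upper bounds replace exact costs, so that bounds for composed expressions follow by
  monotonicity alone.\<close>

definition eval_within :: "exp list \<Rightarrow> data list \<Rightarrow> exp \<Rightarrow> data \<Rightarrow> nat \<Rightarrow> bool" where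
  "eval_within P env e v T \<longleftrightarrow> (\<exists>t \<le> T. eval P env e v t)"

lemma eval_within_mono: "eval_within P env e v T \<Longrightarrow> T \<le> T' \<Longrightarrow> eval_within P env e v T'"
  unfolding eval_within_def using order_trans by blast

text \<open>Every step pays for the size of what it produces, so a time bound is a size bound as
  well.\<close>

lemma eval_within_size: "eval_within P env e v T \<Longrightarrow> size v \<le> T"
  unfolding eval_within_def using size_value_le_cost order_trans by blast

lemma eval_within_append: "eval_within P env e v T \<Longrightarrow> eval_within (P @ R) env e v T"
  unfolding eval_within_def using eval_append by blast

lemma eval_within_Var0: "size x + 1 \<le> T \<Longrightarrow> eval_within P [x] (Var 0) x T"
  unfolding eval_within_def using eval_Var[of 0 "[x]" P] by fastforce

lemma eval_within_Cons:
  assumes "eval_within P env e v T" "eval_within P env e' v' T'"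
    and "T + T' + size v + size v' + 2 \<le> U"
  shows "eval_within P env (ECons e e') (Node v v') U"
proof -
  obtain t t' where t: "eval P env e v t" "eval P env e' v' t'" "t \<le> T" "t' \<le> T'"
    using assms unfolding eval_within_def by blast
  have "t + t' + 1 + size (Node v v') \<le> U"
    using t assms(3) by simp
  then show ?thesis
    unfolding eval_within_def using eval_Cons[OF t(1,2)] by blast
qed

lemma eval_within_Hd:
  assumes "eval_within P env e v T" "T + size (dhd v) + 1 \<le> U"
  shows "eval_within P env (EHd e) (dhd v) U"
proof -
  obtain t where "eval P env e v t" "t \<le> T"
    using assms unfolding eval_within_def by blast
  then have "eval P env (EHd e) (dhd v) (t + 1 + size (dhd v))" "t + 1 + size (dhd v) \<le> U"
    using assms(2) by (auto intro: eval_Hd simp del: One_nat_def)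
  then show ?thesis
    unfolding eval_within_def by blast
qed

lemma eval_within_Tl:
  assumes "eval_within P env e v T" "T + size (dtl v) + 1 \<le> U"
  shows "eval_within P env (ETl e) (dtl v) U"
proof -
  obtain t where "eval P env e v t" "t \<le> T"
    using assms unfolding eval_within_def by blast
  then have "eval P env (ETl e) (dtl v) (t + 1 + size (dtl v))" "t + 1 + size (dtl v) \<le> U"
    using assms(2) by (auto intro: eval_Tl simp del: One_nat_def)
  then show ?thesis
    unfolding eval_within_def by blast
qed

lemma eval_within_Eq:
  assumes "eval_within P env e v T" "eval_within P env e' v' T'" "T + T' + 2 \<le> U"
  shows "eval_within P env (EEq e e') (enc_bool (v = v')) U"
proof -
  obtain t t' where "eval P env e v t" "eval P env e' v' t'" "t \<le> T" "t' \<le> T'"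
    using assms unfolding eval_within_def by blast
  moreover have "size (enc_bool (v = v')) \<le> 1"
    by (cases "v = v'") auto
  ultimately have "eval P env (EEq e e') (enc_bool (v = v')) (t + t' + 1 + size (enc_bool (v = v')))"
    "t + t' + 1 + size (enc_bool (v = v')) \<le> U"
    using assms(3) by (auto intro: eval_Eq simp del: One_nat_def)
  then show ?thesis
    unfolding eval_within_def by blast
qed

lemma eval_within_If:
  assumes "eval_within P env e v T"
    and "eval_within P env (if v = Leaf then e2 else e1) w T'" "T + T' + size w + 1 \<le> U"
  shows "eval_within P env (EIf e e1 e2) w U"
proof -
  obtain t t' where t: "eval P env e v t" "eval P env (if v = Leaf then e2 else e1) w t'"
      "t \<le> T" "t' \<le> T'"
    using assms unfolding eval_within_def by blast
  have "eval P env (EIf e e1 e2) w (t + t' + 1 + size w)"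
    using t by (cases "v = Leaf") (auto intro: eval_If_true eval_If_false simp del: One_nat_def)
  moreover have "t + t' + 1 + size w \<le> U"
    using assms(3) t by simp
  ultimately show ?thesis
    unfolding eval_within_def by blast
qed

lemma eval_within_Call:
  assumes "eval_within P env e w T" "f < length P" "eval_within P [w] (P ! f) v T'"
    and "T + T' + size v + 1 \<le> U"
  shows "eval_within P env (ECall f [e]) v U"
proof -
  obtain t t' where t: "eval P env e w t" "eval P [w] (P ! f) v t'" "t \<le> T" "t' \<le> T'"
    using assms unfolding eval_within_def by blast
  have "evals P env [e] [w] (t + 0)"
    using t by (intro evals_Cons evals_Nil)
  then have "eval P env (ECall f [e]) v (t + 0 + t' + 1 + size v)"
    using t assms by (intro eval_Call)
  moreover have "t + 0 + t' + 1 + size v \<le> U"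
    using assms(4) t by simp
  ultimately show ?thesis
    unfolding eval_within_def by blast
qed

section \<open>Polynomial-time functions on all trees\<close>

definition computes :: "exp list \<Rightarrow> exp \<Rightarrow> (data \<Rightarrow> data) \<Rightarrow> nat poly \<Rightarrow> bool" where
  "computes P e f p \<longleftrightarrow> (\<forall>x. eval_within P [x] e (f x) (poly p (size x)))"

text \<open>The functions are unary and total on trees, several arguments being packed with
  \<open>Node\<close>. As encodings do not enter, the closure properties need no conditions on the
  form of the input.\<close>

definition poly_time :: "(data \<Rightarrow> data) \<Rightarrow> bool" where
  "poly_time f \<longleftrightarrow> (\<exists>P e p. computes P e f p)"

lemma poly_timeI:
  assumes "\<And>x. eval_within P [x] e (f x) (poly p (size x))"
  shows "poly_time f"
  using assms unfolding poly_time_def computes_def by blast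

lemma poly_timeE:
  assumes "poly_time f"
  obtains P e p where "\<And>x. eval_within P [x] e (f x) (poly p (size x))"
  using assms unfolding poly_time_def computes_def by blast

lemma poly_time_size_bound:
  assumes "poly_time f"
  obtains p :: "nat poly" where "\<And>x. size (f x) \<le> poly p (size x)"
  using poly_timeE[OF assms] eval_within_size by metis

text \<open>Combining two functions requires both expressions over one program; the second program
  is appended to the first with its calls relocated.\<close>

lemma poly_time_link:
  assumes "poly_time f" "poly_time g"
  obtains P e e' p q where "\<And>x. eval_within P [x] e (f x) (poly p (size x))"
    and "\<And>x. eval_within P [x] e' (g x) (poly q (size x))"
proof -
  obtain P e p where f: "\<And>x. eval_within P [x] e (f x) (poly p (size x))"
    by (rule poly_timeE[OF assms(1)]) (blast intro: that)
  obtain Q e' q where g: "\<And>x. eval_within Q [x] e' (g x) (poly q (size x))"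
    by (rule poly_timeE[OF assms(2)]) (blast intro: that)
  have "eval_within (P @ map (shift_calls (length P)) Q) [x] (shift_calls (length P) e') (g x)
      (poly q (size x))" for x
    using g[of x] eval_link(1)[where Q = P and R = "[]"] unfolding eval_within_def by fastforce
  then show ?thesis
    using eval_within_append[OF f] that by blast
qed

named_theorems poly_time_intros

lemma poly_time_id [poly_time_intros]: "poly_time (\<lambda>x. x)"
  by (rule poly_timeI[where p = "[:1, 1:]"], rule eval_within_Var0) simp

lemma poly_time_Leaf [poly_time_intros]: "poly_time (\<lambda>x. Leaf)"
  by (rule poly_timeI[of "[]" ENil _ 1], unfold eval_within_def) (use eval_Nil in fastforce)

lemma poly_time_Node [poly_time_intros]:
  assumes "poly_time f" "poly_time g"
  shows "poly_time (\<lambda>x. Node (f x) (g x))"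
proof -
  obtain P e e' p q where c: "\<And>x. eval_within P [x] e (f x) (poly p (size x))"
    "\<And>x. eval_within P [x] e' (g x) (poly q (size x))"
    by (rule poly_time_link[OF assms]) (blast intro: that)
  show ?thesis
  proof (rule poly_timeI)
    show "eval_within P [x] (ECons e e') (Node (f x) (g x)) (poly (2 * p + 2 * q + 2) (size x))"
      for x
      using eval_within_size[OF c(1), of x] eval_within_size[OF c(2), of x]
      by (intro eval_within_Cons[OF c]) simp
  qed
qed

lemma size_dhd_le: "size (dhd x) \<le> size x"
  by (cases x) auto

lemma size_dtl_le: "size (dtl x) \<le> size x"
  by (cases x) auto

lemma poly_time_dhd [poly_time_intros]:
  assumes "poly_time f"
  shows "poly_time (\<lambda>x. dhd (f x))"
proof -
  obtain P e p where c: "\<And>x. eval_within P [x] e (f x) (poly p (size x))"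
    by (rule poly_timeE[OF assms]) (blast intro: that)
  show ?thesis
  proof (rule poly_timeI)
    show "eval_within P [x] (EHd e) (dhd (f x)) (poly (2 * p + 1) (size x))" for x
      using eval_within_size[OF c, of x] size_dhd_le[of "f x"]
      by (intro eval_within_Hd[OF c]) simp
  qed
qed

lemma poly_time_dtl [poly_time_intros]:
  assumes "poly_time f"
  shows "poly_time (\<lambda>x. dtl (f x))"
proof -
  obtain P e p where c: "\<And>x. eval_within P [x] e (f x) (poly p (size x))"
    by (rule poly_timeE[OF assms]) (blast intro: that)
  show ?thesis
  proof (rule poly_timeI)
    show "eval_within P [x] (ETl e) (dtl (f x)) (poly (2 * p + 1) (size x))" for x
      using eval_within_size[OF c, of x] size_dtl_le[of "f x"]
      by (intro eval_within_Tl[OF c]) simp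
  qed
qed

lemma poly_time_eq [poly_time_intros]:
  assumes "poly_time f" "poly_time g"
  shows "poly_time (\<lambda>x. enc_bool (f x = g x))"
proof -
  obtain P e e' p q where c: "\<And>x. eval_within P [x] e (f x) (poly p (size x))"
    "\<And>x. eval_within P [x] e' (g x) (poly q (size x))"
    by (rule poly_time_link[OF assms]) (blast intro: that)
  show ?thesis
  proof (rule poly_timeI)
    show "eval_within P [x] (EEq e e') (enc_bool (f x = g x)) (poly (p + q + 2) (size x))" for x
      by (intro eval_within_Eq[OF c]) simp
  qed
qed

text \<open>\<open>e\<close> becomes a new function that is called on the value of
  \<open>e'\<close>. The cost of that value bounds its size by \<open>q\<close>, whence
  \<open>pcompose p q\<close>.\<close>

lemma poly_time_compose:
  assumes "poly_time f" "poly_time g"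
  shows "poly_time (\<lambda>x. f (g x))"
proof -
  obtain P e e' p q where c: "\<And>x. eval_within P [x] e (f x) (poly p (size x))"
    "\<And>x. eval_within P [x] e' (g x) (poly q (size x))"
    by (rule poly_time_link[OF assms]) (blast intro: that)
  let ?P = "P @ [e]"
  show ?thesis
  proof (rule poly_timeI)
    fix x
    have "poly p (size (g x)) \<le> poly p (poly q (size x))"
      using eval_within_size[OF c(2)] by (rule poly_nat_mono)
    then have f: "eval_within ?P [g x] (?P ! length P) (f (g x)) (poly p (poly q (size x)))"
      using eval_within_append[OF eval_within_mono[OF c(1)]] by simp
    show "eval_within ?P [x] (ECall (length P) [e']) (f (g x))
        (poly (q + 2 * pcompose p q + 1) (size x))"
      using eval_within_size[OF f]
      by (intro eval_within_Call[OF eval_within_append[OF c(2)] _ f]) (simp_all add: poly_pcompose)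
  qed
qed

lemma poly_time_if_Leaf [poly_time_intros]:
  assumes "poly_time f" "poly_time g" "poly_time h"
  shows "poly_time (\<lambda>x. if f x = Leaf then g x else h x)"
proof -
  obtain P e e' p q where c: "\<And>x. eval_within P [x] e (f x) (poly p (size x))"
    "\<And>x. eval_within P [x] e' (Node (g x) (h x)) (poly q (size x))"
    by (rule poly_time_link[OF assms(1) poly_time_Node[OF assms(2,3)]]) (blast intro: that)
  show ?thesis
  proof (rule poly_timeI)
    fix x
    note s = eval_within_size[OF c(2), of x]
    \<comment> \<open>The single expression \<open>e'\<close> yields the pair of both branch values,
      so that linking two programs suffices; the selected half is projected out.\<close>
    have "eval_within P [x] (if f x = Leaf then EHd e' else ETl e') (if f x = Leaf then g x else h x)
        (2 * poly q (size x) + 1)"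
      using eval_within_Hd[OF c(2), of x] eval_within_Tl[OF c(2), of x] s by simp
    then show "eval_within P [x] (EIf e (ETl e') (EHd e')) (if f x = Leaf then g x else h x)
        (poly (p + 3 * q + 2) (size x))"
      by (rule eval_within_If[OF c(1)]) (use s in auto)
  qed
qed

lemma poly_time_runs:
  assumes "poly_time f"
  obtains P and p :: "nat poly" where "\<And>x. \<exists>t. runs P x (f x) t \<and> t \<le> poly p (size x)"
proof -
  obtain P e p where c: "\<And>x. eval_within P [x] e (f x) (poly p (size x))"
    by (rule poly_timeE[OF assms]) (blast intro: that)
  \<comment> \<open>A run starts with function 0, so the expression is put in front and all calls
    move up by one.\<close>
  define Q where "Q = shift_calls 1 e # map (shift_calls 1) P"
  have "eval_within Q [x] (Q ! 0) (f x) (poly p (size x))" for x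
    using c[of x] eval_link(1)[of P "[x]" e "f x" _ "[shift_calls 1 e]" "[]"]
    unfolding eval_within_def Q_def by fastforce
  note q = this
  have "eval_within Q [x] (ECall 0 [Var 0]) (f x) (poly ([:2, 1:] + 2 * p) (size x))" for x
    using eval_within_size[OF q, of x]
    by (intro eval_within_Call[OF eval_within_Var0[OF order.refl] _ q]) (simp_all add: Q_def)
  then show ?thesis
    using that unfolding eval_within_def runs_def by blast
qed

text \<open>Structural recursion on both subtrees; the parameter is transformed by \<open>k\<close> on the way
  down the right spine, so that two lists can be traversed in parallel.\<close>

primrec trec :: "(data \<Rightarrow> data) \<Rightarrow> (data \<Rightarrow> data) \<Rightarrow>
    (data \<Rightarrow> data \<Rightarrow> data \<Rightarrow> data \<Rightarrow> data \<Rightarrow> data) \<Rightarrow> data \<Rightarrow> data \<Rightarrow> data" where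
  "trec k b s Leaf = (\<lambda>c. b c)"
| "trec k b s (Node x y) = (\<lambda>c. s c x y (trec k b s x c) (trec k b s y (k c)))"

text \<open>The recursion becomes one function that calls itself on both subtrees. The parameter
  never grows and the results obey \<open>B\<close>, so a call costs a fixed polynomial apart from
  its recursive calls, and the number of calls is linear in the size of the tree.\<close>

lemma poly_time_trec_bounded:
  assumes k: "poly_time k" "\<And>c. size (k c) \<le> size c"
    and b: "poly_time b"
    and s: "poly_time (\<lambda>z. s (dhd z) (dhd (dtl z)) (dhd (dtl (dtl z)))
      (dhd (dtl (dtl (dtl z)))) (dtl (dtl (dtl (dtl z)))))"
    and B: "\<And>c d. size (trec k b s d c) \<le> poly B (size c + size d)"
    and f: "poly_time f" and g: "poly_time g"
  shows "poly_time (\<lambda>x. trec k b s (f x) (g x))"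
proof -
  let ?s = "\<lambda>z. s (dhd z) (dhd (dtl z)) (dhd (dtl (dtl z)))
      (dhd (dtl (dtl (dtl z)))) (dtl (dtl (dtl (dtl z))))"
  \<comment> \<open>Base value and parameter transformation are paired, again to link only two
    programs.\<close>
  define bk where "bk x = Node (b x) (k x)" for x
  have bk: "poly_time bk"
    using poly_time_Node[OF b k(1)] unfolding bk_def .
  obtain P es ek ps pk where c: "\<And>x. eval_within P [x] es (?s x) (poly ps (size x))"
    "\<And>x. eval_within P [x] ek (bk x) (poly pk (size x))"
    by (rule poly_time_link[OF s bk]) (blast intro: that)
  let ?n = "length P"
  let ?c = "EHd (Var 0)" and ?d = "ETl (Var 0)"
  let ?x = "EHd ?d" and ?y = "ETl ?d"
  \<comment> \<open>The recursive function has index \<open>?n + 2\<close>; its single argument is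
    the pair of parameter and tree.\<close>
  let ?u = "ECall (?n + 2) [ECons ?c ?x]"
  let ?v = "ECall (?n + 2) [ECons (ETl (ECall (?n + 1) [?c])) ?y]"
  let ?z = "ECons ?c (ECons ?x (ECons ?y (ECons ?u ?v)))"
  let ?body = "EIf ?d (ECall ?n [?z]) (EHd (ECall (?n + 1) [?c]))"
  define Q where "Q = P @ [es, ek, ?body]"
  have nth: "Q ! ?n = es" "Q ! (?n + 1) = ek" "Q ! (?n + 2) = ?body"
    and lt: "?n < length Q" "?n + 1 < length Q" "?n + 2 < length Q"
    by (simp_all add: Q_def nth_append)
  have Qs: "eval_within Q [x] (Q ! ?n) (?s x) (poly ps (size x))"
    and Qk: "eval_within Q [x] (Q ! (?n + 1)) (bk x) (poly pk (size x))" for x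
    unfolding nth unfolding Q_def using c eval_within_append by blast+
  \<comment> \<open>\<open>M N\<close> bounds the argument tuple of the step function, including its
    four constructors, and \<open>C N\<close> the cost of one call without the recursive ones. The
    coefficients are generous.\<close>
  define M where "M N = 3 * N + 3 * poly B N + 4" for N
  define C where "C N = 60 + 60 * N + 40 * M N + 10 * poly ps (M N) + 10 * poly pk N" for N
  have ec: "eval_within Q [Node c d] ?c c (2 * N + 3)"
    and ed: "eval_within Q [Node c d] ?d d (2 * N + 3)" if "size c + size d \<le> N" for c d N
  proof -
    have v: "eval_within Q [Node c d] (Var 0) (Node c d) (size c + size d + 2)"
      by (rule eval_within_Var0) simp
    show "eval_within Q [Node c d] ?c c (2 * N + 3)"
      using eval_within_Hd[OF v, of "2 * N + 3"] that by simp
    show "eval_within Q [Node c d] ?d d (2 * N + 3)"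
      using eval_within_Tl[OF v, of "2 * N + 3"] that by simp
  qed
  have call_bk: "eval_within Q [Node c d] (ECall (?n + 1) [?c]) (bk c) (2 * N + 2 * poly pk N + 4)"
    if "size c + size d \<le> N" for c d N
  proof -
    have "poly pk (size c) \<le> poly pk N"
      using that by (intro poly_nat_mono) simp
    then show ?thesis
      using eval_within_size[OF Qk, of c]
      by (intro eval_within_Call[OF ec[OF that] lt(2) Qk]) simp
  qed
  \<comment> \<open>\<open>2 * size d + 1\<close> counts the inner nodes and leaves of
    \<open>d\<close>, hence the calls.\<close>
  have body: "eval_within Q [Node c d] ?body (trec k b s d c) ((2 * size d + 1) * C N)"
    if "size c + size d \<le> N" for c d N
    using that
  proof (induction d arbitrary: c)
    case Leaf
    note bkc = call_bk[OF Leaf]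
    have s: "size (b c) \<le> 2 * N + 2 * poly pk N + 4"
      using eval_within_size[OF bkc] by (simp add: bk_def)
    then have "eval_within Q [Node c Leaf] (EHd (ECall (?n + 1) [?c])) (b c)
        (4 * N + 4 * poly pk N + 9)"
      using eval_within_Hd[OF bkc, of "4 * N + 4 * poly pk N + 9"] by (simp add: bk_def)
    then have "eval_within Q [Node c Leaf]
        (if Leaf = Leaf then EHd (ECall (?n + 1) [?c]) else ECall ?n [?z]) (trec k b s Leaf c)
        (4 * N + 4 * poly pk N + 9)"
      by simp
    then show ?case
      by (rule eval_within_If[OF ed[OF Leaf]]) (use s in \<open>simp add: C_def\<close>)
  next
    case (Node x y)
    let ?e = "[Node c (Node x y)]"
    let ?tx = "trec k b s x c" and ?ty = "trec k b s y (k c)"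
    let ?Tx = "(2 * size x + 1) * C N" and ?Ty = "(2 * size y + 1) * C N"
    have le: "size c + size x \<le> N" "size (k c) + size y \<le> N" "size c + size (Node x y) \<le> N"
      using Node.prems k(2)[of c] by simp_all
    have sb: "size ?tx \<le> poly B N" "size ?ty \<le> poly B N"
      using B order_trans poly_nat_mono le by blast+
    have c: "eval_within Q ?e ?c c (2 * N + 3)"
      by (rule ec[OF le(3)])
    have d: "eval_within Q ?e ?d (Node x y) (2 * N + 3)"
      by (rule ed[OF le(3)])
    have x: "eval_within Q ?e ?x x (3 * N + 4)"
      using eval_within_Hd[OF d, of "3 * N + 4"] le by simp
    have y: "eval_within Q ?e ?y y (3 * N + 4)"
      using eval_within_Tl[OF d, of "3 * N + 4"] le by simp
    have kc: "eval_within Q ?e (ETl (ECall (?n + 1) [?c])) (k c) (3 * N + 2 * poly pk N + 5)"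
      using eval_within_Tl[OF call_bk[OF le(3)], of "3 * N + 2 * poly pk N + 5"] le
      by (simp add: bk_def)
    have cx: "eval_within Q ?e (ECons ?c ?x) (Node c x) (6 * N + 9)"
      by (rule eval_within_Cons[OF c x]) (use le in simp)
    have ky: "eval_within Q ?e (ECons (ETl (ECall (?n + 1) [?c])) ?y) (Node (k c) y)
        (7 * N + 2 * poly pk N + 11)"
      by (rule eval_within_Cons[OF kc y]) (use le in simp)
    have u: "eval_within Q ?e ?u ?tx (?Tx + 6 * N + poly B N + 10)"
      using Node.IH(1)[OF le(1)] sb
      by (intro eval_within_Call[OF cx lt(3)]) (unfold nth, assumption, simp)
    have v: "eval_within Q ?e ?v ?ty (?Ty + 7 * N + 2 * poly pk N + poly B N + 12)"
      using Node.IH(2)[OF le(2)] sb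
      by (intro eval_within_Call[OF ky lt(3)]) (unfold nth, assumption, simp)
    define w where "w = Node c (Node x (Node y (Node ?tx ?ty)))"
    have sw: "size w \<le> M N"
      using sb le by (simp add: w_def M_def)
    have z: "eval_within Q ?e ?z w
        (?Tx + ?Ty + 21 * N + 2 * poly pk N + 2 * poly B N + 4 * M N + 41)"
      unfolding w_def
      by (intro eval_within_Cons[OF c eval_within_Cons[OF x eval_within_Cons[OF y
              eval_within_Cons[OF u v order.refl] order.refl] order.refl]])
        (use sw in \<open>simp add: w_def\<close>)
    have sN: "?s w = trec k b s (Node x y) c"
      by (simp add: w_def)
    have "poly ps (size w) \<le> poly ps (M N)"
      using sw by (rule poly_nat_mono)
    then have t: "eval_within Q [w] (Q ! ?n) (trec k b s (Node x y) c) (poly ps (M N))"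
      using eval_within_mono[OF Qs, of w] unfolding sN by blast
    note st = eval_within_size[OF t]
    have "eval_within Q ?e (ECall ?n [?z]) (trec k b s (Node x y) c)
        (?Tx + ?Ty + 21 * N + 2 * poly pk N + 2 * poly B N + 4 * M N + 42 + 2 * poly ps (M N))"
      by (rule eval_within_Call[OF z lt(1) t]) (use st in simp)
    then have "eval_within Q ?e (if Node x y = Leaf then EHd (ECall (?n + 1) [?c]) else ECall ?n [?z])
        (trec k b s (Node x y) c)
        (?Tx + ?Ty + 21 * N + 2 * poly pk N + 2 * poly B N + 4 * M N + 42 + 2 * poly ps (M N))"
      by simp
    then show ?case
    proof (rule eval_within_If[OF d])
      have "poly B N \<le> M N"
        by (simp add: M_def)
      then have "2 * N + 3 + (?Tx + ?Ty + 21 * N + 2 * poly pk N + 2 * poly B N + 4 * M N + 42 +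
          2 * poly ps (M N)) + size (trec k b s (Node x y) c) + 1 \<le> ?Tx + ?Ty + C N"
        using st unfolding C_def by linarith
      also have "\<dots> \<le> (2 * size (Node x y) + 1) * C N"
        by (simp add: algebra_simps)
      finally show "2 * N + 3 + (?Tx + ?Ty + 21 * N + 2 * poly pk N + 2 * poly B N + 4 * M N + 42 +
          2 * poly ps (M N)) + size (trec k b s (Node x y) c) + 1
          \<le> (2 * size (Node x y) + 1) * C N" .
    qed
  qed
  define CP :: "nat poly" where "CP = [:60, 60:] + 40 * ([:4, 3:] + 3 * B) +
    10 * pcompose ps ([:4, 3:] + 3 * B) + 10 * pk"
  have CP: "poly CP N = C N" for N
    by (simp add: CP_def C_def M_def poly_pcompose algebra_simps)
  have "poly_time (\<lambda>z. trec k b s (dtl z) (dhd z))"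
  proof (rule poly_timeI)
    fix z
    have sz: "size (dhd z) + size (dtl z) \<le> size z"
      by (cases z) auto
    have v: "eval_within Q [z] (Var 0) z (size z + 1)"
      by (rule eval_within_Var0) simp
    have cd: "eval_within Q [z] (ECons ?c ?d) (Node (dhd z) (dtl z)) (6 * size z + 6)"
      by (rule eval_within_Cons[OF eval_within_Hd[OF v order.refl] eval_within_Tl[OF v order.refl]])
        (use sz in simp)
    have "(2 * size (dtl z) + 1) * C (size z) \<le> (2 * size z + 1) * C (size z)"
      using sz by (intro mult_right_mono) auto
    then have t: "eval_within Q [Node (dhd z) (dtl z)] (Q ! (?n + 2)) (trec k b s (dtl z) (dhd z))
        ((2 * size z + 1) * C (size z))"
      unfolding nth using eval_within_mono[OF body[OF sz]] by blast
    show "eval_within Q [z] (ECall (?n + 2) [ECons ?c ?d]) (trec k b s (dtl z) (dhd z))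
        (poly ([:7, 6:] + 2 * ([:1, 2:] * CP)) (size z))"
      by (rule eval_within_Call[OF cd lt(3) t])
        (use eval_within_size[OF t] in \<open>simp add: CP algebra_simps\<close>)
  qed
  from poly_time_compose[OF this poly_time_Node[OF g f]] show ?thesis
    by simp
qed

text \<open>If a step adds a polynomial amount to the sizes of the two recursive results, these
  amounts sum up over the nodes and leaves of \<open>d\<close>, which yields the bound
  \<open>B\<close>.\<close>

lemma poly_time_trec:
  assumes k: "poly_time k" "\<And>c. size (k c) \<le> size c"
    and b: "poly_time b"
    and s: "poly_time (\<lambda>z. s (dhd z) (dhd (dtl z)) (dhd (dtl (dtl z)))
      (dhd (dtl (dtl (dtl z)))) (dtl (dtl (dtl (dtl z)))))"
    and h: "\<And>c x y u v. size (s c x y u v) \<le> size u + size v + poly p (size c + size x + size y)"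
    and f: "poly_time f" and g: "poly_time g"
  shows "poly_time (\<lambda>x. trec k b s (f x) (g x))"
proof -
  obtain q :: "nat poly" where q: "\<And>x. size (b x) \<le> poly q (size x)"
    using poly_time_size_bound[OF b] by blast
  have "size (trec k b s d c) \<le> (2 * size d + 1) * (poly p N + poly q N)"
    if "size c + size d \<le> N" for c d N
    using that
  proof (induction d arbitrary: c)
    case Leaf
    then have "poly q (size c) \<le> poly q N"
      by (intro poly_nat_mono) simp
    then show ?case
      using q[of c] by simp
  next
    case (Node x y)
    let ?K = "poly p N + poly q N"
    have "size (trec k b s x c) \<le> (2 * size x + 1) * ?K"
      using Node by simp
    moreover have "size (trec k b s y (k c)) \<le> (2 * size y + 1) * ?K"
      using Node k(2)[of c] by simp
    moreover have "poly p (size c + size x + size y) \<le> poly p N"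
      using Node.prems by (intro poly_nat_mono) simp
    ultimately have "size (trec k b s (Node x y) c) \<le>
        (2 * size x + 1) * ?K + (2 * size y + 1) * ?K + ?K"
      using h[of c x y "trec k b s x c" "trec k b s y (k c)"]
      by (simp only: trec.simps)
    then show ?case
      by (simp add: algebra_simps)
  qed
  from this[OF order.refl] have "size (trec k b s d c) \<le> poly ([:1, 2:] * (p + q)) (size c + size d)"
    for c d
    by (rule order_trans) (simp add: algebra_simps add_mono)
  from poly_time_trec_bounded[OF k b s this f g] show ?thesis .
qed

section \<open>The simulating vCGS\<close>

text \<open>Prefixing the agents' names with \<open>True\<close> preserves their order and frees the empty name for the
  environment. The pairing \<open>pair_name\<close> marks every bit of its first argument with \<open>True\<close> and its end
  with \<open>False\<close>, which makes the variables of different agents disjoint.\<close>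

fun pair_name :: "name \<Rightarrow> name \<Rightarrow> name" where
  "pair_name [] c = False # c"
| "pair_name (b # a) c = True # b # pair_name a c"

lemma pair_name_inject [simp]: "pair_name a c = pair_name a' c' \<longleftrightarrow> a = a' \<and> c = c'"
proof (induction a c arbitrary: a' rule: pair_name.induct)
  case (1 c)
  then show ?case by (cases a') auto
next
  case (2 b a c)
  then show ?case by (cases a') auto
qed

text \<open>The first bit separates the environment (\<open>False\<close>) from the players
  (\<open>True\<close>). Behind the coded agent name, an empty rest marks the turn variable and a
  leading \<open>True\<close> an action variable.\<close>

abbreviation phase_var :: name where "phase_var \<equiv> [False]"
abbreviation state_var :: "name \<Rightarrow> name" where "state_var q \<equiv> False # True # q"
abbreviation obs_var :: "name \<Rightarrow> name" where "obs_var q \<equiv> False # False # q"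
abbreviation turn_var :: "name \<Rightarrow> name" where "turn_var a \<equiv> True # pair_name a []"
abbreviation act_var :: "name \<Rightarrow> name \<Rightarrow> name" where "act_var a c \<equiv> True # pair_name a (True # c)"

abbreviation agents :: "named_icgs \<Rightarrow> name list" where
  "agents G \<equiv> sorted_list_of_set (Ag G)"

abbreviation states :: "named_icgs \<Rightarrow> name list" where
  "states G \<equiv> sorted_list_of_set (States G)"

text \<open>The dummy action keeps the vCGS well-formed if an agent has no action at all.\<close>

definition actions :: "named_icgs \<Rightarrow> name \<Rightarrow> name list" where
  "actions G a = (if sorted_list_of_set (Act G a) = [] then [[]] else sorted_list_of_set (Act G a))"

text \<open>This is literally the list that \<open>enc_icgs\<close> encodes, so a program can map
  over the given table. The dummy action does not enter, hence the list is empty if some agent has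
  no action.\<close>

definition transitions :: "named_icgs \<Rightarrow> (name \<times> name list \<times> name) list" where
  "transitions G = [(s, cs, \<tau> G s (joint_action (agents G) cs)).
     s \<leftarrow> states G, cs \<leftarrow> product_lists (map (\<lambda>a. sorted_list_of_set (Act G a)) (agents G))]"

text \<open>\<open>turn_var a\<close> is the agent's own copy of the phase; guarding by it keeps the
  availability of commands observable to \<open>a\<close>.\<close>

definition act_command :: "name \<Rightarrow> name \<Rightarrow> (name, name) command" where
  "act_command a c = Command (BNot (BAtom (At (turn_var a))))
     [(At (turn_var a), True), (At (act_var a c), True)]"

text \<open>Clearing all action variables at once makes one command fit every recorded action and
  leaves the agent no choice in phase 1.\<close>

definition reset_command :: "named_icgs \<Rightarrow> name \<Rightarrow> (name, name) command" where
  "reset_command G a = Command (BAtom (At (turn_var a)))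
     ((At (turn_var a), False) # map (\<lambda>c. (At (act_var a c), False)) (actions G a))"

definition player_spec :: "named_icgs \<Rightarrow> name \<Rightarrow> (name, name) agent_spec" where
  "player_spec G a = \<lparr>vars = turn_var a # map (act_var a) (actions G a),
     init_cmds = [Command BTrue []],
     update_cmds = reset_command G a # map (act_command a) (actions G a)\<rparr>"

text \<open>State variables and visibility bits are overwritten completely, so the same list serves
  to initialise and to update from any old state.\<close>

definition env_assigns :: "named_icgs \<Rightarrow> name \<Rightarrow> ((name, name) atom \<times> bool) list" where
  "env_assigns G q = (At phase_var, False) # map (\<lambda>x. (At (state_var x), x = q)) (states G) @
     concat (map (\<lambda>a. map (\<lambda>x. (Vis (obs_var x) (True # a), (q, x) \<in> Indist G a)) (states G)) (agents G))"

definition transition_guard :: "named_icgs \<Rightarrow> name \<Rightarrow> name list \<Rightarrow> (name, name) atom bexp" where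
  "transition_guard G q cs = BAnd (BAtom (At phase_var)) (BAnd (BAtom (At (state_var q)))
     (foldr (\<lambda>(a, c) b. BAnd (BAtom (At (act_var a c))) b) (zip (agents G) cs) BTrue))"

text \<open>Its guard is the negation of all transition guards: some environment command is enabled
  in every valuation, and waiting never competes with a transition. In phase 0 all transition guards
  fail because \<open>phase_var\<close> is false.\<close>

definition wait_command :: "named_icgs \<Rightarrow> (name, name) command" where
  "wait_command G = Command
     (foldr (\<lambda>(q, cs, q') b. BAnd (BNot (transition_guard G q cs)) b) (transitions G) BTrue)
     [(At phase_var, True)]"

definition transition_command :: "named_icgs \<Rightarrow> name \<times> name list \<times> name \<Rightarrow> (name, name) command" where
  "transition_command G = (\<lambda>(q, cs, q'). Command (transition_guard G q cs) (env_assigns G q'))"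

definition env_spec :: "named_icgs \<Rightarrow> (name, name) agent_spec" where
  "env_spec G = \<lparr>vars = phase_var # map state_var (states G) @ map obs_var (states G),
     init_cmds = map (\<lambda>q. Command BTrue (env_assigns G q)) (sorted_list_of_set (Init G)),
     update_cmds = wait_command G # map (transition_command G) (transitions G)\<rparr>"

definition vcgs_of :: "named_icgs \<Rightarrow> named_vcgs" where
  "vcgs_of G = \<lparr>vAg = [] # map ((#) True) (agents G),
     spec = (\<lambda>b. case b of [] \<Rightarrow> env_spec G | _ # a \<Rightarrow> player_spec G a)\<rparr>"

definition phase0_state :: "named_icgs \<Rightarrow> name \<Rightarrow> (name, name) atom set" where
  "phase0_state G q = insert (At (state_var q))
     {Vis (obs_var x) (True # a) | x a. a \<in> Ag G \<and> (q, x) \<in> Indist G a}"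

definition phase1_state :: "named_icgs \<Rightarrow> name \<Rightarrow> (name \<Rightarrow> name) \<Rightarrow> (name, name) atom set" where
  "phase1_state G q \<alpha> = insert (At phase_var) (phase0_state G q \<union>
     (\<lambda>a. At (turn_var a)) ` Ag G \<union> (\<lambda>a. At (act_var a (\<alpha> a))) ` Ag G)"

section \<open>Guards and encoded states: basic facts\<close>

lemma actions_nonempty [simp]: "actions G a \<noteq> []"
  by (simp add: actions_def)

lemma spec_vcgs_of [simp]:
  "spec (vcgs_of G) [] = env_spec G" "spec (vcgs_of G) (b # a) = player_spec G a"
  by (simp_all add: vcgs_of_def)

lemma ctrl_player: "ctrl (vcgs_of G) (b # a) = insert (turn_var a) (act_var a ` set (actions G a))"
  by (auto simp: player_spec_def)

lemma distinct_env_assigns: "distinct (map fst (env_assigns G q))"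
proof -
  have "distinct (map fst (concat (map (\<lambda>a. map (\<lambda>x. (Vis (obs_var x) (True # a),
     (q, x) \<in> Indist G a)) (states G)) as)))" if "distinct as" for as
    using that
    by (induction as) (auto simp: comp_def distinct_map inj_on_def)
  from this[OF distinct_sorted_list_of_set[of "Ag G"]] show ?thesis
    unfolding env_assigns_def by (auto simp: comp_def distinct_map inj_on_def)
qed

lemma beval_foldr_act: "beval s (foldr (\<lambda>(a, c) b. BAnd (BAtom (At (act_var a c))) b) zs BTrue) \<longleftrightarrow>
    (\<forall>(a, c)\<in>set zs. At (act_var a c) \<in> s)"
  by (induction zs) auto

lemma beval_transition_guard: "beval s (transition_guard G q cs) \<longleftrightarrow>
    At phase_var \<in> s \<and> At (state_var q) \<in> s \<and>
    (\<forall>(a, c)\<in>set (zip (agents G) cs). At (act_var a c) \<in> s)"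
  by (simp add: transition_guard_def beval_foldr_act)

lemma beval_wait: "beval s (guard (wait_command G)) \<longleftrightarrow>
    (\<forall>(q, cs, q')\<in>set (transitions G). \<not> beval s (transition_guard G q cs))"
proof -
  have "beval s (foldr (\<lambda>(q, cs, q') b. BAnd (BNot (transition_guard G q cs)) b) ts BTrue) \<longleftrightarrow>
    (\<forall>(q, cs, q')\<in>set ts. \<not> beval s (transition_guard G q cs))" for ts :: "(name \<times> name list \<times> name) list"
    by (induction ts) auto
  then show ?thesis
    by (simp add: wait_command_def)
qed

lemma set_bexp_foldr_act: "set_bexp (foldr (\<lambda>(a, c) b. BAnd (BAtom (At (act_var a c))) b) zs BTrue) =
    (\<lambda>(a, c). At (act_var a c)) ` set zs"
  by (induction zs) auto

lemma enabled_player: "enabled (update_cmds (player_spec G a)) s =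
    (if At (turn_var a) \<in> s then {reset_command G a} else act_command a ` set (actions G a))"
  by (auto simp: enabled_def player_spec_def reset_command_def act_command_def)

lemma enabled_env: "enabled (update_cmds (env_spec G)) s =
    (if beval s (guard (wait_command G)) then {wait_command G} else {}) \<union>
    transition_command G ` {z \<in> set (transitions G). beval s (transition_guard G (fst z) (fst (snd z)))}"
proof -
  have "guard (transition_command G z) = transition_guard G (fst z) (fst (snd z))" for z
    by (simp add: transition_command_def split_beta)
  then show ?thesis
    by (auto simp: enabled_def env_spec_def)
qed

lemma At_phase0 [simp]: "At v \<in> phase0_state G q \<longleftrightarrow> v = state_var q"
  by (auto simp: phase0_state_def)

lemma Vis_phase0 [simp]: "Vis v b \<in> phase0_state G q \<longleftrightarrow>
    (\<exists>x a. v = obs_var x \<and> b = True # a \<and> a \<in> Ag G \<and> (q, x) \<in> Indist G a)"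
  by (auto simp: phase0_state_def)

lemma At_phase1 [simp]: "At v \<in> phase1_state G q \<alpha> \<longleftrightarrow> v = phase_var \<or> v = state_var q \<or>
    (\<exists>a\<in>Ag G. v = turn_var a \<or> v = act_var a (\<alpha> a))"
  by (auto simp: phase1_state_def)

lemma Vis_phase1 [simp]: "Vis v b \<in> phase1_state G q \<alpha> \<longleftrightarrow>
    (\<exists>x a. v = obs_var x \<and> b = True # a \<and> a \<in> Ag G \<and> (q, x) \<in> Indist G a)"
  by (auto simp: phase1_state_def)

lemma phase0_inject [simp]: "phase0_state G q = phase0_state G q' \<longleftrightarrow> q = q'"
proof
  assume "phase0_state G q = phase0_state G q'"
  then have "At (state_var q) \<in> phase0_state G q'"
    using At_phase0 by blast
  then show "q = q'"
    by simp
qed simp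

lemma atom_set_eqI:
  assumes "\<And>v. At v \<in> S \<longleftrightarrow> At v \<in> T" "\<And>v b. Vis v b \<in> S \<longleftrightarrow> Vis v b \<in> T"
  shows "S = T"
proof (rule set_eqI)
  show "x \<in> S \<longleftrightarrow> x \<in> T" for x
    using assms by (cases x) simp_all
qed

lemma vindist_refl: "s \<in> vstates D \<Longrightarrow> (s, s) \<in> vindist D b"
  by (simp add: vindist_def)

lemma vindist_sym: "(s, t) \<in> vindist D b \<Longrightarrow> (t, s) \<in> vindist D b"
  unfolding vindist_def by blast

lemma vindist_trans:
  "(s, t) \<in> vindist D b \<Longrightarrow> (t, u) \<in> vindist D b \<Longrightarrow>
   (s, u) \<in> vindist D b"
  unfolding vindist_def by (simp (no_asm_use)) blast

section \<open>Well-formedness, initial states and indistinguishability\<close>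

context
  fixes G :: named_icgs
  assumes G: "finite_icgs G"
begin

lemma finite_parts:
  "finite (Ag G)" "a \<in> Ag G \<Longrightarrow> finite (Act G a)" "finite (States G)" "Init G \<subseteq> States G"
  "s \<in> States G \<Longrightarrow> \<alpha> \<in> (\<Pi>\<^sub>E a\<in>Ag G. Act G a) \<Longrightarrow> \<tau> G s \<alpha> \<in> States G"
  "a \<in> Ag G \<Longrightarrow> equiv (States G) (Indist G a)"
  "s \<in> States G \<Longrightarrow> \<pi> G s \<subseteq> Props G" "finite (Props G)"
  using G unfolding finite_icgs_def by blast+

lemma set_agents [simp]: "set (agents G) = Ag G"
  using finite_parts(1) by simp

lemma set_states [simp]: "set (states G) = States G"
  using finite_parts(3) by simp

lemma set_init [simp]: "set (sorted_list_of_set (Init G)) = Init G"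
  using finite_subset[OF finite_parts(4,3)] by simp

lemma set_actions_superset: "a \<in> Ag G \<Longrightarrow> Act G a \<subseteq> set (actions G a)"
  using finite_parts(2)[of a] by (auto simp: actions_def)

lemma set_actions: "a \<in> Ag G \<Longrightarrow> Act G a \<noteq> {} \<Longrightarrow> set (actions G a) = Act G a"
  using finite_parts(2)[of a] by (simp add: actions_def)

lemma IndistD: "a \<in> Ag G \<Longrightarrow> (q, x) \<in> Indist G a \<Longrightarrow> q \<in> States G \<and> x \<in> States G"
  using finite_parts(6)[of a] unfolding equiv_def refl_on_def by blast

text \<open>As \<open>agents G\<close> has no repetitions, looking up an agent in the zipped list
  recovers its entry, so the action lists of the table are the joint actions read along the
  agents.\<close>

lemma set_product_lists_agents:
  "cs \<in> set (product_lists (map (\<lambda>a. sorted_list_of_set (Act G a)) (agents G))) \<longleftrightarrow>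
     (\<exists>\<alpha> \<in> (\<Pi>\<^sub>E a\<in>Ag G. Act G a). cs = map \<alpha> (agents G))" (is "?L \<longleftrightarrow> ?R")
proof
  assume ?L
  then have l: "list_all2 (\<lambda>x ys. x \<in> set ys) cs (map (\<lambda>a. sorted_list_of_set (Act G a)) (agents G))"
    by (simp add: product_lists_set)
  then have len: "length cs = length (agents G)"
    using list_all2_lengthD by fastforce
  have nth: "cs ! i \<in> Act G (agents G ! i)" if "i < length (agents G)" for i
    using list_all2_nthD2[OF l, of i] that finite_parts(2)[of "agents G ! i"] nth_mem[OF that]
    by (simp del: nth_mem)
  have m: "joint_action (agents G) cs (agents G ! i) = cs ! i" if "i < length (agents G)" for i
    using that len map_of_zip_nth[of "agents G" cs i] nth_mem[OF that]
    by (simp add: joint_action_def del: nth_mem)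
  have "cs = map (joint_action (agents G) cs) (agents G)"
    using len m by (intro nth_equalityI) auto
  moreover have "joint_action (agents G) cs \<in> (\<Pi>\<^sub>E a\<in>Ag G. Act G a)"
  proof (rule PiE_I)
    fix a
    assume "a \<in> Ag G"
    then obtain i where "i < length (agents G)" "agents G ! i = a"
      using in_set_conv_nth set_agents by metis
    then show "joint_action (agents G) cs a \<in> Act G a"
      using nth m by metis
  qed (simp add: joint_action_def)
  ultimately show ?R
    by blast
next
  assume ?R
  then obtain \<alpha> where \<alpha>: "\<alpha> \<in> (\<Pi>\<^sub>E a\<in>Ag G. Act G a)" "cs = map \<alpha> (agents G)"
    by blast
  then have "\<alpha> a \<in> set (sorted_list_of_set (Act G a))" if "a \<in> set (agents G)" for a
    using that finite_parts(2)[of a] by (simp add: PiE_mem)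
  then show ?L
    unfolding product_lists_set \<alpha>(2) mem_Collect_eq list_all2_map1 list_all2_map2
    by (simp add: list_all2_same)
qed

lemma joint_action_map:
  assumes "\<alpha> \<in> (\<Pi>\<^sub>E a\<in>Ag G. Act G a)"
  shows "joint_action (agents G) (map \<alpha> (agents G)) = \<alpha>"
proof (rule ext)
  show "joint_action (agents G) (map \<alpha> (agents G)) a = \<alpha> a" for a
    using PiE_arb[OF assms, of a] by (cases "a \<in> Ag G") (simp_all add: joint_action_def map_of_zip_map)
qed

lemma set_transitions:
  "set (transitions G) =
     {(q, map \<alpha> (agents G), \<tau> G q \<alpha>) | q \<alpha>. q \<in> States G \<and> \<alpha> \<in> (\<Pi>\<^sub>E a\<in>Ag G. Act G a)}"
proof -
  have "set (transitions G) = {(q, cs, \<tau> G q (joint_action (agents G) cs)) | q cs.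
      q \<in> States G \<and> (\<exists>\<alpha> \<in> (\<Pi>\<^sub>E a\<in>Ag G. Act G a). cs = map \<alpha> (agents G))}"
    unfolding transitions_def set_product_lists_agents[symmetric] by (auto simp: finite_parts)
  also have "\<dots> = {(q, map \<alpha> (agents G), \<tau> G q \<alpha>) | q \<alpha>. q \<in> States G \<and> \<alpha> \<in> (\<Pi>\<^sub>E a\<in>Ag G. Act G a)}"
    using joint_action_map by (auto; metis)
  finally show ?thesis .
qed

lemma vAg_vcgs_of [simp]: "set (vAg (vcgs_of G)) = insert [] ((#) True ` Ag G)"
  by (simp add: vcgs_of_def finite_parts)

lemma ctrl_env: "ctrl (vcgs_of G) [] = {phase_var} \<union> state_var ` States G \<union> obs_var ` States G"
  by (auto simp: env_spec_def finite_parts)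

lemma controlled_env: "controlled (vcgs_of G) [] =
    At ` ({phase_var} \<union> state_var ` States G \<union> obs_var ` States G) \<union>
    {Vis v (True # a) | v a. v \<in> {phase_var} \<union> state_var ` States G \<union> obs_var ` States G \<and> a \<in> Ag G}"
  unfolding controlled_def ctrl_env vAg_vcgs_of by blast

lemma controlled_player: "controlled (vcgs_of G) (True # a) =
    At ` insert (turn_var a) (act_var a ` set (actions G a)) \<union>
    {Vis v b | v b. v \<in> insert (turn_var a) (act_var a ` set (actions G a)) \<and>
       b \<in> insert [] ((#) True ` Ag G) \<and> b \<noteq> True # a}"
  unfolding controlled_def ctrl_player vAg_vcgs_of by blast

lemma atoms_memI:
  "At phase_var \<in> atoms (vcgs_of G)"
  "q \<in> States G \<Longrightarrow> At (state_var q) \<in> atoms (vcgs_of G)"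
  "q \<in> States G \<Longrightarrow> a \<in> Ag G \<Longrightarrow> Vis (obs_var q) (True # a) \<in> atoms (vcgs_of G)"
  "a \<in> Ag G \<Longrightarrow> At (turn_var a) \<in> atoms (vcgs_of G)"
  "a \<in> Ag G \<Longrightarrow> c \<in> set (actions G a) \<Longrightarrow> At (act_var a c) \<in> atoms (vcgs_of G)"
proof -
  have At: "At v \<in> atoms (vcgs_of G)"
    if "b \<in> set (vAg (vcgs_of G))" "v \<in> ctrl (vcgs_of G) b" for v b
    using that unfolding atoms_def controlled_def by blast
  have Vis: "Vis v c \<in> atoms (vcgs_of G)"
    if "b \<in> set (vAg (vcgs_of G))" "c \<in> set (vAg (vcgs_of G))" "b \<noteq> c" "v \<in> ctrl (vcgs_of G) b" for v b c
    using that unfolding atoms_def controlled_def by blast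
  show "At phase_var \<in> atoms (vcgs_of G)"
    by (rule At[of "[]"]) (simp_all add: ctrl_env del: spec_vcgs_of)
  show "q \<in> States G \<Longrightarrow> At (state_var q) \<in> atoms (vcgs_of G)"
    by (rule At[of "[]"]) (simp_all add: ctrl_env del: spec_vcgs_of)
  show "q \<in> States G \<Longrightarrow> a \<in> Ag G \<Longrightarrow> Vis (obs_var q) (True # a) \<in> atoms (vcgs_of G)"
    by (rule Vis[of "[]"]) (simp_all add: ctrl_env del: spec_vcgs_of)
  show "a \<in> Ag G \<Longrightarrow> At (turn_var a) \<in> atoms (vcgs_of G)"
    by (rule At[of "True # a"]) (simp_all add: ctrl_player del: spec_vcgs_of)
  show "a \<in> Ag G \<Longrightarrow> c \<in> set (actions G a) \<Longrightarrow> At (act_var a c) \<in> atoms (vcgs_of G)"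
    by (rule At[of "True # a"]) (simp_all add: ctrl_player del: spec_vcgs_of)
qed

lemma set_env_assigns: "set (env_assigns G q) = insert (At phase_var, False)
    ((\<lambda>x. (At (state_var x), x = q)) ` States G \<union>
     {(Vis (obs_var x) (True # a), (q, x) \<in> Indist G a) | x a. x \<in> States G \<and> a \<in> Ag G})"
  unfolding env_assigns_def by (auto simp: finite_parts)

lemma set_bexp_transition_guard:
  assumes "(q, cs, q') \<in> set (transitions G)"
  shows "set_bexp (transition_guard G q cs) \<subseteq> atoms (vcgs_of G)"
proof -
  obtain \<alpha> where \<alpha>: "cs = map \<alpha> (agents G)" "q \<in> States G" "\<alpha> \<in> (\<Pi>\<^sub>E a\<in>Ag G. Act G a)"
    using assms unfolding set_transitions by auto
  have "(\<lambda>(a, c). At (act_var a c)) ` set (zip (agents G) cs) \<subseteq> atoms (vcgs_of G)"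
    using \<alpha> set_actions_superset atoms_memI(5) PiE_mem[OF \<alpha>(3)]
    by (fastforce simp: zip_map2 zip_same_conv_map finite_parts)
  then show ?thesis
    using \<alpha>(2) atoms_memI(1,2) by (simp add: transition_guard_def set_bexp_foldr_act)
qed

lemma set_bexp_wait: "set_bexp (guard (wait_command G)) \<subseteq> atoms (vcgs_of G)"
proof -
  have "set_bexp (foldr (\<lambda>(q, cs, q') b. BAnd (BNot (transition_guard G q cs)) b) ts BTrue) =
    (\<Union>(q, cs, q')\<in>set ts. set_bexp (transition_guard G q cs))" for ts :: "(name \<times> name list \<times> name) list"
    by (induction ts) auto
  then show ?thesis
    using set_bexp_transition_guard unfolding wait_command_def by fastforce
qed

text \<open>Nobody is ever stuck: a player's guards split on its turn variable and it has at least
  one action, while the environment waits whenever no transition command applies. Disjointness of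
  variables is due to the choice of names.\<close>

lemma wf_vcgs_of: "wf_vcgs (vcgs_of G)"
  unfolding wf_vcgs_def
proof (intro conjI ballI impI)
  fix a b
  assume "a \<in> set (vAg (vcgs_of G))" "b \<in> set (vAg (vcgs_of G))" "a \<noteq> b"
  then show "ctrl (vcgs_of G) a \<inter> ctrl (vcgs_of G) b = {}"
    unfolding vAg_vcgs_of by (auto simp: ctrl_env ctrl_player simp del: spec_vcgs_of)
next
  have env_assigns: "fst ` set (env_assigns G q) \<subseteq> controlled (vcgs_of G) []" for q
    unfolding set_env_assigns controlled_env by auto
  fix b c
  assume b: "b \<in> set (vAg (vcgs_of G))"
    and c: "c \<in> set (init_cmds (spec (vcgs_of G) b)) \<union> set (update_cmds (spec (vcgs_of G) b))"
  show "wf_command (vcgs_of G) b c"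
  proof (cases "b = []")
    case True
    then consider q where "c = Command BTrue (env_assigns G q)" | "c = wait_command G"
      | z where "z \<in> set (transitions G)" "c = transition_command G z"
      using c by (auto simp: env_spec_def)
    then show ?thesis
    proof cases
      case 1
      then show ?thesis
        using True env_assigns distinct_env_assigns by (simp add: wf_command_def)
    next
      case 2
      have "fst ` set (assigns c) \<subseteq> controlled (vcgs_of G) []"
        unfolding 2 controlled_env by (auto simp: wait_command_def)
      then show ?thesis
        using True 2 set_bexp_wait by (simp add: wf_command_def) (simp add: wait_command_def)
    next
      case 3
      then show ?thesis
        using True env_assigns distinct_env_assigns
          set_bexp_transition_guard[of "fst z" "fst (snd z)" "snd (snd z)"]
        by (simp add: wf_command_def transition_command_def split_beta)
    qed
  next
    case False
    then obtain a where a: "b = True # a" "a \<in> Ag G"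
      using b by auto
    then consider "c = Command BTrue []" | "c = reset_command G a"
      | d where "d \<in> set (actions G a)" "c = act_command a d"
      using c by (auto simp: player_spec_def)
    then show ?thesis
    proof cases
      case 1
      then show ?thesis
        by (simp add: wf_command_def)
    next
      case 2
      have "fst ` set (assigns c) \<subseteq> controlled (vcgs_of G) (True # a)"
        unfolding 2 controlled_player by (auto simp: reset_command_def)
      moreover have "distinct (map fst (assigns c))"
        unfolding 2 by (auto simp: reset_command_def comp_def distinct_map inj_on_def actions_def)
      ultimately show ?thesis
        using a 2 atoms_memI(4) by (simp add: wf_command_def) (simp add: reset_command_def)
    next
      case 3
      have "fst ` set (assigns c) \<subseteq> controlled (vcgs_of G) (True # a)"
        unfolding 3 controlled_player using 3(1) by (auto simp: act_command_def)
      then show ?thesis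
        using a 3 atoms_memI(4) by (simp add: wf_command_def) (simp add: act_command_def)
    qed
  qed
next
  fix b s
  assume "b \<in> set (vAg (vcgs_of G))"
  then consider "b = []" | a where "b = True # a"
    by auto
  then show "enabled (update_cmds (spec (vcgs_of G) b)) s \<noteq> {}"
  proof cases
    case 1
    then show ?thesis
      using beval_wait[of s G] by (fastforce simp: enabled_env)
  next
    case 2
    then show ?thesis
      by (simp add: enabled_player)
  qed
qed

lemma phase0_in_vstates: "q \<in> States G \<Longrightarrow> phase0_state G q \<in> vstates (vcgs_of G)"
  using atoms_memI(2,3) IndistD unfolding vstates_def phase0_state_def by fast

lemma phase1_in_vstates:
  assumes "q \<in> States G" "\<alpha> \<in> (\<Pi>\<^sub>E a\<in>Ag G. Act G a)"
  shows "phase1_state G q \<alpha> \<in> vstates (vcgs_of G)"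
proof -
  have "\<alpha> a \<in> set (actions G a)" if "a \<in> Ag G" for a
    using assms(2) that set_actions_superset by (meson PiE_mem in_mono)
  then show ?thesis
    using phase0_in_vstates[OF assms(1)] atoms_memI(1,4,5)
    unfolding vstates_def phase1_state_def by blast
qed

lemma execute_vcgs_of: "x \<in> execute (vcgs_of G) s \<beta> \<longleftrightarrow>
    (x, True) \<in> set (assigns (\<beta> [])) \<or> (\<exists>a\<in>Ag G. (x, True) \<in> set (assigns (\<beta> (True # a)))) \<or>
    x \<in> s \<and> (x, False) \<notin> set (assigns (\<beta> [])) \<and>
    (\<forall>a\<in>Ag G. (x, False) \<notin> set (assigns (\<beta> (True # a))))"
  unfolding execute_def vAg_vcgs_of by blast

text \<open>The all-false valuation already suits the players, whose only init command is empty; the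
  initial state is the environment's choice.\<close>

lemma vinit_vcgs_of: "vinit (vcgs_of G) = phase0_state G ` Init G"
proof -
  have cmd: "enabled (init_cmds (player_spec G a)) {} = {Command BTrue []}"
    "enabled (init_cmds (env_spec G)) {} = (\<lambda>q. Command BTrue (env_assigns G q)) ` Init G" for a
    by (auto simp: enabled_def player_spec_def env_spec_def simp del: sorted_list_of_set)
  have ex: "execute (vcgs_of G) {} \<beta> = phase0_state G q"
    if "q \<in> Init G" "\<beta> [] = Command BTrue (env_assigns G q)"
      "\<And>a. a \<in> Ag G \<Longrightarrow> \<beta> (True # a) = Command BTrue []" for \<beta> q
    by (rule atom_set_eqI)
      (use that finite_parts(4) IndistD in \<open>auto simp: execute_vcgs_of set_env_assigns\<close>)
  show ?thesis
  proof
    show "vinit (vcgs_of G) \<subseteq> phase0_state G ` Init G"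
    proof
      fix s
      assume "s \<in> vinit (vcgs_of G)"
      then obtain \<beta> where \<beta>: "s = execute (vcgs_of G) {} \<beta>"
        "\<beta> \<in> (\<Pi>\<^sub>E b\<in>set (vAg (vcgs_of G)). enabled (init_cmds (spec (vcgs_of G) b)) {})"
        unfolding vinit_def by blast
      have "\<beta> [] \<in> (\<lambda>q. Command BTrue (env_assigns G q)) ` Init G"
        using PiE_mem[OF \<beta>(2), of "[]"] cmd by simp
      moreover have "\<beta> (True # a) = Command BTrue []" if "a \<in> Ag G" for a
        using PiE_mem[OF \<beta>(2), of "True # a"] cmd that by simp
      ultimately show "s \<in> phase0_state G ` Init G"
        using ex \<beta>(1) by blast
    qed
    show "phase0_state G ` Init G \<subseteq> vinit (vcgs_of G)"
    proof
      fix s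
      assume "s \<in> phase0_state G ` Init G"
      then obtain q where q: "q \<in> Init G" "s = phase0_state G q"
        by blast
      define \<beta> where "\<beta> = (\<lambda>b\<in>set (vAg (vcgs_of G)).
        if b = [] then Command BTrue (env_assigns G q) else Command BTrue [])"
      have "\<beta> \<in> (\<Pi>\<^sub>E b\<in>set (vAg (vcgs_of G)). enabled (init_cmds (spec (vcgs_of G) b)) {})"
        using q cmd by (auto simp: \<beta>_def)
      moreover have "execute (vcgs_of G) {} \<beta> = s"
        unfolding q(2) by (rule ex[OF q(1)]) (simp_all add: \<beta>_def)
      ultimately show "s \<in> vinit (vcgs_of G)"
        unfolding vinit_def by blast
    qed
  qed
qed

lemma vindist_iff:
  assumes "a \<in> Ag G" "s \<in> vstates (vcgs_of G)" "t \<in> vstates (vcgs_of G)"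
  shows "(s, t) \<in> vindist (vcgs_of G) (True # a) \<longleftrightarrow>
    (\<forall>x\<in>controlled (vcgs_of G) (True # a). x \<in> s \<longleftrightarrow> x \<in> t) \<and>
    (\<forall>v \<in> ctrl (vcgs_of G) [] \<union> (\<Union>b\<in>Ag G - {a}. ctrl (vcgs_of G) (True # b)).
        (Vis v (True # a) \<in> s \<longleftrightarrow> Vis v (True # a) \<in> t) \<and>
        (Vis v (True # a) \<in> s \<longrightarrow> (At v \<in> s \<longleftrightarrow> At v \<in> t)))"
  using assms unfolding vindist_def vAg_vcgs_of by (auto simp del: spec_vcgs_of)

text \<open>In phase 0 the agent's own atoms and the dummies are false, so only the rows of
  visibility bits count. They list the classes of \<open>q\<close> and \<open>q'\<close>, and these
  coincide exactly if the two states are related.\<close>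

lemma vindist_phase0:
  assumes "a \<in> Ag G" "q \<in> States G" "q' \<in> States G"
  shows "(phase0_state G q, phase0_state G q') \<in> vindist (vcgs_of G) (True # a) \<longleftrightarrow>
    (q, q') \<in> Indist G a"
proof -
  have "(phase0_state G q, phase0_state G q') \<in> vindist (vcgs_of G) (True # a) \<longleftrightarrow>
      (\<forall>x\<in>States G. (q, x) \<in> Indist G a \<longleftrightarrow> (q', x) \<in> Indist G a)"
    using assms phase0_in_vstates
    by (subst vindist_iff) (auto simp: controlled_player ctrl_env ctrl_player simp del: spec_vcgs_of)
  also have "\<dots> \<longleftrightarrow> (q, q') \<in> Indist G a"
    using finite_parts(6)[OF assms(1)] assms(2,3)
    by (meson equivE refl_onD symD transE)
  finally show ?thesis .
qed

text \<open>The visibility bits are carried over from phase 0 and recorded actions are hidden from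
  others, so the own action is all that \<open>a\<close> additionally sees.\<close>

lemma vindist_phase1:
  assumes "a \<in> Ag G" "q \<in> States G" "q' \<in> States G" "(q, q') \<in> Indist G a"
    and "\<alpha> \<in> (\<Pi>\<^sub>E a\<in>Ag G. Act G a)" "\<alpha>' \<in> (\<Pi>\<^sub>E a\<in>Ag G. Act G a)" "\<alpha> a = \<alpha>' a"
  shows "(phase1_state G q \<alpha>, phase1_state G q' \<alpha>') \<in> vindist (vcgs_of G) (True # a)"
proof -
  have "\<forall>x. (q, x) \<in> Indist G a \<longleftrightarrow> (q', x) \<in> Indist G a"
    using finite_parts(6)[OF assms(1)] assms(2-4)
    by (meson equivE refl_onD symD transE)
  then show ?thesis
    using assms phase1_in_vstates
    by (subst vindist_iff) (auto simp: controlled_player ctrl_env ctrl_player simp del: spec_vcgs_of)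
qed

text \<open>A player's available commands depend on its turn variable only, so they are determined
  by what it observes.\<close>

lemma vindist_own: "a \<in> Ag G \<Longrightarrow> (s, t) \<in> vindist (vcgs_of G) (True # a) \<Longrightarrow>
    At (turn_var a) \<in> s \<longleftrightarrow> At (turn_var a) \<in> t"
  unfolding vindist_def controlled_player by blast

end

section \<open>Translation of formulas\<close>

text \<open>The syntax has no constants; \<open>phase_var\<close> is an atom of every simulating
  vCGS.\<close>

definition sfm_false :: "((name, name) atom, name) sfm" where
  "sfm_false = SAnd (Prop (At phase_var)) (SNot (Prop (At phase_var)))"

definition sfm_true :: "((name, name) atom, name) sfm" where
  "sfm_true = SNot sfm_false"

text \<open>\<open>is_ATL\<close> demands \<open>St\<close> directly below a temporal operator, so a
  state formula must be turned into a state formula; the same holds for the two functions that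
  follow.\<close>

fun or_phase1 :: "((name, name) atom, name) pfm \<Rightarrow> ((name, name) atom, name) pfm" where
  "or_phase1 (St \<phi>) = St (SNot (SAnd (SNot (Prop (At phase_var))) (SNot \<phi>)))"
| "or_phase1 \<psi> = PNot (PAnd (St (SNot (Prop (At phase_var)))) (PNot \<psi>))"

fun and_phase0 :: "((name, name) atom, name) pfm \<Rightarrow> ((name, name) atom, name) pfm" where
  "and_phase0 (St \<phi>) = St (SAnd (SNot (Prop (At phase_var))) \<phi>)"
| "and_phase0 \<psi> = PAnd (St (SNot (Prop (At phase_var)))) \<psi>"

fun next_phase0 :: "((name, name) atom, name) pfm \<Rightarrow> ((name, name) atom, name) pfm" where
  "next_phase0 (St \<phi>) = Next (St (Coal {} (Next (St \<phi>))))"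
| "next_phase0 \<psi> = Next (Next \<psi>)"

definition idle_agents :: "named_icgs \<Rightarrow> name set" where
  "idle_agents G = {a \<in> Ag G. Act G a = {}}"

text \<open>Atoms of the vCGS describe states and not labels, so a proposition becomes the
  disjunction, written with negation and conjunction, of the states labelled with it. Every other
  operator adds at most a constant number of symbols, apart from the prefixed agent names.\<close>

primrec trans_sfm :: "named_icgs \<Rightarrow> (name, name) sfm \<Rightarrow> ((name, name) atom, name) sfm"
  and trans_pfm :: "named_icgs \<Rightarrow> (name, name) pfm \<Rightarrow> ((name, name) atom, name) pfm" where
  "trans_sfm G (Prop p) = SNot (foldr (\<lambda>q \<phi>. if p \<in> \<pi> G q
     then SAnd (SNot (Prop (At (state_var q)))) \<phi> else \<phi>) (states G) sfm_true)"
| "trans_sfm G (SNot \<phi>) = SNot (trans_sfm G \<phi>)"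
| "trans_sfm G (SAnd \<phi> \<psi>) = SAnd (trans_sfm G \<phi>) (trans_sfm G \<psi>)"
| "trans_sfm G (Coal A \<psi>) = (if idle_agents G = {} then Coal ((#) True ` A) (trans_pfm G \<psi>)
     else if A \<inter> idle_agents G = {} then sfm_true else sfm_false)"
| "trans_pfm G (St \<phi>) = St (trans_sfm G \<phi>)"
| "trans_pfm G (PNot \<psi>) = PNot (trans_pfm G \<psi>)"
| "trans_pfm G (PAnd \<psi> \<chi>) = PAnd (trans_pfm G \<psi>) (trans_pfm G \<chi>)"
| "trans_pfm G (Next \<psi>) = next_phase0 (trans_pfm G \<psi>)"
| "trans_pfm G (Until \<psi> \<chi>) = Until (or_phase1 (trans_pfm G \<psi>)) (and_phase0 (trans_pfm G \<chi>))"
| "trans_pfm G (Release \<psi> \<chi>) = Release (and_phase0 (trans_pfm G \<psi>)) (or_phase1 (trans_pfm G \<chi>))"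

lemma is_ATL_true [simp]: "is_ATL sfm_true" and is_ATL_false [simp]: "is_ATL sfm_false"
  by (simp_all add: sfm_true_def sfm_false_def)

lemma is_ATL_trans_sfm: "is_ATL \<phi> \<Longrightarrow> is_ATL (trans_sfm G \<phi>)"
proof (induction \<phi> rule: is_ATL.induct)
  case (1 p)
  have "is_ATL (foldr (\<lambda>q \<phi>. if p \<in> \<pi> G q
     then SAnd (SNot (Prop (At (state_var q)))) \<phi> else \<phi>) qs sfm_true)" for qs
    by (induction qs) auto
  then show ?case
    by simp
qed auto

lemma ssat_true [simp]: "ssat M s sfm_true" and ssat_false [simp]: "\<not> ssat M s sfm_false"
  by (simp_all add: sfm_true_def sfm_false_def)

lemma psat_or_phase1: "psat (vcgs_game D) p (or_phase1 \<psi>) \<longleftrightarrow>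
    At phase_var \<in> p 0 \<or> psat (vcgs_game D) p \<psi>"
  by (cases \<psi>) (auto simp: vcgs_game_def)

lemma psat_and_phase0: "psat (vcgs_game D) p (and_phase0 \<psi>) \<longleftrightarrow>
    At phase_var \<notin> p 0 \<and> psat (vcgs_game D) p \<psi>"
  by (cases \<psi>) (auto simp: vcgs_game_def)

text \<open>This is the shape of \<open>Until\<close>, and of a negated \<open>Release\<close>,
  after relativisation to even positions.\<close>

lemma even_Ex_All_iff:
  "(\<exists>n. even n \<and> Q n \<and> (\<forall>m<n. even m \<longrightarrow> R m)) \<longleftrightarrow> (\<exists>k. Q (2 * k) \<and> (\<forall>j<k. R (2 * j)))"
  for Q R :: "nat \<Rightarrow> bool"
proof
  assume "\<exists>n. even n \<and> Q n \<and> (\<forall>m<n. even m \<longrightarrow> R m)"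
  then obtain k where "Q (2 * k)" "\<forall>m<2 * k. even m \<longrightarrow> R m"
    by (auto elim!: evenE)
  then show "\<exists>k. Q (2 * k) \<and> (\<forall>j<k. R (2 * j))"
    by auto
next
  assume "\<exists>k. Q (2 * k) \<and> (\<forall>j<k. R (2 * j))"
  then obtain k where "Q (2 * k)" "\<forall>j<k. R (2 * j)"
    by blast
  then have "even (2 * k) \<and> Q (2 * k) \<and> (\<forall>m<2 * k. even m \<longrightarrow> R m)"
    by (auto elim!: evenE)
  then show "\<exists>n. even n \<and> Q n \<and> (\<forall>m<n. even m \<longrightarrow> R m)"
    by blast
qed

lemma act_command_inject [simp]: "act_command a c = act_command a c' \<longleftrightarrow> c = c'"
  by (simp add: act_command_def)

lemma list_all2_last:
  assumes "list_all2 R h h'" "h \<noteq> []"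
  shows "R (last h) (last h')"
  using assms by (metis last_conv_nth list_all2_lengthD list_all2_nthD length_0_conv diff_less
      length_greater_0_conv zero_less_one)

lemma upt_double_Suc: "[0..<Suc (2 * Suc i)] = [0..<Suc (2 * i)] @ [2 * i + 1, 2 * i + 2]"
  by simp

section \<open>Preservation of truth\<close>

context
  fixes G :: named_icgs
  assumes G: "finite_icgs G"
begin

lemma sfm_over_trans_sfm:
  "sfm_over (Props G) (Ag G) \<phi> \<Longrightarrow>
     sfm_over (atoms (vcgs_of G)) (set (vAg (vcgs_of G))) (trans_sfm G \<phi>)"
  "pfm_over (Props G) (Ag G) \<psi> \<Longrightarrow>
     pfm_over (atoms (vcgs_of G)) (set (vAg (vcgs_of G))) (trans_pfm G \<psi>)"
proof (induction \<phi> and \<psi>)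
  case (Prop p)
  have "sfm_over (atoms (vcgs_of G)) N (foldr (\<lambda>q \<phi>. if p \<in> \<pi> G q
     then SAnd (SNot (Prop (At (state_var q)))) \<phi> else \<phi>) qs sfm_true)"
    if "set qs \<subseteq> States G" for qs N
    using that atoms_memI(1,2)[OF G] by (induction qs) (auto simp: sfm_true_def sfm_false_def)
  from this[of "states G"] show ?case
    using set_states[OF G] by simp
next
  case (Coal A \<psi>)
  then show ?case
    using atoms_memI(1)[OF G] vAg_vcgs_of[OF G] by (auto simp: sfm_true_def sfm_false_def)
next
  case (Next \<psi>)
  then show ?case
    by (cases "trans_pfm G \<psi>") simp_all
next
  case (Until \<psi> \<chi>)
  then show ?case
    using atoms_memI(1)[OF G]
    by (cases "trans_pfm G \<psi>"; cases "trans_pfm G \<chi>") simp_all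
next
  case (Release \<psi> \<chi>)
  then show ?case
    using atoms_memI(1)[OF G]
    by (cases "trans_pfm G \<psi>"; cases "trans_pfm G \<chi>") simp_all
qed simp_all

lemma ssat_trans_Prop:
  assumes "q \<in> States G"
  shows "ssat (vcgs_game D) (phase0_state G q) (trans_sfm G (Prop p)) \<longleftrightarrow> p \<in> \<pi> G q"
proof -
  have sat: "ssat (vcgs_game D) s (foldr (\<lambda>q \<phi>. if p \<in> \<pi> G q
     then SAnd (SNot (Prop (At (state_var q)))) \<phi> else \<phi>) qs sfm_true) \<longleftrightarrow>
    (\<forall>q\<in>set qs. p \<in> \<pi> G q \<longrightarrow> At (state_var q) \<notin> s)" for s qs
    by (induction qs) (auto simp: vcgs_game_def)
  show ?thesis
    unfolding trans_sfm.simps ssat.simps sat set_states[OF G] At_phase0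
    using assms by simp
qed

text \<open>If some agent has no action then there are no plays at all, so a coalition wins vacuously
  exactly when all its members have a strategy.\<close>

lemma ssat_trans_idle:
  assumes "idle_agents G \<noteq> {}" "q \<in> States G"
  shows "sfm_over (Props G) (Ag G) \<phi> \<Longrightarrow>
    ssat (icgs_game G) q \<phi> \<longleftrightarrow> ssat (vcgs_game D) (phase0_state G q) (trans_sfm G \<phi>)"
\<comment> \<open>Nothing has to be claimed about path formulas, since every coalition formula is
  translated into a constant.\<close>
proof (induction \<phi> rule: sfm.induct[where ?P2.0 = "\<lambda>_. True"])
  case (Prop p)
  show ?case
    unfolding ssat_trans_Prop[OF assms(2)] by (simp add: icgs_game_def)
next
  case (Coal A \<psi>)
  obtain b where b: "b \<in> Ag G" "Act G b = {}"
    using assms(1) unfolding idle_agents_def by blast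
  have none: "outcomes (icgs_game G) q A F = {}" for F
    using b by (auto simp: outcomes_def icgs_game_def PiE_eq_empty_iff)
  have ex: "(\<exists>f. uniform_strategy (icgs_game G) a f) \<longleftrightarrow> Act G a \<noteq> {}" for a
  proof
    assume "\<exists>f. uniform_strategy (icgs_game G) a f"
    then obtain f where "uniform_strategy (icgs_game G) a f"
      by blast
    moreover have "[q] \<in> histories (icgs_game G)"
      using assms(2) by (simp add: histories_def icgs_game_def)
    ultimately show "Act G a \<noteq> {}"
      unfolding uniform_strategy_def by (auto simp: icgs_game_def)
  next
    assume "Act G a \<noteq> {}"
    then obtain c where "c \<in> Act G a"
      by blast
    then have "uniform_strategy (icgs_game G) a (\<lambda>_. c)"
      by (simp add: uniform_strategy_def icgs_game_def)
    then show "\<exists>f. uniform_strategy (icgs_game G) a f"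
      by blast
  qed
  have "ssat (icgs_game G) q (Coal A \<psi>) \<longleftrightarrow> (\<forall>a\<in>A. Act G a \<noteq> {})"
    unfolding ssat.simps none using ex by (auto; metis)
  also have "\<dots> \<longleftrightarrow> A \<inter> idle_agents G = {}"
    using Coal.prems by (auto simp: idle_agents_def)
  finally show ?case
    using assms(1) by simp
qed simp_all

section \<open>Moves and plays when every agent has an action\<close>

context
  assumes busy: "idle_agents G = {}"
begin

abbreviation joint :: "(name \<Rightarrow> name) set" where
  "joint \<equiv> (\<Pi>\<^sub>E a\<in>Ag G. Act G a)"

lemma set_actions': "a \<in> Ag G \<Longrightarrow> set (actions G a) = Act G a"
  using busy set_actions[OF G] unfolding idle_agents_def by blast

abbreviation legal :: "(name, name) atom set \<Rightarrow> (name \<Rightarrow> (name, name) command) set" where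
  "legal s \<equiv> (\<Pi>\<^sub>E b\<in>set (vAg (vcgs_of G)). enabled (update_cmds (spec (vcgs_of G) b)) s)"

lemma legal_cong: 
  assumes "\<And>b. b \<in> set (vAg (vcgs_of G)) \<Longrightarrow> \<beta> b \<in> enabled (update_cmds (spec (vcgs_of G) b)) s"
  shows "restrict \<beta> (set (vAg (vcgs_of G))) \<in> legal s"
  using assms by auto

lemma enabled_env_phase0: "enabled (update_cmds (env_spec G)) (phase0_state G q) = {wait_command G}"
  unfolding enabled_env beval_wait beval_transition_guard At_phase0 by auto

lemma enabled_player_phase0: "a \<in> Ag G \<Longrightarrow>
    enabled (update_cmds (player_spec G a)) (phase0_state G q) = act_command a ` Act G a"
  unfolding enabled_player At_phase0 by (simp add: set_actions')

lemma enabled_player_phase1: "a \<in> Ag G \<Longrightarrow>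
    enabled (update_cmds (player_spec G a)) (phase1_state G q \<alpha>) = {reset_command G a}"
  unfolding enabled_player At_phase1 by auto

lemma beval_guard_phase1:
  assumes "\<alpha> \<in> joint" "\<beta> \<in> joint"
  shows "beval (phase1_state G q \<alpha>) (transition_guard G r (map \<beta> (agents G))) \<longleftrightarrow> r = q \<and> \<beta> = \<alpha>"
proof -
  have "beval (phase1_state G q \<alpha>) (transition_guard G r (map \<beta> (agents G))) \<longleftrightarrow>
      r = q \<and> (\<forall>a\<in>Ag G. \<beta> a = \<alpha> a)"
    unfolding beval_transition_guard At_phase1
    using set_agents[OF G] by (auto simp: zip_map2 zip_same_conv_map)
  also have "\<dots> \<longleftrightarrow> r = q \<and> \<beta> = \<alpha>"
    using PiE_ext[OF assms(2,1)] by auto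
  finally show ?thesis .
qed

text \<open>The environment is in no translated coalition and thus an opponent of all of them. It
  does no harm, because the current state and the recorded actions satisfy exactly one transition
  guard.\<close>

lemma enabled_env_phase1:
  assumes "q \<in> States G" "\<alpha> \<in> joint"
  shows "enabled (update_cmds (env_spec G)) (phase1_state G q \<alpha>) =
    {transition_command G (q, map \<alpha> (agents G), \<tau> G q \<alpha>)}"
proof -
  have "{z \<in> set (transitions G).
      beval (phase1_state G q \<alpha>) (transition_guard G (fst z) (fst (snd z)))} =
    {(q, map \<alpha> (agents G), \<tau> G q \<alpha>)}"
    unfolding set_transitions[OF G]
    using assms by (auto simp: beval_guard_phase1)
  moreover have "\<not> beval (phase1_state G q \<alpha>) (guard (wait_command G))"
  proof
    assume "beval (phase1_state G q \<alpha>) (guard (wait_command G))"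
    moreover have "(q, map \<alpha> (agents G), \<tau> G q \<alpha>) \<in> set (transitions G)"
      unfolding set_transitions[OF G] using assms by blast
    ultimately show False
      unfolding beval_wait using beval_guard_phase1[OF assms(2,2)] by (auto dest!: bspec)
  qed
  ultimately show ?thesis
    unfolding enabled_env by simp
qed

lemma execute_phase0:
  assumes "\<beta> [] = wait_command G" "\<And>a. a \<in> Ag G \<Longrightarrow> \<beta> (True # a) = act_command a (\<alpha> a)"
  shows "execute (vcgs_of G) (phase0_state G q) \<beta> = phase1_state G q \<alpha>"
  by (rule atom_set_eqI)
    (use assms in \<open>auto simp: execute_vcgs_of[OF G] At_phase0 At_phase1 Vis_phase0
      Vis_phase1 wait_command_def act_command_def\<close>)

lemma execute_phase1:
  assumes "q \<in> States G" "\<alpha> \<in> joint"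
    and "\<beta> [] = transition_command G (q, map \<alpha> (agents G), \<tau> G q \<alpha>)"
    and "\<And>a. a \<in> Ag G \<Longrightarrow> \<beta> (True # a) = reset_command G a"
  shows "execute (vcgs_of G) (phase1_state G q \<alpha>) \<beta> = phase0_state G (\<tau> G q \<alpha>)"
proof -
  have act: "\<alpha> a \<in> Act G a" if "a \<in> Ag G" for a
    using assms(2) that by (rule PiE_mem)
  show ?thesis
    by (rule atom_set_eqI)
      (use assms act finite_parts(5)[OF G assms(1,2)] IndistD[OF G] in \<open>auto simp: execute_vcgs_of[OF G]
        At_phase0 At_phase1 Vis_phase0 Vis_phase1 transition_command_def
        reset_command_def set_env_assigns[OF G] set_actions'\<close>)
qed

lemma move_phase0:
  assumes "\<beta> \<in> legal (phase0_state G q)"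
  obtains \<alpha> where "\<alpha> \<in> joint" "execute (vcgs_of G) (phase0_state G q) \<beta> = phase1_state G q \<alpha>"
    "\<And>a. a \<in> Ag G \<Longrightarrow> \<beta> (True # a) = act_command a (\<alpha> a)"
proof -
  have "\<exists>c. c \<in> Act G a \<and> \<beta> (True # a) = act_command a c" if "a \<in> Ag G" for a
    using PiE_mem[OF assms, of "True # a"] that enabled_player_phase0[of a q] spec_vcgs_of
      vAg_vcgs_of[OF G] by auto
  then obtain f where f: "\<And>a. a \<in> Ag G \<Longrightarrow> f a \<in> Act G a \<and> \<beta> (True # a) = act_command a (f a)"
    by metis
  have "\<beta> [] = wait_command G"
    using PiE_mem[OF assms, of "[]"] enabled_env_phase0[of q] spec_vcgs_of vAg_vcgs_of[OF G]
    by auto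
  then have "execute (vcgs_of G) (phase0_state G q) \<beta> = phase1_state G q (restrict f (Ag G))"
    using f by (intro execute_phase0) auto
  then show ?thesis
    using f by (intro that[of "restrict f (Ag G)"]) auto
qed

lemma move_phase1:
  assumes "q \<in> States G" "\<alpha> \<in> joint" "\<beta> \<in> legal (phase1_state G q \<alpha>)"
  shows "execute (vcgs_of G) (phase1_state G q \<alpha>) \<beta> = phase0_state G (\<tau> G q \<alpha>)"
proof (rule execute_phase1[OF assms(1,2)])
  show "\<beta> [] = transition_command G (q, map \<alpha> (agents G), \<tau> G q \<alpha>)"
    using PiE_mem[OF assms(3), of "[]"] enabled_env_phase1[OF assms(1,2)] spec_vcgs_of
      vAg_vcgs_of[OF G] by auto
  show "\<beta> (True # a) = reset_command G a" if "a \<in> Ag G" for a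
    using PiE_mem[OF assms(3), of "True # a"] enabled_player_phase1 that spec_vcgs_of
      vAg_vcgs_of[OF G] by auto
qed

definition lift_phase0 :: "(name \<Rightarrow> name) \<Rightarrow> name \<Rightarrow> (name, name) command" where
  "lift_phase0 \<alpha> = (\<lambda>b\<in>set (vAg (vcgs_of G)).
     if b = [] then wait_command G else act_command (tl b) (\<alpha> (tl b)))"

definition lift_phase1 :: "name \<Rightarrow> (name \<Rightarrow> name) \<Rightarrow> name \<Rightarrow> (name, name) command" where
  "lift_phase1 q \<alpha> = (\<lambda>b\<in>set (vAg (vcgs_of G)).
     if b = [] then transition_command G (q, map \<alpha> (agents G), \<tau> G q \<alpha>) else reset_command G (tl b))"

lemma lift_phase0:
  assumes "\<alpha> \<in> joint"
  shows "lift_phase0 \<alpha> \<in> legal (phase0_state G q)"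
    "execute (vcgs_of G) (phase0_state G q) (lift_phase0 \<alpha>) = phase1_state G q \<alpha>"
proof -
  show "lift_phase0 \<alpha> \<in> legal (phase0_state G q)"
    unfolding lift_phase0_def
    by (rule legal_cong) (use assms enabled_env_phase0 enabled_player_phase0 vAg_vcgs_of[OF G]
        spec_vcgs_of PiE_mem[OF assms] in auto)
  show "execute (vcgs_of G) (phase0_state G q) (lift_phase0 \<alpha>) = phase1_state G q \<alpha>"
    by (rule execute_phase0) (simp_all add: lift_phase0_def vAg_vcgs_of[OF G])
qed

lemma lift_phase1:
  assumes "q \<in> States G" "\<alpha> \<in> joint"
  shows "lift_phase1 q \<alpha> \<in> legal (phase1_state G q \<alpha>)"
    "execute (vcgs_of G) (phase1_state G q \<alpha>) (lift_phase1 q \<alpha>) = phase0_state G (\<tau> G q \<alpha>)"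
proof -
  show l: "lift_phase1 q \<alpha> \<in> legal (phase1_state G q \<alpha>)"
    unfolding lift_phase1_def
    by (rule legal_cong) (use enabled_env_phase1[OF assms] enabled_player_phase1 vAg_vcgs_of[OF G]
        spec_vcgs_of in auto)
  show "execute (vcgs_of G) (phase1_state G q \<alpha>) (lift_phase1 q \<alpha>) = phase0_state G (\<tau> G q \<alpha>)"
    by (rule move_phase1[OF assms l])
qed

text \<open>Two vCGS positions correspond to one position of \<open>G\<close>, the odd one recording
  the joint action. Strategies are left out so that the relation passes to suffixes, as the
  induction over temporal operators requires.\<close>

definition expands :: "(nat \<Rightarrow> name) \<Rightarrow> (nat \<Rightarrow> (name, name) atom set) \<Rightarrow> bool" where
  "expands p P \<longleftrightarrow> (\<forall>i. p i \<in> States G \<and> P (2 * i) = phase0_state G (p i) \<and>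
     (\<exists>\<alpha>\<in>joint. P (2 * i + 1) = phase1_state G (p i) \<alpha> \<and> p (Suc i) = \<tau> G (p i) \<alpha>))"

lemma expands_shift: "expands p P \<Longrightarrow> expands (\<lambda>i. p (k + i)) (\<lambda>i. P (2 * k + i))"
  unfolding expands_def by (metis add.assoc add_Suc_right distrib_left)

lemma expands_phase:
  assumes "expands p P"
  shows "At phase_var \<in> P n \<longleftrightarrow> odd n"
proof (cases "even n")
  case True
  then obtain i where "n = 2 * i" by blast
  then show ?thesis
    using assms True At_phase0 by (simp add: expands_def)
next
  case False
  then obtain i where "n = 2 * i + 1" using oddE by blast
  moreover obtain \<alpha> where "P (2 * i + 1) = phase1_state G (p i) \<alpha>"
    using assms unfolding expands_def by blast
  ultimately show ?thesis
    using False At_phase1 by simp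
qed

lemma game_simps [simp]:
  "players (vcgs_game (vcgs_of G)) = set (vAg (vcgs_of G))"
  "avail (vcgs_game (vcgs_of G)) = (\<lambda>b. enabled (update_cmds (spec (vcgs_of G) b)))"
  "move (vcgs_game (vcgs_of G)) = execute (vcgs_of G)"
  "similar (vcgs_game (vcgs_of G)) = vindist (vcgs_of G)"
  "positions (vcgs_game (vcgs_of G)) = vstates (vcgs_of G)"
  "players (icgs_game G) = Ag G"
  "avail (icgs_game G) = (\<lambda>a s. Act G a)"
  "move (icgs_game G) = \<tau> G"
  "similar (icgs_game G) = Indist G"
  "positions (icgs_game G) = States G"
  by (simp_all add: vcgs_game_def icgs_game_def)

text \<open>An expansion obeys the rules of the vCGS everywhere, so each of its suffixes is an
  outcome for the empty coalition.\<close>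

lemma expands_move:
  assumes "expands p P"
  shows "\<exists>\<beta> \<in> legal (P n). P (Suc n) = execute (vcgs_of G) (P n) \<beta>"
proof -
  obtain i where i: "n = 2 * i \<or> n = 2 * i + 1"
    by (meson evenE oddE)
  obtain \<alpha> where \<alpha>: "p i \<in> States G" "\<alpha> \<in> joint" "P (2 * i) = phase0_state G (p i)"
    "P (2 * i + 1) = phase1_state G (p i) \<alpha>" "P (2 * i + 2) = phase0_state G (\<tau> G (p i) \<alpha>)"
    using assms unfolding expands_def by (metis add_2_eq_Suc' mult_Suc_right add.commute)
  from i show ?thesis
  proof
    assume "n = 2 * i"
    then show ?thesis
      using lift_phase0[OF \<alpha>(2), of "p i"] \<alpha>(3,4) by (intro bexI[of _ "lift_phase0 \<alpha>"]) simp_all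
  next
    assume "n = 2 * i + 1"
    then show ?thesis
      using lift_phase1[OF \<alpha>(1,2)] \<alpha>(4,5)
      by (intro bexI[of _ "lift_phase1 (p i) \<alpha>"]) simp_all
  qed
qed

text \<open>For \<open>St \<phi>\<close> the empty coalition quantifies over all plays from
  \<open>P 1\<close>. The suffix of \<open>P\<close> is one of them, and all of them continue with
  \<open>P 2\<close> because moves from phase 1 are deterministic.\<close>

lemma psat_next_phase0:
  assumes "expands p P"
  shows "psat (vcgs_game (vcgs_of G)) P (next_phase0 \<psi>) \<longleftrightarrow>
    psat (vcgs_game (vcgs_of G)) (\<lambda>i. P (2 + i)) \<psi>"
proof (cases "\<exists>\<phi>. \<psi> = St \<phi>")
  case False
  then have "next_phase0 \<psi> = Next (Next \<psi>)"
    by (cases \<psi>) auto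
  then show ?thesis
    by (simp add: numeral_2_eq_2)
next
  case True
  then obtain \<phi> where \<psi>: "\<psi> = St \<phi>"
    by blast
  obtain \<alpha> where \<alpha>: "p 0 \<in> States G" "\<alpha> \<in> joint" "P 1 = phase1_state G (p 0) \<alpha>"
      "p 1 = \<tau> G (p 0) \<alpha>" "P 2 = phase0_state G (p 1)"
    using assms[unfolded expands_def, rule_format, of 0] assms[unfolded expands_def, rule_format, of 1]
    by auto
  have "(\<lambda>i. P (Suc i)) \<in> outcomes (vcgs_game (vcgs_of G)) (P 1) {} F" for F
    using expands_move[OF assms] by (simp add: outcomes_def)
  moreover have "r 1 = P 2" if "r \<in> outcomes (vcgs_game (vcgs_of G)) (P 1) {} F" for r F
  proof -
    have r: "r 0 = P 1" "\<And>i. \<exists>\<beta>\<in>legal (r i). r (Suc i) = execute (vcgs_of G) (r i) \<beta>"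
      using that by (simp_all add: outcomes_def)
    obtain \<beta> where "\<beta> \<in> legal (r 0)" "r 1 = execute (vcgs_of G) (r 0) \<beta>"
      using r(2)[of 0] by auto
    with r(1) show ?thesis
      using move_phase1[OF \<alpha>(1,2), of \<beta>] \<alpha>(3-5) by simp
  qed
  ultimately have "ssat (vcgs_game (vcgs_of G)) (P 1) (Coal {} (Next (St \<phi>))) \<longleftrightarrow>
      ssat (vcgs_game (vcgs_of G)) (P 2) \<phi>"
    by (auto simp: numeral_2_eq_2 intro!: exI[of _ undefined])
  then show ?thesis
    unfolding \<psi> by (simp add: numeral_2_eq_2)
qed

text \<open>A strategy of \<open>G\<close> is simulated by discarding from a history all states that \<open>a\<close> can tell
  apart from every \<open>phase0_state\<close> and replacing each remaining one by a state of \<open>G\<close> that looks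
  the same to \<open>a\<close>.\<close>

lemma strategy_to_vcgs:
  assumes A: "A \<subseteq> Ag G" and F: "\<forall>a\<in>A. uniform_strategy (icgs_game G) a (F a)"
    and q: "q \<in> States G"
  obtains F' where "\<forall>b\<in>(#) True ` A. uniform_strategy (vcgs_game (vcgs_of G)) b (F' b)"
    and "\<And>P. P \<in> outcomes (vcgs_game (vcgs_of G)) (phase0_state G q) ((#) True ` A) F' \<Longrightarrow>
      \<exists>p \<in> outcomes (icgs_game G) q A F. expands p P"
proof -
  \<comment> \<open>States are matched up to \<open>vindist\<close> only, because a history may
    contain arbitrary valuations and may be judged only by what \<open>a\<close> sees.\<close>
  define looks where "looks a s r \<longleftrightarrow> r \<in> States G \<and> (s, phase0_state G r) \<in> vindist (vcgs_of G) (True # a)"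
    for a s r
  define good where "good a s \<longleftrightarrow> (\<exists>r. looks a s r)" for a s
  define rep where "rep a s = (SOME r. looks a s r)" for a s
  define view where "view a H = map (rep a) (filter (good a) H)" for a H
  \<comment> \<open>The default serves histories without any state that looks like phase 0, where
    \<open>F a\<close> would receive the empty list and is unconstrained.\<close>
  define choice where "choice a H = (if view a H = [] then SOME c. c \<in> Act G a else F a (view a H))"
    for a H
  define F' where "F' b H = (if At (turn_var (tl b)) \<in> last H then reset_command G (tl b)
    else act_command (tl b) (choice (tl b) H))" for b H
  have rep: "looks a s (rep a s)" if "good a s" for a s
    using that unfolding good_def rep_def by (rule someI_ex)
  have view_set: "set (view a H) \<subseteq> States G" for a H
    using rep unfolding view_def looks_def by auto
  have choice: "choice a H \<in> Act G a" if "a \<in> A" for a H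
  proof (cases "view a H = []")
    case True
    have "Act G a \<noteq> {}"
      using that A busy unfolding idle_agents_def by blast
    then show ?thesis
      using True by (simp add: choice_def some_in_eq)
  next
    case False
    then have "view a H \<in> histories (icgs_game G)"
      using view_set by (simp add: histories_def)
    then show ?thesis
      using F that False unfolding uniform_strategy_def by (simp add: choice_def)
  qed
  \<comment> \<open>The set of candidates is the same for indistinguishable states, so the choice
    operator picks the same representative; this gives uniformity.\<close>
  have looks_cong: "looks a s = looks a t" if "(s, t) \<in> vindist (vcgs_of G) (True # a)" for a s t
    unfolding looks_def using that vindist_trans[where D = "vcgs_of G"] vindist_sym[where D = "vcgs_of G"]
    by blast
  have view_cong: "view a H = view a H'"
    if "list_all2 (\<lambda>s t. (s, t) \<in> vindist (vcgs_of G) (True # a)) H H'" for a H H'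
    using that unfolding view_def
    by (induction rule: list_all2_induct) (simp_all add: good_def rep_def looks_cong)
  have "uniform_strategy (vcgs_game (vcgs_of G)) (True # a) (F' (True # a))" if a: "a \<in> A" for a
    unfolding uniform_strategy_def
  proof (intro conjI ballI impI)
    fix H
    have "choice a H \<in> set (actions G a)"
      using choice[OF a] A a set_actions' by blast
    then show "F' (True # a) H \<in> avail (vcgs_game (vcgs_of G)) (True # a) (last H)"
      by (simp add: F'_def spec_vcgs_of enabled_player)
  next
    fix H H'
    assume H: "H \<in> histories (vcgs_game (vcgs_of G))"
      and "similar_histories (vcgs_game (vcgs_of G)) (True # a) H H'"
    then have sim: "list_all2 (\<lambda>s t. (s, t) \<in> vindist (vcgs_of G) (True # a)) H H'"
      by (simp add: similar_histories_def)
    have "choice a H = choice a H'"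
      using view_cong[OF sim] by (simp add: choice_def)
    moreover have "(last H, last H') \<in> vindist (vcgs_of G) (True # a)"
      using list_all2_last[OF sim] H by (simp add: histories_def)
    ultimately show "F' (True # a) H = F' (True # a) H'"
      using vindist_own[OF G] a A by (auto simp: F'_def)
  qed
  then have uniform: "\<forall>b\<in>(#) True ` A. uniform_strategy (vcgs_game (vcgs_of G)) b (F' b)"
    by blast
  have "\<exists>p \<in> outcomes (icgs_game G) q A F. expands p P"
    if "P \<in> outcomes (vcgs_game (vcgs_of G)) (phase0_state G q) ((#) True ` A) F'" for P
  proof -
    have P0: "P 0 = phase0_state G q"
      and step: "\<And>n. \<exists>\<beta>\<in>legal (P n). (\<forall>a\<in>A. \<beta> (True # a) = F' (True # a) (map P [0..<Suc n])) \<and>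
        P (Suc n) = execute (vcgs_of G) (P n) \<beta>"
      using that unfolding outcomes_def by simp_all
    \<comment> \<open>Only the phase 0 half of a round constrains the joint action; the other half
      is forced.\<close>
    have two: "\<exists>\<alpha>\<in>joint. P (2 * i + 1) = phase1_state G r \<alpha> \<and>
        P (2 * Suc i) = phase0_state G (\<tau> G r \<alpha>) \<and> (\<forall>a\<in>A. \<alpha> a = choice a (map P [0..<Suc (2 * i)]))"
      if r: "r \<in> States G" "P (2 * i) = phase0_state G r" for r i
    proof -
      obtain \<beta> where \<beta>: "\<beta> \<in> legal (phase0_state G r)"
        "\<forall>a\<in>A. \<beta> (True # a) = F' (True # a) (map P [0..<Suc (2 * i)])"
        "P (2 * i + 1) = execute (vcgs_of G) (phase0_state G r) \<beta>"
        using step[of "2 * i"] r(2) by auto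
      obtain \<alpha> where \<alpha>: "\<alpha> \<in> joint" "execute (vcgs_of G) (phase0_state G r) \<beta> = phase1_state G r \<alpha>"
        "\<And>a. a \<in> Ag G \<Longrightarrow> \<beta> (True # a) = act_command a (\<alpha> a)"
        using move_phase0[OF \<beta>(1)] by blast
      obtain \<gamma> where \<gamma>: "\<gamma> \<in> legal (phase1_state G r \<alpha>)"
        "P (2 * Suc i) = execute (vcgs_of G) (phase1_state G r \<alpha>) \<gamma>"
        using step[of "2 * i + 1"] \<beta>(3) \<alpha>(2) by auto
      have "\<alpha> a = choice a (map P [0..<Suc (2 * i)])" if "a \<in> A" for a
      proof -
        have "act_command a (\<alpha> a) = F' (True # a) (map P [0..<Suc (2 * i)])"
          using \<alpha>(3) \<beta>(2) that A by (metis subsetD)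
        also have "\<dots> = act_command a (choice a (map P [0..<Suc (2 * i)]))"
          using r(2) At_phase0 by (simp add: F'_def)
        finally show ?thesis
          by simp
      qed
      then show ?thesis
        using \<alpha> \<beta>(3) \<gamma>(2) move_phase1[OF r(1) \<alpha>(1) \<gamma>(1)] by auto
    qed
    have "\<exists>r \<in> States G. P (2 * i) = phase0_state G r" for i
    proof (induction i)
      case 0
      then show ?case
        using P0 q by auto
    next
      case (Suc i)
      then show ?case
        using two finite_parts(5)[OF G] by metis
    qed
    then obtain p where p: "\<And>i. p i \<in> States G" "\<And>i. P (2 * i) = phase0_state G (p i)"
      by metis
    have p_step: "\<exists>\<alpha>\<in>joint. P (2 * i + 1) = phase1_state G (p i) \<alpha> \<and> p (Suc i) = \<tau> G (p i) \<alpha> \<and>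
        (\<forall>a\<in>A. \<alpha> a = choice a (map P [0..<Suc (2 * i)]))" for i
      using two[OF p(1,2)] p(2)[of "Suc i"] phase0_inject by metis
    have "p 0 = q"
      using P0 p(2)[of 0] phase0_inject by simp
    have good0: "good a (P (2 * i))" "(rep a (P (2 * i)), p i) \<in> Indist G a" if "a \<in> A" for a i
    proof -
      have "looks a (P (2 * i)) (p i)"
        using p vindist_refl[OF phase0_in_vstates[OF G p(1)]] by (simp add: looks_def)
      then show g: "good a (P (2 * i))"
        unfolding good_def by blast
      have "(p i, rep a (P (2 * i))) \<in> Indist G a"
        using rep[OF g] p that A vindist_phase0[OF G] unfolding looks_def by auto
      then show "(rep a (P (2 * i)), p i) \<in> Indist G a"
        using finite_parts(6)[OF G] that A by (meson equivE subsetD symD)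
    qed
    \<comment> \<open>The agent's own turn variable gives phase 1 away, so exactly the odd positions
      are filtered out.\<close>
    have bad1: "\<not> good a (P (2 * i + 1))" if "a \<in> A" for a i
    proof -
      have "At (turn_var a) \<in> P (2 * i + 1)"
        using p_step[of i] that A At_phase1 by auto
      then show ?thesis
        using vindist_own[OF G] that A At_phase0 unfolding good_def looks_def by blast
    qed
    have view_sim: "list_all2 (\<lambda>s t. (s, t) \<in> Indist G a) (view a (map P [0..<Suc (2 * i)])) (map p [0..<Suc i])"
      if "a \<in> A" for a i
    proof (induction i)
      case 0
      then show ?case
        using good0[OF that, of 0] by (simp add: view_def)
    next
      case (Suc i)
      have "view a (map P [0..<Suc (2 * Suc i)]) =
          view a (map P [0..<Suc (2 * i)]) @ [rep a (P (2 * Suc i))]"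
        using good0(1)[OF that, of "Suc i"] bad1[OF that, of i]
        unfolding view_def upt_double_Suc by simp
      moreover have "map p [0..<Suc (Suc i)] = map p [0..<Suc i] @ [p (Suc i)]"
        by simp
      moreover have "list_all2 (\<lambda>s t. (s, t) \<in> Indist G a)
          (view a (map P [0..<Suc (2 * i)]) @ [rep a (P (2 * Suc i))]) (map p [0..<Suc i] @ [p (Suc i)])"
        using good0(2)[OF that, of "Suc i"] by (intro list_all2_appendI[OF Suc]) simp
      ultimately show ?case
        by (simp only:)
    qed
    \<comment> \<open>The view need not be the history of \<open>p\<close>, but \<open>a\<close>
      cannot tell them apart, and \<open>F a\<close> is uniform.\<close>
    have choice_eq: "choice a (map P [0..<Suc (2 * i)]) = F a (map p [0..<Suc i])" if "a \<in> A" for a i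
    proof -
      let ?v = "view a (map P [0..<Suc (2 * i)])"
      note sim = view_sim[OF that, of i]
      have ne: "?v \<noteq> []"
        using sim by auto
      then have "?v \<in> histories (icgs_game G)" "map p [0..<Suc i] \<in> histories (icgs_game G)"
        using view_set p(1) by (auto simp: histories_def)
      then have "F a ?v = F a (map p [0..<Suc i])"
        using F that sim unfolding uniform_strategy_def similar_histories_def game_simps by blast
      then show ?thesis
        using ne by (simp add: choice_def)
    qed
    have "p \<in> outcomes (icgs_game G) q A F"
      unfolding outcomes_def mem_Collect_eq game_simps
    proof (intro conjI allI)
      show "\<exists>\<alpha>\<in>joint. (\<forall>a\<in>A. \<alpha> a = F a (map p [0..<Suc i])) \<and> p (Suc i) = \<tau> G (p i) \<alpha>" for i
        using p_step[of i] choice_eq by metis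
    qed (rule \<open>p 0 = q\<close>)
    moreover have "expands p P"
      unfolding expands_def using p p_step by metis
    ultimately show ?thesis
      by blast
  qed
  with uniform show ?thesis
    using that by blast
qed

text \<open>Conversely, along a play of \<open>G\<close> agent \<open>a\<close> can reconstruct a history of the vCGS that looks
  right to itself: the only part of the second phases it sees is its own action, which its strategy
  determines.\<close>

lemma strategy_from_vcgs:
  assumes A: "A \<subseteq> Ag G"
    and F': "\<forall>b\<in>(#) True ` A. uniform_strategy (vcgs_game (vcgs_of G)) b (F' b)"
    and q: "q \<in> States G"
  obtains F where "\<forall>a\<in>A. uniform_strategy (icgs_game G) a (F a)"
    and "\<And>p. p \<in> outcomes (icgs_game G) q A F \<Longrightarrow>
      \<exists>P \<in> outcomes (vcgs_game (vcgs_of G)) (phase0_state G q) ((#) True ` A) F'. expands p P"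
proof -
  \<comment> \<open>Arbitrary actions to fill in for the other agents; \<open>a\<close> does not see
    them.\<close>
  define d0 where "d0 a = (SOME c. c \<in> Act G a)" for a
  have d0: "d0 a \<in> Act G a" if "a \<in> Ag G" for a
    using that busy unfolding idle_agents_def by (auto simp: d0_def some_in_eq)
  \<comment> \<open>The action is read off from the command that the strategy issues, so it depends
    on that command only.\<close>
  define pick where "pick a H = (SOME c. c \<in> Act G a \<and> F' (True # a) H = act_command a c)" for a H
  define joint1 where "joint1 a H = (\<lambda>b\<in>Ag G. if b = a then pick a H else d0 b)" for a H
  define hist where "hist a p = rec_nat [phase0_state G (p 0)]
    (\<lambda>i H. H @ [phase1_state G (p i) (joint1 a H), phase0_state G (p (Suc i))])" for a p
  have hist_0: "hist a p 0 = [phase0_state G (p 0)]"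
    and hist_Suc: "hist a p (Suc i) = hist a p i @
      [phase1_state G (p i) (joint1 a (hist a p i)), phase0_state G (p (Suc i))]" for a p i
    by (simp_all add: hist_def)
  have hist_cong: "hist a p i = hist a p' i" if "\<And>j. j \<le> i \<Longrightarrow> p j = p' j" for a p p' i
    using that by (induction i) (simp_all add: hist_0 hist_Suc)
  have last_hist: "last (hist a p i) = phase0_state G (p i)" "hist a p i \<noteq> []" for a p i
    by (cases i; simp add: hist_0 hist_Suc)+
  have unif: "F' (True # a) H \<in> enabled (update_cmds (player_spec G a)) (last H)"
    if "a \<in> A" "H \<in> histories (vcgs_game (vcgs_of G))" for a H
    using F' that spec_vcgs_of unfolding uniform_strategy_def by auto
  have unif_eq: "F' (True # a) H = F' (True # a) H'"
    if "a \<in> A" "H \<in> histories (vcgs_game (vcgs_of G))" "H' \<in> histories (vcgs_game (vcgs_of G))"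
      "list_all2 (\<lambda>s t. (s, t) \<in> vindist (vcgs_of G) (True # a)) H H'" for a H H'
    using F' that unfolding uniform_strategy_def similar_histories_def by auto
  have pick: "pick a H \<in> Act G a" "F' (True # a) H = act_command a (pick a H)"
    if "a \<in> A" "H \<in> histories (vcgs_game (vcgs_of G))" "last H = phase0_state G r" for a H r
  proof -
    have "a \<in> Ag G"
      using that A by blast
    then have "\<exists>c. c \<in> Act G a \<and> F' (True # a) H = act_command a c"
      using unif[OF that(1,2)] enabled_player_phase0 that(3) by auto
    from someI_ex[OF this] show "pick a H \<in> Act G a" "F' (True # a) H = act_command a (pick a H)"
      unfolding pick_def by blast+
  qed
  have joint1: "joint1 a H \<in> joint" "joint1 a H a = pick a H"
    if "a \<in> A" "H \<in> histories (vcgs_game (vcgs_of G))" "last H = phase0_state G r" for a H r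
    using pick(1)[OF that] d0 that A by (auto simp: joint1_def)
  have hist: "hist a p i \<in> histories (vcgs_game (vcgs_of G))"
    if "a \<in> A" "\<And>j. j \<le> i \<Longrightarrow> p j \<in> States G" for a p i
    using that(2)
  proof (induction i)
    case 0
    then show ?case
      using phase0_in_vstates[OF G] by (simp add: hist_0 histories_def)
  next
    case (Suc i)
    then have h: "hist a p i \<in> histories (vcgs_game (vcgs_of G))"
      by simp
    show ?case
      using h joint1(1)[OF that(1) h last_hist(1)] Suc.prems phase0_in_vstates[OF G]
        phase1_in_vstates[OF G] by (simp add: hist_Suc histories_def)
  qed
  have hist_sim: "list_all2 (\<lambda>s t. (s, t) \<in> vindist (vcgs_of G) (True # a)) (hist a p i) (hist a p' i)"
    if "a \<in> A" "\<And>j. j \<le> i \<Longrightarrow> (p j, p' j) \<in> Indist G a" for a p p' i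
    using that(2)
  proof (induction i)
    case 0
    then show ?case
      using that(1) A IndistD[OF G] vindist_phase0[OF G] by (auto simp: hist_0)
  next
    case (Suc i)
    have a: "a \<in> Ag G"
      using that(1) A by blast
    have st: "p j \<in> States G" "p' j \<in> States G" if "j \<le> Suc i" for j
      using Suc.prems[OF that] IndistD[OF G a] by blast+
    have h: "hist a p i \<in> histories (vcgs_game (vcgs_of G))" "hist a p' i \<in> histories (vcgs_game (vcgs_of G))"
      using hist[OF that(1)] st by simp_all
    have sim: "list_all2 (\<lambda>s t. (s, t) \<in> vindist (vcgs_of G) (True # a)) (hist a p i) (hist a p' i)"
      using Suc by simp
    have "pick a (hist a p i) = pick a (hist a p' i)"
      unfolding pick_def using unif_eq[OF that(1) h sim] by simp
    then have "(phase1_state G (p i) (joint1 a (hist a p i)), phase1_state G (p' i) (joint1 a (hist a p' i)))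
        \<in> vindist (vcgs_of G) (True # a)"
      using joint1[OF that(1) h(1) last_hist(1)] joint1[OF that(1) h(2) last_hist(1)]
        Suc.prems[of i] st[of i] a by (intro vindist_phase1[OF G]) simp_all
    moreover have "(phase0_state G (p (Suc i)), phase0_state G (p' (Suc i))) \<in> vindist (vcgs_of G) (True # a)"
      using vindist_phase0[OF G a] st Suc.prems by simp
    ultimately show ?case
      using sim unfolding hist_Suc by (intro list_all2_appendI) simp_all
  qed
  \<comment> \<open>\<open>hist a p i\<close> reads only \<open>p 0\<close> to \<open>p i\<close>,
    so \<open>length h - 1\<close> is the last index at which \<open>nth h\<close> is
    consulted.\<close>
  define F where "F a h = pick a (hist a (nth h) (length h - 1))" for a h
  have "uniform_strategy (icgs_game G) a (F a)" if a: "a \<in> A" for a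
    unfolding uniform_strategy_def
  proof (intro conjI ballI impI)
    have hh: "hist a (nth h) (length h - 1) \<in> histories (vcgs_game (vcgs_of G))"
      if "h \<in> histories (icgs_game G)" for h
    proof (rule hist[OF a])
      fix j
      assume "j \<le> length h - 1"
      moreover have "h \<noteq> []" "set h \<subseteq> States G"
        using that by (simp_all add: histories_def)
      ultimately show "h ! j \<in> States G"
        by (metis Suc_pred' le_imp_less_Suc length_greater_0_conv nth_mem subsetD)
    qed
    fix h
    assume h: "h \<in> histories (icgs_game G)"
    show "F a h \<in> avail (icgs_game G) a (last h)"
      using pick(1)[OF a hh[OF h] last_hist(1)] by (simp add: F_def)
    fix h'
    assume h': "h' \<in> histories (icgs_game G)" and "similar_histories (icgs_game G) a h h'"
    then have l: "list_all2 (\<lambda>s t. (s, t) \<in> Indist G a) h h'"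
      by (simp add: similar_histories_def)
    then have len: "length h' = length h"
      using list_all2_lengthD by metis
    have "h \<noteq> []"
      using h by (simp add: histories_def)
    then have "(h ! j, h' ! j) \<in> Indist G a" if "j \<le> length h - 1" for j
      using list_all2_nthD[OF l, of j] that by (metis Suc_pred' le_imp_less_Suc length_greater_0_conv)
    from hist_sim[OF a this]
    have "F' (True # a) (hist a (nth h) (length h - 1)) = F' (True # a) (hist a (nth h') (length h - 1))"
      using unif_eq[OF a hh[OF h] hh[OF h']] len by simp
    then show "F a h = F a h'"
      by (simp add: F_def pick_def len)
  qed
  then have uniform: "\<forall>a\<in>A. uniform_strategy (icgs_game G) a (F a)"
    by blast
  have "\<exists>P \<in> outcomes (vcgs_game (vcgs_of G)) (phase0_state G q) ((#) True ` A) F'. expands p P"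
    if "p \<in> outcomes (icgs_game G) q A F" for p
  proof -
    have p0: "p 0 = q" and "\<And>i. \<exists>\<alpha>\<in>joint. (\<forall>a\<in>A. \<alpha> a = F a (map p [0..<Suc i])) \<and>
        p (Suc i) = \<tau> G (p i) \<alpha>"
      using that unfolding outcomes_def by simp_all
    then obtain \<alpha> where \<alpha>: "\<And>i. \<alpha> i \<in> joint" "\<And>i a. a \<in> A \<Longrightarrow> \<alpha> i a = F a (map p [0..<Suc i])"
      "\<And>i. p (Suc i) = \<tau> G (p i) (\<alpha> i)"
      by metis
    have p: "p i \<in> States G" for i
      by (induction i) (use p0 q \<alpha> finite_parts(5)[OF G] in simp_all)
    \<comment> \<open>The actual play records the true joint actions \<open>\<alpha>\<close>,
      whereas \<open>hist\<close> contains fillers for the other agents.\<close>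
    define P where "P n = (if even n then phase0_state G (p (n div 2))
      else phase1_state G (p (n div 2)) (\<alpha> (n div 2)))" for n
    have P_even: "P (2 * i) = phase0_state G (p i)" and P_odd: "P (2 * i + 1) = phase1_state G (p i) (\<alpha> i)"
      and P_even': "P (2 * i + 2) = phase0_state G (p (Suc i))" for i
      by (simp_all add: P_def)
    have exp: "expands p P"
      unfolding expands_def using P_even P_odd p \<alpha>(1,3) by blast
    have vst: "P n \<in> vstates (vcgs_of G)" for n
      using phase0_in_vstates[OF G p] phase1_in_vstates[OF G p \<alpha>(1)] by (simp add: P_def)
    then have hP: "map P [0..<Suc n] \<in> histories (vcgs_game (vcgs_of G))" for n
      by (auto simp: histories_def)
    have \<alpha>_pick: "\<alpha> i a = pick a (hist a p i)" if "a \<in> A" for a i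
    proof -
      have "hist a (nth (map p [0..<Suc i])) i = hist a p i"
        by (rule hist_cong) (simp del: upt_Suc)
      then show ?thesis
        using \<alpha>(2)[OF that, of i] by (simp add: F_def)
    qed
    \<comment> \<open>Real and reconstructed history differ only in the recorded actions of others:
      the action of \<open>a\<close> itself is \<open>pick a (hist a p i)\<close> in both.\<close>
    have P_hist: "list_all2 (\<lambda>s t. (s, t) \<in> vindist (vcgs_of G) (True # a)) (map P [0..<Suc (2 * i)]) (hist a p i)"
      if "a \<in> A" for a i
    proof (induction i)
      case 0
      then show ?case
        using vindist_refl[OF vst, of 0] P_even[of 0] by (simp add: hist_0)
    next
      case (Suc i)
      have h: "hist a p i \<in> histories (vcgs_game (vcgs_of G))"
        by (rule hist[OF that p])
      have a: "a \<in> Ag G"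
        using that A by blast
      have "(p i, p i) \<in> Indist G a"
        using p finite_parts(6)[OF G a] by (meson equivE refl_onD)
      then have "(P (2 * i + 1), phase1_state G (p i) (joint1 a (hist a p i))) \<in> vindist (vcgs_of G) (True # a)"
        unfolding P_odd using joint1[OF that h last_hist(1)] \<alpha>_pick[OF that] \<alpha>(1) p a
        by (intro vindist_phase1[OF G]) simp_all
      moreover have "(P (2 * i + 2), phase0_state G (p (Suc i))) \<in> vindist (vcgs_of G) (True # a)"
        using vindist_refl[OF vst] P_even' by metis
      ultimately show ?case
        using Suc unfolding hist_Suc upt_double_Suc map_append by (intro list_all2_appendI) simp_all
    qed
    have "\<exists>\<beta>\<in>legal (P n). (\<forall>b\<in>(#) True ` A. \<beta> b = F' b (map P [0..<Suc n])) \<and>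
        P (Suc n) = execute (vcgs_of G) (P n) \<beta>" for n
    proof (cases "even n")
      case True
      then obtain i where n: "n = 2 * i"
        by blast
      have "lift_phase0 (\<alpha> i) (True # a) = F' (True # a) (map P [0..<Suc n])" if "a \<in> A" for a
      proof -
        have h: "hist a p i \<in> histories (vcgs_game (vcgs_of G))"
          by (rule hist[OF that p])
        have "F' (True # a) (map P [0..<Suc n]) = F' (True # a) (hist a p i)"
          unfolding n by (rule unif_eq[OF that hP h P_hist[OF that]])
        also have "\<dots> = act_command a (\<alpha> i a)"
          using pick(2)[OF that h last_hist(1)] \<alpha>_pick[OF that] by simp
        finally show ?thesis
          using that A vAg_vcgs_of[OF G] by (auto simp: lift_phase0_def)
      qed
      then show ?thesis
        using lift_phase0[OF \<alpha>(1)[of i], of "p i"] P_even[of i] P_odd[of i] n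
        by (intro bexI[of _ "lift_phase0 (\<alpha> i)"]) (auto simp del: upt_Suc)
    next
      case False
      then obtain i where n: "n = 2 * i + 1"
        using oddE by blast
      have "lift_phase1 (p i) (\<alpha> i) (True # a) = F' (True # a) (map P [0..<Suc n])" if "a \<in> A" for a
      proof -
        have "last (map P [0..<Suc n]) = phase1_state G (p i) (\<alpha> i)"
          using P_odd[of i] n by simp
        \<comment> \<open>In phase 1 only the reset command is enabled, so the strategy has to
          choose it.\<close>
        then have "F' (True # a) (map P [0..<Suc n]) = reset_command G a"
          using unif[OF that hP, of n] enabled_player_phase1 that A by auto
        then show ?thesis
          using that A vAg_vcgs_of[OF G] by (auto simp: lift_phase1_def)
      qed
      then show ?thesis
        using lift_phase1[OF p[of i] \<alpha>(1)[of i]] P_even'[of i] P_odd[of i] n \<alpha>(3)[of i]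
        by (intro bexI[of _ "lift_phase1 (p i) (\<alpha> i)"]) (auto simp del: upt_Suc)
    qed
    then have "P \<in> outcomes (vcgs_game (vcgs_of G)) (phase0_state G q) ((#) True ` A) F'"
      unfolding outcomes_def using P_even[of 0] p0 by (simp del: upt_Suc)
    then show ?thesis
      using exp by blast
  qed
  with uniform show ?thesis
    using that by blast
qed

text \<open>Path formulas are compared along all pairs related by \<open>expands\<close>. Each
  outcome of a transferred strategy is related to an outcome of the original one, so winning carries
  over in both directions.\<close>

lemma ssat_trans_busy:
  "sfm_over (Props G) (Ag G) \<phi> \<Longrightarrow> \<forall>q\<in>States G.
     ssat (icgs_game G) q \<phi> \<longleftrightarrow> ssat (vcgs_game (vcgs_of G)) (phase0_state G q) (trans_sfm G \<phi>)"
  "pfm_over (Props G) (Ag G) \<psi> \<Longrightarrow> \<forall>p P. expands p P \<longrightarrow>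
     (psat (icgs_game G) p \<psi> \<longleftrightarrow> psat (vcgs_game (vcgs_of G)) P (trans_pfm G \<psi>))"
proof (induction \<phi> and \<psi>)
  case (Prop p)
  show ?case
    using ssat_trans_Prop by (simp add: icgs_game_def del: trans_sfm.simps)
next
  case (Coal A \<psi>)
  have A: "A \<subseteq> Ag G" and
    IH: "\<And>p P. expands p P \<Longrightarrow>
      psat (icgs_game G) p \<psi> \<longleftrightarrow> psat (vcgs_game (vcgs_of G)) P (trans_pfm G \<psi>)"
    using Coal by simp_all
  show ?case
  proof
    fix q
    assume q: "q \<in> States G"
    show "ssat (icgs_game G) q (Coal A \<psi>) \<longleftrightarrow>
        ssat (vcgs_game (vcgs_of G)) (phase0_state G q) (trans_sfm G (Coal A \<psi>))"
    proof
      assume "ssat (icgs_game G) q (Coal A \<psi>)"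
      then obtain F where F: "\<forall>a\<in>A. uniform_strategy (icgs_game G) a (F a)"
        "\<forall>p\<in>outcomes (icgs_game G) q A F. psat (icgs_game G) p \<psi>"
        by auto
      obtain F' where F': "\<forall>b\<in>(#) True ` A. uniform_strategy (vcgs_game (vcgs_of G)) b (F' b)"
        "\<And>P. P \<in> outcomes (vcgs_game (vcgs_of G)) (phase0_state G q) ((#) True ` A) F' \<Longrightarrow>
          \<exists>p \<in> outcomes (icgs_game G) q A F. expands p P"
        using strategy_to_vcgs[OF A F(1) q] by blast
      have "psat (vcgs_game (vcgs_of G)) P (trans_pfm G \<psi>)"
        if "P \<in> outcomes (vcgs_game (vcgs_of G)) (phase0_state G q) ((#) True ` A) F'" for P
        using F'(2)[OF that] F(2) IH by blast
      then show "ssat (vcgs_game (vcgs_of G)) (phase0_state G q) (trans_sfm G (Coal A \<psi>))"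
        using F'(1) busy by auto
    next
      assume "ssat (vcgs_game (vcgs_of G)) (phase0_state G q) (trans_sfm G (Coal A \<psi>))"
      then obtain F' where F': "\<forall>b\<in>(#) True ` A. uniform_strategy (vcgs_game (vcgs_of G)) b (F' b)"
        "\<forall>P\<in>outcomes (vcgs_game (vcgs_of G)) (phase0_state G q) ((#) True ` A) F'.
          psat (vcgs_game (vcgs_of G)) P (trans_pfm G \<psi>)"
        using busy by auto
      obtain F where F: "\<forall>a\<in>A. uniform_strategy (icgs_game G) a (F a)"
        "\<And>p. p \<in> outcomes (icgs_game G) q A F \<Longrightarrow>
          \<exists>P \<in> outcomes (vcgs_game (vcgs_of G)) (phase0_state G q) ((#) True ` A) F'. expands p P"
        using strategy_from_vcgs[OF A F'(1) q] by blast
      have "psat (icgs_game G) p \<psi>" if "p \<in> outcomes (icgs_game G) q A F" for p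
        using F(2)[OF that] F'(2) IH by blast
      then show "ssat (icgs_game G) q (Coal A \<psi>)"
        using F(1) by auto
    qed
  qed
next
  case (St \<phi>)
  then show ?case
    unfolding expands_def by (auto dest!: spec[of _ 0])
next
  case (Next \<psi>)
  then show ?case
    using psat_next_phase0 expands_shift[of _ _ 1] by simp
next
  case (Until \<psi> \<chi>)
  show ?case
  proof (intro allI impI)
    fix p P
    assume e: "expands p P"
    let ?D = "vcgs_game (vcgs_of G)"
    have IH: "psat (icgs_game G) (\<lambda>i. p (k + i)) \<psi> \<longleftrightarrow> psat ?D (\<lambda>i. P (2 * k + i)) (trans_pfm G \<psi>)"
      "psat (icgs_game G) (\<lambda>i. p (k + i)) \<chi> \<longleftrightarrow> psat ?D (\<lambda>i. P (2 * k + i)) (trans_pfm G \<chi>)" for k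
      using Until expands_shift[OF e] by simp_all
    have "psat ?D P (trans_pfm G (Until \<psi> \<chi>)) \<longleftrightarrow>
        (\<exists>n. even n \<and> psat ?D (\<lambda>i. P (n + i)) (trans_pfm G \<chi>) \<and>
          (\<forall>m<n. even m \<longrightarrow> psat ?D (\<lambda>i. P (m + i)) (trans_pfm G \<psi>)))"
      by (auto simp: psat_or_phase1 psat_and_phase0 expands_phase[OF e])
    also have "\<dots> \<longleftrightarrow> psat (icgs_game G) p (Until \<psi> \<chi>)"
      unfolding psat.simps IH by (rule even_Ex_All_iff)
    finally show "psat (icgs_game G) p (Until \<psi> \<chi>) \<longleftrightarrow> psat ?D P (trans_pfm G (Until \<psi> \<chi>))"
      by simp
  qed
next
  case (Release \<psi> \<chi>)
  show ?case
  proof (intro allI impI)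
    fix p P
    assume e: "expands p P"
    let ?D = "vcgs_game (vcgs_of G)"
    have IH: "psat (icgs_game G) (\<lambda>i. p (k + i)) \<psi> \<longleftrightarrow> psat ?D (\<lambda>i. P (2 * k + i)) (trans_pfm G \<psi>)"
      "psat (icgs_game G) (\<lambda>i. p (k + i)) \<chi> \<longleftrightarrow> psat ?D (\<lambda>i. P (2 * k + i)) (trans_pfm G \<chi>)" for k
      using Release expands_shift[OF e] by simp_all
    \<comment> \<open>The negated form turns the universal condition of \<open>Release\<close> into
      the pattern of \<open>even_Ex_All_iff\<close>.\<close>
    have "psat ?D P (trans_pfm G (Release \<psi> \<chi>)) \<longleftrightarrow>
        \<not> (\<exists>n. even n \<and> \<not> psat ?D (\<lambda>i. P (n + i)) (trans_pfm G \<chi>) \<and>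
          (\<forall>m<n. even m \<longrightarrow> \<not> psat ?D (\<lambda>i. P (m + i)) (trans_pfm G \<psi>)))"
      by (auto simp: psat_or_phase1 psat_and_phase0 expands_phase[OF e])
    also have "\<dots> \<longleftrightarrow> \<not> (\<exists>k. \<not> psat (icgs_game G) (\<lambda>i. p (k + i)) \<chi> \<and>
        (\<forall>j<k. \<not> psat (icgs_game G) (\<lambda>i. p (j + i)) \<psi>))"
      unfolding IH even_Ex_All_iff ..
    finally show "psat (icgs_game G) p (Release \<psi> \<chi>) \<longleftrightarrow> psat ?D P (trans_pfm G (Release \<psi> \<chi>))"
      by auto
  qed
qed simp_all

end

lemma models_trans:
  assumes "sfm_over (Props G) (Ag G) \<phi>"
  shows "icgs_game G \<Turnstile> \<phi> \<longleftrightarrow> vcgs_game (vcgs_of G) \<Turnstile> trans_sfm G \<phi>"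
proof -
  have "ssat (icgs_game G) q \<phi> \<longleftrightarrow> ssat (vcgs_game (vcgs_of G)) (phase0_state G q) (trans_sfm G \<phi>)"
    if "q \<in> Init G" for q
    using ssat_trans_busy(1)[OF _ assms] ssat_trans_idle[OF _ _ assms] that finite_parts(4)[OF G] by blast
  then show ?thesis
    unfolding models_def using vinit_vcgs_of[OF G] by (auto simp: icgs_game_def vcgs_game_def)
qed

end

section \<open>The reduction on encodings\<close>

lemma poly_time_const [poly_time_intros]: "poly_time (\<lambda>_. d)"
  by (induction d) (auto intro: poly_time_Leaf poly_time_Node)

lemma poly_time_if_eq [poly_time_intros]:
  assumes "poly_time f" "poly_time g" "poly_time h" "poly_time k"
  shows "poly_time (\<lambda>x. if f x = g x then h x else k x)"
proof -
  have "(\<lambda>x. if f x = g x then h x else k x) =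
      (\<lambda>x. if enc_bool (f x = g x) = Leaf then k x else h x)"
    by (rule ext) simp
  then show ?thesis
    using poly_time_if_Leaf[OF poly_time_eq[OF assms(1,2)] assms(4,3)] by simp
qed

lemma poly_time_tagged [poly_time_intros]: "poly_time f \<Longrightarrow> poly_time (\<lambda>x. tagged n (f x))"
  unfolding tagged_def by (intro poly_time_Node poly_time_const)

section \<open>List functions on encodings\<close>

primrec dfoldr :: "(data \<Rightarrow> data \<Rightarrow> data) \<Rightarrow> data \<Rightarrow> data \<Rightarrow> data" where
  "dfoldr h b Leaf = b"
| "dfoldr h b (Node x y) = h x (dfoldr h b y)"

text \<open>Lists run along the right spine, so this is \<open>trec\<close> with the results for
  left subtrees discarded and the input \<open>z\<close> as constant parameter. The new material per
  element is measured by a polynomial-time \<open>k\<close>, whose size is automatically polynomial,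
  and \<open>N\<close> pays for fixed constructors.\<close>

lemma poly_time_dfoldr:
  assumes h: "poly_time (\<lambda>w. h (dhd w) (dhd (dtl w)) (dtl (dtl w)))"
    and k: "poly_time (\<lambda>w. k (dhd w) (dtl w))"
    and size: "\<And>z x v. size (h z x v) \<le> size v + size (k z x) + N"
    and b: "poly_time b" and f: "poly_time f"
  shows "poly_time (\<lambda>z. dfoldr (h z) (b z) (f z))"
proof -
  obtain q :: "nat poly" where q: "\<And>w. size (k (dhd w) (dtl w)) \<le> poly q (size w)"
    using poly_time_size_bound[OF k] by blast
  \<comment> \<open>\<open>[:1, 1:]\<close> shifts the argument of \<open>q\<close> by one, for the
    constructor that packs \<open>c\<close> and \<open>x\<close>.\<close>
  have "size (h c x v) \<le> size u + size v + poly (pcompose q [:1, 1:] + [:N:]) (size c + size x + size y)"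
    for c x y u v
  proof -
    have "size (k c x) \<le> poly q (size (Node c x))"
      using q[of "Node c x"] by simp
    also have "\<dots> \<le> poly q (size c + size x + size y + 1)"
      by (rule poly_nat_mono) simp
    finally show ?thesis
      using size[of c x v] by (simp add: poly_pcompose add.commute)
  qed
  moreover have "poly_time (\<lambda>z. h (dhd z) (dhd (dtl z)) (dtl (dtl (dtl (dtl z)))))"
    using poly_time_compose[OF h, of "\<lambda>z. Node (dhd z) (Node (dhd (dtl z)) (dtl (dtl (dtl (dtl z)))))"]
    by (simp add: poly_time_intros)
  ultimately have "poly_time (\<lambda>z. trec (\<lambda>c. c) b (\<lambda>c x y u v. h c x v) (f z) z)"
    by (intro poly_time_trec[where p = "pcompose q [:1, 1:] + [:N:]"] b f poly_time_id order.refl)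
  moreover have "trec (\<lambda>c. c) b (\<lambda>c x y u v. h c x v) d z = dfoldr (h z) (b z) d" for d z
    by (induction d) auto
  ultimately show ?thesis
    by simp
qed

definition dmap :: "(data \<Rightarrow> data) \<Rightarrow> data \<Rightarrow> data" where
  "dmap h d = dfoldr (\<lambda>x v. Node (h x) v) Leaf d"

definition dapp :: "data \<Rightarrow> data \<Rightarrow> data" where
  "dapp d d' = dfoldr Node d' d"

definition dconcat_map :: "(data \<Rightarrow> data) \<Rightarrow> data \<Rightarrow> data" where
  "dconcat_map h d = dfoldr (\<lambda>x v. dapp (h x) v) Leaf d"

definition dmem :: "data \<Rightarrow> data \<Rightarrow> data" where
  "dmem x d = dfoldr (\<lambda>y v. if y = x then enc_bool True else v) Leaf d"

definition dzip :: "data \<Rightarrow> data \<Rightarrow> data" where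
  "dzip d d' = trec dtl (\<lambda>_. Leaf) (\<lambda>c x y u v. Node (Node x (dhd c)) v) d d'"

lemma poly_time_dmap [poly_time_intros]:
  assumes "poly_time (\<lambda>w. h (dhd w) (dtl w))" "poly_time f"
  shows "poly_time (\<lambda>z. dmap (h z) (f z))"
  unfolding dmap_def
proof (rule poly_time_dfoldr[where k = h and N = 1])
  show "poly_time (\<lambda>w. Node (h (dhd w) (dhd (dtl w))) (dtl (dtl w)))"
    using poly_time_compose[OF assms(1), of "\<lambda>w. Node (dhd w) (dhd (dtl w))"]
    by (simp add: poly_time_intros)
qed (use assms in \<open>simp_all add: poly_time_intros\<close>)

lemma poly_time_dapp [poly_time_intros]:
  assumes "poly_time f" "poly_time g"
  shows "poly_time (\<lambda>z. dapp (f z) (g z))"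
  unfolding dapp_def
  by (rule poly_time_dfoldr[where k = "\<lambda>_ x. x" and N = 1])
    (use assms in \<open>simp_all add: poly_time_intros\<close>)

lemma size_dapp: "size (dapp d d') = size d + size d'"
  by (induction d) (simp_all add: dapp_def)

lemma poly_time_dconcat_map [poly_time_intros]:
  assumes "poly_time (\<lambda>w. h (dhd w) (dtl w))" "poly_time f"
  shows "poly_time (\<lambda>z. dconcat_map (h z) (f z))"
  unfolding dconcat_map_def
proof (rule poly_time_dfoldr[where k = h and N = 0])
  show "poly_time (\<lambda>w. dapp (h (dhd w) (dhd (dtl w))) (dtl (dtl w)))"
    using poly_time_compose[OF assms(1), of "\<lambda>w. Node (dhd w) (dhd (dtl w))"]
    by (simp add: poly_time_intros)
qed (use assms in \<open>simp_all add: poly_time_intros size_dapp\<close>)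

lemma poly_time_dmem [poly_time_intros]:
  assumes "poly_time f" "poly_time g"
  shows "poly_time (\<lambda>z. dmem (f z) (g z))"
  unfolding dmem_def
proof (rule poly_time_dfoldr[where k = "\<lambda>_ _. Leaf" and N = 1])
  show "poly_time (\<lambda>w. if dhd (dtl w) = f (dhd w) then enc_bool True else dtl (dtl w))"
    by (intro poly_time_intros assms[THEN poly_time_compose])
qed (use assms in \<open>simp_all add: poly_time_intros\<close>)

lemma poly_time_dzip [poly_time_intros]:
  assumes "poly_time f" "poly_time g"
  shows "poly_time (\<lambda>z. dzip (f z) (g z))"
proof -
  have "size (Node (Node x (dhd c)) v) \<le> size u + size v + poly [:2, 1:] (size c + size x + size y)"
    for c x y u v
    using size_dhd_le[of c] by simp
  then show ?thesis
    unfolding dzip_def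
    by (intro poly_time_trec assms poly_time_intros size_dtl_le)
qed

lemma dfoldr_enc_list [simp]: "dfoldr h b (enc_list e xs) = foldr (\<lambda>x v. h (e x) v) xs b"
  by (induction xs) simp_all

lemma dmap_enc_list [simp]: "dmap h (enc_list e xs) = enc_list (\<lambda>x. h (e x)) xs"
  by (induction xs) (simp_all add: dmap_def)

lemma dapp_enc_list [simp]: "dapp (enc_list e xs) (enc_list e ys) = enc_list e (xs @ ys)"
  by (induction xs) (simp_all add: dapp_def)

lemma enc_list_map: "enc_list e (map f xs) = enc_list (\<lambda>x. e (f x)) xs"
  by (induction xs) simp_all

lemma enc_list_cong: "(\<And>x. x \<in> set xs \<Longrightarrow> e x = e' x) \<Longrightarrow> enc_list e xs = enc_list e' xs"
  by (induction xs) simp_all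

lemma dconcat_map_enc_list:
  assumes "\<And>x. x \<in> set xs \<Longrightarrow> h (e x) = enc_list e' (g x)"
  shows "dconcat_map h (enc_list e xs) = enc_list e' (concat (map g xs))"
  using assms by (induction xs) (simp_all add: dconcat_map_def)

lemma enc_bool_eq_Leaf [simp]: "enc_bool b = Leaf \<longleftrightarrow> \<not> b"
  by (cases b) simp_all

lemma enc_bool_inject [simp]: "enc_bool b = enc_bool b' \<longleftrightarrow> b = b'"
  by (cases b; cases b') simp_all

lemma enc_list_inject: "(\<And>x y. e x = e y \<longleftrightarrow> x = y) \<Longrightarrow> enc_list e xs = enc_list e ys \<longleftrightarrow> xs = ys"
proof (induction xs arbitrary: ys)
  case Nil
  then show ?case by (cases ys) simp_all
next
  case (Cons x xs)
  then show ?case by (cases ys) simp_all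
qed

lemma enc_name_inject [simp]: "enc_name a = enc_name b \<longleftrightarrow> a = b"
  unfolding enc_name_def by (rule enc_list_inject) simp

lemma enc_name_simps [simp]: "enc_name [] = Leaf" "enc_name (b # a) = Node (enc_bool b) (enc_name a)"
  by (simp_all add: enc_name_def)

lemma dmem_enc_list: "dmem d (enc_list e xs) = enc_bool (d \<in> e ` set xs)"
  by (induction xs) (simp_all add: dmem_def)

lemma dmem_enc_names [simp]: "dmem (enc_name a) (enc_list enc_name xs) = enc_bool (a \<in> set xs)"
  by (simp add: dmem_enc_list image_iff)

lemma dzip_enc_list [simp]:
  "length xs = length ys \<Longrightarrow> dzip (enc_list e xs) (enc_list e' ys) = enc_list (enc_pair e e') (zip xs ys)"
  by (induction xs ys rule: list_induct2) (simp_all add: dzip_def enc_pair_def)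

lemma dzip_same: "dzip (enc_list e xs) (enc_list e' xs) = enc_list (\<lambda>x. Node (e x) (e' x)) xs"
  by (induction xs) (simp_all add: dzip_def)

lemma enc_pair_simp [simp]: "enc_pair e e' (x, y) = Node (e x) (e' y)"
  by (simp add: enc_pair_def)

section \<open>Computing the vCGS from the encoded iCGS\<close>

abbreviation (input) dT :: data where "dT \<equiv> Node Leaf Leaf"
abbreviation (input) dF :: data where "dF \<equiv> Leaf"

definition d_phase :: data where "d_phase = enc_atom (At phase_var)"

definition d_state :: "data \<Rightarrow> data" where "d_state q = tagged 0 (Node dF (Node dT q))"

definition d_obs :: "data \<Rightarrow> data \<Rightarrow> data" where
  "d_obs q a = tagged 1 (Node (Node dF (Node dF q)) (Node dT a))"

definition d_pair :: "data \<Rightarrow> data \<Rightarrow> data" where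
  "d_pair a c = dfoldr (\<lambda>b v. Node dT (Node b v)) (Node dF c) a"

definition d_turn :: "data \<Rightarrow> data" where "d_turn a = Node dT (d_pair a Leaf)"

definition d_act :: "data \<Rightarrow> data \<Rightarrow> data" where "d_act a c = Node dT (d_pair a (Node dT c))"

lemma poly_time_d_pair [poly_time_intros]:
  assumes "poly_time f" "poly_time g"
  shows "poly_time (\<lambda>z. d_pair (f z) (g z))"
  unfolding d_pair_def
  by (rule poly_time_dfoldr[where k = "\<lambda>_ x. x" and N = 3])
    (use assms in \<open>simp_all add: poly_time_intros\<close>)

lemma poly_time_d_atoms [poly_time_intros]:
  "poly_time f \<Longrightarrow> poly_time (\<lambda>z. d_state (f z))"
  "poly_time f \<Longrightarrow> poly_time g \<Longrightarrow> poly_time (\<lambda>z. d_obs (f z) (g z))"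
  "poly_time f \<Longrightarrow> poly_time (\<lambda>z. d_turn (f z))"
  "poly_time f \<Longrightarrow> poly_time g \<Longrightarrow> poly_time (\<lambda>z. d_act (f z) (g z))"
  unfolding d_state_def d_obs_def d_turn_def d_act_def by (intro poly_time_intros; assumption)+

lemma d_pair_enc [simp]: "d_pair (enc_name a) (enc_name c) = enc_name (pair_name a c)"
  unfolding d_pair_def by (induction a) simp_all

lemma d_pair_enc' [simp]: "d_pair (enc_name a) Leaf = enc_name (pair_name a [])"
  "d_pair (enc_name a) (Node dT (enc_name c)) = enc_name (pair_name a (True # c))"
  using d_pair_enc[of a "[]"] d_pair_enc[of a "True # c"] by simp_all

lemma d_atoms_enc [simp]:
  "d_state (enc_name q) = enc_atom (At (state_var q))"
  "d_obs (enc_name q) (enc_name a) = enc_atom (Vis (obs_var q) (True # a))"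
  "d_turn (enc_name a) = enc_name (turn_var a)"
  "d_act (enc_name a) (enc_name c) = enc_name (act_var a c)"
  by (simp_all add: d_state_def d_obs_def d_turn_def d_act_def)

text \<open>\<open>ai\<close> lists the agents, each paired with the encoded list of its
  indistinguishable pairs.\<close>

definition d_env_assigns :: "data \<Rightarrow> data \<Rightarrow> data \<Rightarrow> data" where
  "d_env_assigns sts ai q = Node (Node d_phase dF)
     (dapp (dmap (\<lambda>x. Node (d_state x) (enc_bool (x = q))) sts)
       (dconcat_map (\<lambda>e. dmap (\<lambda>x. Node (d_obs x (dhd e)) (dmem (Node q x) (dtl e))) sts) ai))"

lemma poly_time_d_env_assigns [poly_time_intros]:
  assumes "poly_time f" "poly_time g" "poly_time h"
  shows "poly_time (\<lambda>z. d_env_assigns (f z) (g z) (h z))"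
  unfolding d_env_assigns_def by (intro poly_time_intros assms[THEN poly_time_compose])

text \<open>The tags are those of \<open>enc_bexp\<close>: \<open>0\<close> true, \<open>1\<close>
  atom, \<open>2\<close> negation, \<open>3\<close> conjunction. The \<open>tagged 0\<close> around
  \<open>d_act\<close> is the constructor \<open>At\<close>.\<close>

definition d_guard :: "data \<Rightarrow> data \<Rightarrow> data \<Rightarrow> data" where
  "d_guard ags q cs = tagged 3 (Node (tagged 1 d_phase) (tagged 3 (Node (tagged 1 (d_state q))
     (dfoldr (\<lambda>e v. tagged 3 (Node (tagged 1 (tagged 0 (d_act (dhd e) (dtl e)))) v)) (tagged 0 Leaf)
        (dzip ags cs)))))"

lemma poly_time_d_guard [poly_time_intros]:
  assumes "poly_time f" "poly_time g" "poly_time h"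
  shows "poly_time (\<lambda>z. d_guard (f z) (g z) (h z))"
proof -
  \<comment> \<open>\<open>N = 5\<close> arises from \<open>tagged 3\<close>, which contributes four
    nodes, and the pair below it.\<close>
  have "poly_time (\<lambda>z. dfoldr (\<lambda>e v. tagged 3 (Node (tagged 1 (tagged 0 (d_act (dhd e) (dtl e)))) v))
      (tagged 0 Leaf) (dzip (f z) (h z)))"
    by (rule poly_time_dfoldr[where k = "\<lambda>_ e. tagged 1 (tagged 0 (d_act (dhd e) (dtl e)))" and N = 5])
      (intro poly_time_intros assms | simp add: tagged_def numeral_eq_Suc)+
  then show ?thesis
    unfolding d_guard_def by (intro poly_time_intros assms)
qed

definition d_actions :: "data \<Rightarrow> data" where
  "d_actions cs = (if cs = Leaf then Node Leaf Leaf else cs)"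

definition d_player :: "data \<Rightarrow> data \<Rightarrow> data" where
  "d_player a cs = Node (Node dT a) (Node (Node (d_turn a) (dmap (\<lambda>c. d_act a c) cs))
     (Node (Node (Node (tagged 0 Leaf) Leaf) Leaf)
     (Node (Node
        (Node (tagged 1 (tagged 0 (d_turn a)))
          (Node (Node (tagged 0 (d_turn a)) dF) (dmap (\<lambda>c. Node (tagged 0 (d_act a c)) dF) cs)))
        (dmap (\<lambda>c. Node (tagged 2 (tagged 1 (tagged 0 (d_turn a))))
          (Node (Node (tagged 0 (d_turn a)) dT) (Node (Node (tagged 0 (d_act a c)) dT) Leaf))) cs))
     Leaf)))"

lemma poly_time_d_player [poly_time_intros]:
  assumes "poly_time f" "poly_time g"
  shows "poly_time (\<lambda>z. d_player (f z) (g z))"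
  unfolding d_player_def by (intro poly_time_intros assms[THEN poly_time_compose])

lemma poly_time_d_actions [poly_time_intros]: "poly_time f \<Longrightarrow> poly_time (\<lambda>z. d_actions (f z))"
  unfolding d_actions_def by (intro poly_time_intros; assumption)

text \<open>An element \<open>e\<close> of \<open>tab\<close> is an encoded table entry: source,
  action list and target are \<open>dhd e\<close>, \<open>dhd (dtl e)\<close> and
  \<open>dtl (dtl e)\<close>.\<close>

definition d_env :: "data \<Rightarrow> data \<Rightarrow> data \<Rightarrow> data \<Rightarrow> data \<Rightarrow> data" where
  "d_env ags sts ini tab ai = Node Leaf (Node
     (Node (Node dF Leaf) (dapp (dmap (\<lambda>q. Node dF (Node dT q)) sts) (dmap (\<lambda>q. Node dF (Node dF q)) sts)))
     (Node (dmap (\<lambda>q. Node (tagged 0 Leaf) (d_env_assigns sts ai q)) ini)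
     (Node (Node
        (Node (dfoldr (\<lambda>e v. tagged 3 (Node (tagged 2 (d_guard ags (dhd e) (dhd (dtl e)))) v)) (tagged 0 Leaf) tab)
          (Node (Node d_phase dT) Leaf))
        (dmap (\<lambda>e. Node (d_guard ags (dhd e) (dhd (dtl e))) (d_env_assigns sts ai (dtl (dtl e)))) tab))
     Leaf)))"

lemma poly_time_d_env [poly_time_intros]:
  assumes "poly_time f1" "poly_time f2" "poly_time f3" "poly_time f4" "poly_time f5"
  shows "poly_time (\<lambda>z. d_env (f1 z) (f2 z) (f3 z) (f4 z) (f5 z))"
proof -
  have "poly_time (\<lambda>z. dfoldr (\<lambda>e v. tagged 3 (Node (tagged 2 (d_guard (f1 z) (dhd e) (dhd (dtl e)))) v))
      (tagged 0 Leaf) (f4 z))"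
    by (rule poly_time_dfoldr[where k = "\<lambda>z e. tagged 2 (d_guard (f1 z) (dhd e) (dhd (dtl e)))" and N = 5])
      (intro poly_time_intros assms[THEN poly_time_compose] | simp add: tagged_def numeral_eq_Suc)+
  then show ?thesis
    unfolding d_env_def by (intro poly_time_intros assms[THEN poly_time_compose])
qed

definition d_vcgs :: "data \<Rightarrow> data" where
  "d_vcgs g = (let ags = dhd g; acts = dhd (dtl g); sts = dhd (dtl (dtl g));
       ini = dhd (dtl (dtl (dtl g))); tab = dhd (dtl (dtl (dtl (dtl (dtl g)))));
       ind = dhd (dtl (dtl (dtl (dtl (dtl (dtl g))))))
     in Node (d_env ags sts ini tab (dzip ags ind))
       (dmap (\<lambda>e. d_player (dhd e) (d_actions (dtl e))) (dzip ags acts)))"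

lemma poly_time_d_vcgs [poly_time_intros]:
  assumes "poly_time f"
  shows "poly_time (\<lambda>z. d_vcgs (f z))"
  unfolding d_vcgs_def Let_def by (intro poly_time_intros assms[THEN poly_time_compose])

lemma enc_bexp_foldr:
  "enc_bexp e (foldr (\<lambda>x b. BAnd (g x) b) xs b) =
     foldr (\<lambda>x v. tagged 3 (Node (enc_bexp e (g x)) v)) xs (enc_bexp e b)"
  by (induction xs) simp_all

lemma d_guard_enc:
  assumes "length cs = length (agents G)"
  shows "d_guard (enc_names (Ag G)) (enc_name q) (enc_list enc_name cs) =
    enc_bexp enc_atom (transition_guard G q cs)"
proof -
  have "enc_bexp enc_atom (foldr (\<lambda>(a, c) b. BAnd (BAtom (At (act_var a c))) b) zs BTrue) =
      foldr (\<lambda>z v. tagged 3 (Node (tagged 1 (tagged 0 (enc_name (act_var (fst z) (snd z))))) v)) zs (tagged 0 Leaf)"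
    for zs
    by (induction zs) auto
  then show ?thesis
    using assms by (simp add: d_guard_def transition_guard_def enc_names_def d_phase_def enc_pair_def)
qed

lemma d_actions_enc: "d_actions (enc_names (Act G a)) = enc_list enc_name (actions G a)"
proof -
  have "enc_list enc_name xs = Leaf \<longleftrightarrow> xs = []" for xs
    by (cases xs) simp_all
  then show ?thesis
    by (simp add: d_actions_def enc_names_def actions_def)
qed

lemma d_player_enc:
  "d_player (enc_name a) (enc_list enc_name (actions G a)) = enc_list id
     [enc_name (True # a), enc_list enc_name (vars (player_spec G a)),
      enc_list enc_command (init_cmds (player_spec G a)),
      enc_list enc_command (update_cmds (player_spec G a))]"
  by (simp add: d_player_def player_spec_def reset_command_def act_command_def enc_command_def enc_list_map)

context
  fixes G :: named_icgs
  assumes G: "finite_icgs G"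
begin

definition enc_indist :: "name \<Rightarrow> data" where
  "enc_indist a = enc_list (enc_pair enc_name enc_name)
     [(s, s'). s \<leftarrow> states G, s' \<leftarrow> states G, (s, s') \<in> Indist G a]"

lemma dmem_enc_indist:
  assumes "q \<in> States G" "x \<in> States G"
  shows "dmem (Node (enc_name q) (enc_name x)) (enc_indist a) = enc_bool ((q, x) \<in> Indist G a)"
proof -
  have "Node (enc_name q) (enc_name x) \<in> enc_pair enc_name enc_name ` S \<longleftrightarrow> (q, x) \<in> S" for S
    by (force simp: enc_pair_def)
  then show ?thesis
    using assms set_states[OF G] unfolding enc_indist_def dmem_enc_list by auto
qed

lemma d_env_assigns_enc:
  assumes "q \<in> States G"
  shows "d_env_assigns (enc_names (States G)) (enc_list (\<lambda>a. Node (enc_name a) (enc_indist a)) (agents G))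
      (enc_name q) = enc_list (enc_pair enc_atom enc_bool) (env_assigns G q)"
proof -
  have 1: "dmap (\<lambda>x. Node (d_state x) (enc_bool (x = enc_name q))) (enc_names (States G)) =
      enc_list (enc_pair enc_atom enc_bool) (map (\<lambda>x. (At (state_var x), x = q)) (states G))"
    by (simp add: enc_names_def enc_list_map)
  have 2: "dconcat_map (\<lambda>e. dmap (\<lambda>x. Node (d_obs x (dhd e)) (dmem (Node (enc_name q) x) (dtl e)))
        (enc_names (States G))) (enc_list (\<lambda>a. Node (enc_name a) (enc_indist a)) (agents G)) =
      enc_list (enc_pair enc_atom enc_bool)
        (concat (map (\<lambda>a. map (\<lambda>x. (Vis (obs_var x) (True # a), (q, x) \<in> Indist G a)) (states G)) (agents G)))"
  proof (rule dconcat_map_enc_list)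
    fix a
    show "dmap (\<lambda>x. Node (d_obs x (dhd (Node (enc_name a) (enc_indist a))))
          (dmem (Node (enc_name q) x) (dtl (Node (enc_name a) (enc_indist a))))) (enc_names (States G)) =
        enc_list (enc_pair enc_atom enc_bool)
          (map (\<lambda>x. (Vis (obs_var x) (True # a), (q, x) \<in> Indist G a)) (states G))"
      unfolding enc_names_def dmap_enc_list enc_list_map
      by (rule enc_list_cong) (use set_states[OF G] dmem_enc_indist[OF assms] in simp)
  qed
  show ?thesis
    unfolding d_env_assigns_def env_assigns_def 1 2 dapp_enc_list
    by (simp add: d_phase_def)
qed

lemma d_env_enc:
  "d_env (enc_names (Ag G)) (enc_names (States G)) (enc_names (Init G))
      (enc_list (enc_pair enc_name (enc_pair (enc_list enc_name) enc_name)) (transitions G))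
      (enc_list (\<lambda>a. Node (enc_name a) (enc_indist a)) (agents G)) =
    enc_list id [enc_name [], enc_list enc_name (vars (env_spec G)),
      enc_list enc_command (init_cmds (env_spec G)), enc_list enc_command (update_cmds (env_spec G))]"
proof -
  let ?ai = "enc_list (\<lambda>a. Node (enc_name a) (enc_indist a)) (agents G)"
  have z: "snd (snd z) \<in> States G" "length (fst (snd z)) = length (agents G)" if "z \<in> set (transitions G)" for z
    using that finite_parts(5)[OF G] unfolding set_transitions[OF G] by auto
  have vars: "dapp (dmap (\<lambda>q. Node dF (Node dT q)) (enc_names (States G)))
      (dmap (\<lambda>q. Node dF (Node dF q)) (enc_names (States G))) =
    enc_list enc_name (map state_var (states G) @ map obs_var (states G))"
  proof -
    have "dmap (\<lambda>q. Node dF (Node dT q)) (enc_names (States G)) = enc_list enc_name (map state_var (states G))"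
      "dmap (\<lambda>q. Node dF (Node dF q)) (enc_names (States G)) = enc_list enc_name (map obs_var (states G))"
      by (simp_all add: enc_names_def enc_list_map)
    then show ?thesis
      by simp
  qed
  have init: "dmap (\<lambda>q. Node (tagged 0 Leaf) (d_env_assigns (enc_names (States G)) ?ai q)) (enc_names (Init G)) =
    enc_list enc_command (init_cmds (env_spec G))"
    unfolding enc_names_def[of "Init G"] dmap_enc_list env_spec_def agent_spec.simps enc_list_map
    by (rule enc_list_cong)
      (use finite_parts(4)[OF G] set_init[OF G] in \<open>auto simp: enc_command_def d_env_assigns_enc\<close>)
  have wait: "dfoldr (\<lambda>e v. tagged 3 (Node (tagged 2 (d_guard (enc_names (Ag G)) (dhd e) (dhd (dtl e)))) v))
      (tagged 0 Leaf) (enc_list (enc_pair enc_name (enc_pair (enc_list enc_name) enc_name)) (transitions G)) =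
    enc_bexp enc_atom (guard (wait_command G))"
  proof -
    have "foldr (\<lambda>(q, cs, q') b. BAnd (BNot (transition_guard G q cs)) b) zs BTrue =
        foldr (\<lambda>z b. BAnd (BNot (transition_guard G (fst z) (fst (snd z)))) b) zs BTrue"
      for zs :: "(name \<times> name list \<times> name) list"
      by (rule foldr_cong) auto
    then show ?thesis
      unfolding wait_command_def command.sel
      by (simp add: enc_bexp_foldr) (rule foldr_cong, use z(2) in \<open>auto simp: enc_pair_def d_guard_enc\<close>)
  qed
  have upd: "dmap (\<lambda>e. Node (d_guard (enc_names (Ag G)) (dhd e) (dhd (dtl e)))
        (d_env_assigns (enc_names (States G)) ?ai (dtl (dtl e))))
      (enc_list (enc_pair enc_name (enc_pair (enc_list enc_name) enc_name)) (transitions G)) =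
    enc_list enc_command (map (transition_command G) (transitions G))"
    unfolding dmap_enc_list enc_list_map
    by (rule enc_list_cong) (use z in \<open>auto simp: enc_pair_def d_guard_enc d_env_assigns_enc
        transition_command_def enc_command_def split_beta\<close>)
  show ?thesis
    unfolding d_env_def vars init wait upd
    by (simp add: env_spec_def enc_command_def wait_command_def d_phase_def)
qed

lemma enc_icgs_components:
  "enc_icgs G = Node (enc_names (Ag G)) (Node (enc_list (\<lambda>a. enc_names (Act G a)) (agents G))
    (Node (enc_names (States G)) (Node (enc_names (Init G)) (Node (enc_names (Props G))
    (Node (enc_list (enc_pair enc_name (enc_pair (enc_list enc_name) enc_name)) (transitions G))
    (Node (enc_list enc_indist (agents G))
    (Node (enc_list (\<lambda>s. enc_names (\<pi> G s)) (states G)) Leaf)))))))"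
  by (simp add: enc_icgs_def Let_def transitions_def enc_indist_def[abs_def])

lemma d_vcgs_enc: "d_vcgs (enc_icgs G) = enc_vcgs (vcgs_of G)"
proof -
  have players: "dmap (\<lambda>e. d_player (dhd e) (d_actions (dtl e)))
      (dzip (enc_names (Ag G)) (enc_list (\<lambda>a. enc_names (Act G a)) (agents G))) =
    enc_list (\<lambda>b. enc_list id [enc_name b, enc_list enc_name (vars (spec (vcgs_of G) b)),
      enc_list enc_command (init_cmds (spec (vcgs_of G) b)),
      enc_list enc_command (update_cmds (spec (vcgs_of G) b))]) (map ((#) True) (agents G))"
    unfolding enc_names_def[of "Ag G"] dzip_same enc_list_map dmap_enc_list
    by (simp add: d_actions_enc d_player_enc spec_vcgs_of)
  have "dzip (enc_names (Ag G)) (enc_list enc_indist (agents G)) =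
      enc_list (\<lambda>a. Node (enc_name a) (enc_indist a)) (agents G)"
    unfolding enc_names_def dzip_same ..
  then show ?thesis
    unfolding d_vcgs_def Let_def enc_icgs_components dhd.simps dtl.simps players
    using d_env_enc by (simp add: enc_vcgs_def vcgs_of_def)
qed

end

section \<open>Computing the translated formula\<close>

definition d_true :: data where "d_true = enc_sfm enc_atom sfm_true"
definition d_false :: data where "d_false = enc_sfm enc_atom sfm_false"

text \<open>\<open>sp\<close> lists the states paired with their label sets; the tags are now those
  of \<open>enc_sfm\<close>.\<close>

definition d_prop :: "data \<Rightarrow> data \<Rightarrow> data" where
  "d_prop sp p = tagged 1 (dfoldr (\<lambda>e v. if dmem p (dtl e) = Leaf then v
     else tagged 2 (Node (tagged 1 (tagged 0 (d_state (dhd e)))) v)) d_true sp)"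

lemma poly_time_d_prop [poly_time_intros]:
  assumes "poly_time f" "poly_time g"
  shows "poly_time (\<lambda>z. d_prop (f z) (g z))"
proof -
  have "poly_time (\<lambda>z. dfoldr (\<lambda>e v. if dmem (g z) (dtl e) = Leaf then v
     else tagged 2 (Node (tagged 1 (tagged 0 (d_state (dhd e)))) v)) d_true (f z))"
    by (rule poly_time_dfoldr[where k = "\<lambda>_ e. tagged 1 (tagged 0 (d_state (dhd e)))" and N = 4])
      (intro poly_time_intros assms[THEN poly_time_compose] | simp add: tagged_def numeral_eq_Suc)+
  then show ?thesis
    unfolding d_prop_def by (intro poly_time_intros)
qed

definition d_coal :: "data \<Rightarrow> data \<Rightarrow> data" where
  "d_coal idle A = dfoldr (\<lambda>a v. if dmem a idle = Leaf then v else d_false) d_true A"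

lemma poly_time_d_coal [poly_time_intros]:
  assumes "poly_time f" "poly_time g"
  shows "poly_time (\<lambda>z. d_coal (f z) (g z))"
  unfolding d_coal_def
  by (rule poly_time_dfoldr[where k = "\<lambda>_ _. Leaf" and N = "size d_false"])
    (intro poly_time_intros assms[THEN poly_time_compose] | simp)+

abbreviation d_not_phase :: data where
  "d_not_phase \<equiv> tagged 1 (tagged 0 d_phase)"

text \<open>The head of an encoded formula is its tag, so the comparison recognises
  \<open>St\<close>, whose tag is \<open>4\<close>.\<close>

definition d_or_phase1 :: "data \<Rightarrow> data" where
  "d_or_phase1 t = (if dhd t = dhd (tagged 4 Leaf)
     then tagged 4 (tagged 1 (tagged 2 (Node d_not_phase (tagged 1 (dtl t)))))
     else tagged 5 (tagged 6 (Node (tagged 4 d_not_phase) (tagged 5 t))))"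

definition d_and_phase0 :: "data \<Rightarrow> data" where
  "d_and_phase0 t = (if dhd t = dhd (tagged 4 Leaf) then tagged 4 (tagged 2 (Node d_not_phase (dtl t)))
     else tagged 6 (Node (tagged 4 d_not_phase) t))"

definition d_next_phase0 :: "data \<Rightarrow> data" where
  "d_next_phase0 t = (if dhd t = dhd (tagged 4 Leaf) then tagged 7 (tagged 4 (tagged 3 (Node Leaf (tagged 7 t))))
     else tagged 7 (tagged 7 t))"

lemma poly_time_d_phases [poly_time_intros]:
  assumes "poly_time f"
  shows "poly_time (\<lambda>z. d_or_phase1 (f z))" "poly_time (\<lambda>z. d_and_phase0 (f z))"
    "poly_time (\<lambda>z. d_next_phase0 (f z))"
  unfolding d_or_phase1_def d_and_phase0_def d_next_phase0_def by (intro poly_time_intros assms)+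

text \<open>\<open>t\<close> is the translation of \<open>y\<close>, and \<open>t1\<close>, \<open>t2\<close> those of the two subtrees of \<open>y\<close>.\<close>

definition d_trans_step :: "data \<Rightarrow> data \<Rightarrow> data \<Rightarrow> data \<Rightarrow> data \<Rightarrow> data \<Rightarrow> data" where
  "d_trans_step c x y t t1 t2 =
    (if x = dhd (tagged 0 Leaf) then d_prop (dtl c) y
     else if x = dhd (tagged 1 Leaf) then tagged 1 t
     else if x = dhd (tagged 2 Leaf) then tagged 2 (Node t1 t2)
     else if x = dhd (tagged 3 Leaf) then
       (if dhd c = Leaf then tagged 3 (Node (dmap (\<lambda>a. Node dT a) (dhd y)) t2) else d_coal (dhd c) (dhd y))
     else if x = dhd (tagged 4 Leaf) then tagged 4 t
     else if x = dhd (tagged 5 Leaf) then tagged 5 t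
     else if x = dhd (tagged 6 Leaf) then tagged 6 (Node t1 t2)
     else if x = dhd (tagged 7 Leaf) then d_next_phase0 t
     else if x = dhd (tagged 8 Leaf) then tagged 8 (Node (d_or_phase1 t1) (d_and_phase0 t2))
     else tagged 9 (Node (d_and_phase0 t1) (d_or_phase1 t2)))"

text \<open>A binary formula is encoded as \<open>Node tag (Node d1 d2)\<close>, so its translation
  needs results from two levels below. The recursion therefore returns the translation of a tree
  together with those of its two subtrees.\<close>

definition d_trans_rec :: "data \<Rightarrow> data \<Rightarrow> data" where
  "d_trans_rec = trec (\<lambda>c. c) (\<lambda>c. Leaf) (\<lambda>c x y u v.
     Node (d_trans_step c x y (dhd v) (dhd (dtl v)) (dtl (dtl v))) (Node (dhd u) (dhd v)))"

definition d_trans :: "data \<Rightarrow> data \<Rightarrow> data" where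
  "d_trans c d = dhd (d_trans_rec d c)"

lemma d_trans_rec_Node:
  "dtl (d_trans_rec (Node x y) c) = Node (d_trans c x) (d_trans c y)"
  by (simp add: d_trans_def d_trans_rec_def)

lemma d_trans_Node: "d_trans c (Node x y) =
    d_trans_step c x y (d_trans c y) (dhd (dtl (d_trans_rec y c))) (dtl (dtl (d_trans_rec y c)))"
  by (simp add: d_trans_def d_trans_rec_def)

lemma size_tagged: "size (tagged n d) = n + size d + 1"
proof -
  have "size (((\<lambda>x. Node Leaf x) ^^ n) Leaf) = n"
    by (induction n) simp_all
  then show ?thesis
    by (simp add: tagged_def)
qed

lemma size_d_phases:
  "size (d_or_phase1 t) \<le> size t + 100" "size (d_and_phase0 t) \<le> size t + 100"
  "size (d_next_phase0 t) \<le> size t + 100"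
  using size_dtl_le[of t]
  by (auto simp: d_or_phase1_def d_and_phase0_def d_next_phase0_def tagged_def d_phase_def numeral_eq_Suc)

text \<open>A step uses either \<open>t\<close> or the pair \<open>t1\<close>, \<open>t2\<close>,
  hence \<open>max\<close>. With the sum of all three, the bounds would follow a Fibonacci-like
  recursion and become exponential in the depth.\<close>

lemma size_d_trans_step:
  obtains p :: "nat poly" where "\<And>c x y t t1 t2.
    size (d_trans_step c x y t t1 t2) \<le> max (size t) (size t1 + size t2) + poly p (size c + size y)"
proof -
  obtain p :: "nat poly" where p: "\<And>z. size (d_prop (dtl (dhd z)) (dtl z)) \<le> poly p (size z)"
    by (rule poly_time_size_bound[of "\<lambda>z. d_prop (dtl (dhd z)) (dtl z)"])
      (intro poly_time_intros, blast)
  obtain q :: "nat poly" where q: "\<And>z. size (dmap (\<lambda>a. Node dT a) (dhd (dtl z))) \<le> poly q (size z)"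
    by (rule poly_time_size_bound[of "\<lambda>z. dmap (\<lambda>a. Node dT a) (dhd (dtl z))"])
      (intro poly_time_intros, blast)
  obtain r :: "nat poly" where r: "\<And>z. size (d_coal (dhd (dhd z)) (dhd (dtl z))) \<le> poly r (size z)"
    by (rule poly_time_size_bound[of "\<lambda>z. d_coal (dhd (dhd z)) (dhd (dtl z))"])
      (intro poly_time_intros, blast)
  show ?thesis
  proof
    fix c x y t t1 t2 :: data
    define n m where "n = size c + size y + 1" and "m = max (size t) (size t1 + size t2)"
    \<comment> \<open>At most two phase wrappers are applied, adding at most \<open>100\<close>
      each; the rest of \<open>300\<close> pays for tags and pairs.\<close>
    let ?B = "m + (poly p n + poly q n + poly r n + 300)"
    have le: "size (d_prop (dtl c) y) \<le> poly p n" "size (dmap (\<lambda>a. Node dT a) (dhd y)) \<le> poly q n"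
      "size (d_coal (dhd c) (dhd y)) \<le> poly r n" "size t \<le> m" "size t1 + size t2 \<le> m"
      using p[of "Node c y"] q[of "Node c y"] r[of "Node c y"] by (simp_all add: n_def m_def)
    have ifI: "size d \<le> ?B \<Longrightarrow> size d' \<le> ?B \<Longrightarrow> size (if b then d else d') \<le> ?B" for b and d d' :: data
      by simp
    have "size (d_trans_step c x y t t1 t2) \<le> ?B"
      unfolding d_trans_step_def
      using le size_d_phases[of t] size_d_phases[of t1] size_d_phases[of t2]
      by (intro ifI) (auto simp: size_tagged)
    then show "size (d_trans_step c x y t t1 t2) \<le> max (size t) (size t1 + size t2) +
        poly (pcompose (p + q + r) [:1, 1:] + [:300:]) (size c + size y)"
      by (simp add: poly_pcompose n_def m_def add.commute add.left_commute)
  qed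
qed

text \<open>The additive criterion \<open>poly_time_trec\<close> does not fit, since
  \<open>t\<close> may occur in the new translation and also be stored beside it. The sizes are
  bounded by a separate induction instead.\<close>

lemma poly_time_d_trans [poly_time_intros]:
  assumes "poly_time f" "poly_time g"
  shows "poly_time (\<lambda>z. d_trans (f z) (g z))"
proof -
  obtain p :: "nat poly" where p: "\<And>c x y t t1 t2.
      size (d_trans_step c x y t t1 t2) \<le> max (size t) (size t1 + size t2) + poly p (size c + size y)"
    using size_d_trans_step by blast
  \<comment> \<open>The second conjunct bounds the two stored translations together; it supplies the
    other argument of \<open>max\<close> one level up. They belong to disjoint subtrees, so their
    bounds add up.\<close>
  have "size (d_trans c d) \<le> (2 * size d + 1) * poly p N \<and>
      size (dhd (dtl (d_trans_rec d c))) + size (dtl (dtl (d_trans_rec d c))) \<le> (2 * size d + 1) * poly p N"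
    if "size c + size d \<le> N" for c d N
    using that
  proof (induction d)
    case Leaf
    then show ?case
      by (simp add: d_trans_def d_trans_rec_def)
  next
    case (Node x y)
    have IH: "size (d_trans c x) \<le> (2 * size x + 1) * poly p N" "size (d_trans c y) \<le> (2 * size y + 1) * poly p N"
      "size (dhd (dtl (d_trans_rec y c))) + size (dtl (dtl (d_trans_rec y c))) \<le> (2 * size y + 1) * poly p N"
      using Node by simp_all
    have "poly p (size c + size y) \<le> poly p N"
      using Node.prems by (intro poly_nat_mono) simp
    then have "size (d_trans c (Node x y)) \<le> (2 * size y + 1) * poly p N + poly p N"
      unfolding d_trans_Node using IH p[of c x y "d_trans c y" "dhd (dtl (d_trans_rec y c))"
          "dtl (dtl (d_trans_rec y c))"] by linarith
    also have "\<dots> \<le> (2 * size (Node x y) + 1) * poly p N"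
      by (simp add: algebra_simps)
    finally have 1: "size (d_trans c (Node x y)) \<le> (2 * size (Node x y) + 1) * poly p N" .
    have "size (d_trans c x) + size (d_trans c y) \<le> (2 * size x + 1) * poly p N + (2 * size y + 1) * poly p N"
      using IH(1,2) by (rule add_mono)
    also have "\<dots> \<le> (2 * size (Node x y) + 1) * poly p N"
      by (simp add: algebra_simps)
    finally show ?case
      using 1 unfolding d_trans_rec_Node by simp
  qed
  note bound = this
  have "size (d_trans_rec d c) \<le> poly ([:2:] + [:2, 4:] * p) (size c + size d)" for c d
  proof -
    let ?N = "size c + size d"
    have split: "size z \<le> size (dhd z) + (size (dhd (dtl z)) + size (dtl (dtl z))) + 2" for z
      by (cases z; simp; cases "dtl z") auto
    have "size (d_trans_rec d c) \<le> 2 * ((2 * size d + 1) * poly p ?N) + 2"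
      using split[of "d_trans_rec d c"] bound[OF order.refl, of c d] unfolding d_trans_def by linarith
    also have "\<dots> \<le> 2 * ((2 * ?N + 1) * poly p ?N) + 2"
      by (intro add_mono mult_mono) simp_all
    also have "\<dots> = poly ([:2:] + [:2, 4:] * p) ?N"
      by (simp add: algebra_simps)
    finally show ?thesis .
  qed
  then have "poly_time (\<lambda>z. d_trans_rec (g z) (f z))"
    unfolding d_trans_rec_def
  proof (rule poly_time_trec_bounded[rotated 4])
    show "poly_time (\<lambda>z. Node
      (d_trans_step (dhd z) (dhd (dtl z)) (dhd (dtl (dtl z))) (dhd (dtl (dtl (dtl (dtl z)))))
        (dhd (dtl (dtl (dtl (dtl (dtl z)))))) (dtl (dtl (dtl (dtl (dtl (dtl z)))))))
      (Node (dhd (dhd (dtl (dtl (dtl z))))) (dhd (dtl (dtl (dtl (dtl z)))))))"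
      unfolding d_trans_step_def by (intro poly_time_intros)
  qed (use assms in \<open>simp_all add: poly_time_intros\<close>)
  then show ?thesis
    unfolding d_trans_def by (rule poly_time_dhd)
qed

text \<open>Sets are encoded in sorted order, and a common first bit respects that order; the
  program can thus prefix the names of a coalition in place, without sorting.\<close>

lemma sorted_list_of_set_Cons_image:
  fixes A :: "name set"
  assumes "finite A"
  shows "sorted_list_of_set ((#) b ` A) = map ((#) b) (sorted_list_of_set A)"
proof (rule sorted_distinct_set_unique)
  show "sorted (map ((#) b) (sorted_list_of_set A))"
    using sorted_sorted_list_of_set[of A] by (simp add: sorted_wrt_map)
qed (use assms in \<open>simp_all add: distinct_map\<close>)

lemma dhd_tagged_eq [simp]: "dhd (tagged m d) = dhd (tagged n d') \<longleftrightarrow> m = n"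
proof -
  have "size (dhd (tagged n d)) = n" for n d
    using size_tagged[of n d] by (simp add: tagged_def)
  then show ?thesis
    by (metis dhd.simps(2) tagged_def)
qed

lemma d_phases_enc:
  "d_or_phase1 (enc_pfm enc_atom \<psi>) = enc_pfm enc_atom (or_phase1 \<psi>)"
  "d_and_phase0 (enc_pfm enc_atom \<psi>) = enc_pfm enc_atom (and_phase0 \<psi>)"
  "d_next_phase0 (enc_pfm enc_atom \<psi>) = enc_pfm enc_atom (next_phase0 \<psi>)"
proof -
  have [simp]: "dtl (tagged n d) = d" for n d
    by (simp add: tagged_def)
  show "d_or_phase1 (enc_pfm enc_atom \<psi>) = enc_pfm enc_atom (or_phase1 \<psi>)"
    by (cases \<psi>) (simp_all add: d_or_phase1_def d_phase_def)
  show "d_and_phase0 (enc_pfm enc_atom \<psi>) = enc_pfm enc_atom (and_phase0 \<psi>)"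
    by (cases \<psi>) (simp_all add: d_and_phase0_def d_phase_def)
  show "d_next_phase0 (enc_pfm enc_atom \<psi>) = enc_pfm enc_atom (next_phase0 \<psi>)"
    by (cases \<psi>) (simp_all add: d_next_phase0_def enc_names_def)
qed

lemma d_trans_tagged: "d_trans c (tagged n y) =
    d_trans_step c (dhd (tagged n Leaf)) y (d_trans c y) (dhd (dtl (d_trans_rec y c))) (dtl (dtl (d_trans_rec y c)))"
  unfolding tagged_def d_trans_Node by simp

context
  fixes G :: named_icgs
  assumes G: "finite_icgs G"
begin

text \<open>All that the formula translation has to know about \<open>G\<close>: the agents without
  actions, for coalitions, and the labelled states, for propositions.\<close>

definition enc_context :: data where
  "enc_context = Node (enc_list enc_name (filter (\<lambda>a. Act G a = {}) (agents G)))
     (enc_list (\<lambda>q. Node (enc_name q) (enc_names (\<pi> G q))) (states G))"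

lemma d_prop_enc: "d_prop (dtl enc_context) (enc_name p) = enc_sfm enc_atom (trans_sfm G (Prop p))"
proof -
  have "foldr (\<lambda>q v. if dmem (enc_name p) (enc_names (\<pi> G q)) = Leaf then v
       else tagged 2 (Node (tagged 1 (tagged 0 (d_state (enc_name q)))) v)) qs d_true =
     enc_sfm enc_atom (foldr (\<lambda>q \<phi>. if p \<in> \<pi> G q
       then SAnd (SNot (Prop (At (state_var q)))) \<phi> else \<phi>) qs sfm_true)" if "set qs \<subseteq> States G" for qs
    using that
  proof (induction qs)
    case (Cons q qs)
    then have "finite (\<pi> G q)"
      using finite_subset[OF finite_parts(7)[OF G] finite_parts(8)[OF G]] by simp
    then show ?case
      using Cons by (simp add: enc_names_def)
  qed (simp add: d_true_def)
  from this[of "states G"] show ?thesis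
    using set_states[OF G]
    unfolding d_prop_def enc_context_def dtl.simps dfoldr_enc_list dhd.simps by simp
qed

lemma d_coal_enc:
  assumes "A \<subseteq> Ag G"
  shows "d_coal (dhd enc_context) (enc_names A) =
    enc_sfm enc_atom (if A \<inter> idle_agents G = {} then sfm_true else sfm_false)"
proof -
  have "foldr (\<lambda>a v. if dmem (enc_name a) (dhd enc_context) = Leaf then v else d_false) as d_true =
      enc_sfm enc_atom (if set as \<inter> idle_agents G = {} then sfm_true else sfm_false)" for as
    by (induction as) (auto simp: enc_context_def d_true_def d_false_def idle_agents_def finite_parts(1)[OF G])
  moreover have "finite A"
    using assms finite_parts(1)[OF G] finite_subset by blast
  ultimately show ?thesis
    by (simp add: d_coal_def enc_names_def)
qed

lemma enc_context_idle: "dhd enc_context = Leaf \<longleftrightarrow> idle_agents G = {}"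
proof -
  have "enc_list enc_name xs = Leaf \<longleftrightarrow> xs = []" for xs
    by (cases xs) simp_all
  then show ?thesis
    using set_agents[OF G] by (auto simp: enc_context_def idle_agents_def filter_empty_conv)
qed

lemma d_trans_enc:
  "sfm_over (Props G) (Ag G) \<phi> \<Longrightarrow>
     d_trans enc_context (enc_sfm enc_name \<phi>) = enc_sfm enc_atom (trans_sfm G \<phi>)"
  "pfm_over (Props G) (Ag G) \<psi> \<Longrightarrow>
     d_trans enc_context (enc_pfm enc_name \<psi>) = enc_pfm enc_atom (trans_pfm G \<psi>)"
proof (induction \<phi> and \<psi>)
  case (Prop p)
  show ?case
    unfolding enc_sfm.simps d_trans_tagged by (simp add: d_trans_step_def d_prop_enc del: trans_sfm.simps)
next
  case (Coal A \<psi>)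
  have "finite A"
    using Coal.prems finite_parts(1)[OF G] finite_subset by auto
  then have names: "dmap (\<lambda>a. Node dT a) (enc_names A) = enc_names ((#) True ` A)"
    by (simp add: enc_names_def sorted_list_of_set_Cons_image enc_list_map)
  show ?case
    using Coal d_coal_enc[of A]
    unfolding enc_sfm.simps d_trans_tagged d_trans_rec_Node
    by (simp add: d_trans_step_def names enc_context_idle)
next
  case (Next \<psi>)
  then show ?case
    unfolding enc_pfm.simps d_trans_tagged by (simp add: d_trans_step_def d_phases_enc)
qed (simp_all add: d_trans_tagged d_trans_rec_Node d_trans_step_def d_phases_enc)

end

section \<open>Assembling the reduction\<close>

definition d_context :: "data \<Rightarrow> data" where
  "d_context g = Node
     (dconcat_map (\<lambda>e. if dtl e = Leaf then Node (dhd e) Leaf else Leaf) (dzip (dhd g) (dhd (dtl g))))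
     (dzip (dhd (dtl (dtl g))) (dhd (dtl (dtl (dtl (dtl (dtl (dtl (dtl g)))))))))"

lemma poly_time_d_context [poly_time_intros]:
  assumes "poly_time f"
  shows "poly_time (\<lambda>z. d_context (f z))"
  unfolding d_context_def by (intro poly_time_intros assms)

lemma d_context_enc:
  assumes G: "finite_icgs G"
  shows "d_context (enc_icgs G) = enc_context G"
proof -
  have "dconcat_map (\<lambda>e. if dtl e = Leaf then Node (dhd e) Leaf else Leaf)
      (enc_list (\<lambda>a. Node (enc_name a) (enc_names (Act G a))) (agents G)) =
    enc_list enc_name (concat (map (\<lambda>a. if Act G a = {} then [a] else []) (agents G)))"
  proof (rule dconcat_map_enc_list)
    fix a
    assume "a \<in> set (agents G)"
    then have "finite (Act G a)"
      using set_agents[OF G] finite_parts(2)[OF G] by simp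
    moreover have "enc_list enc_name xs = Leaf \<longleftrightarrow> xs = []" for xs
      by (cases xs) simp_all
    ultimately show "(if dtl (Node (enc_name a) (enc_names (Act G a))) = Leaf
        then Node (dhd (Node (enc_name a) (enc_names (Act G a)))) Leaf else Leaf) =
      enc_list enc_name (if Act G a = {} then [a] else [])"
      by (simp add: enc_names_def)
  qed
  moreover have "concat (map (\<lambda>a. if P a then [a] else []) xs) = filter P xs" for P and xs :: "name list"
    by (induction xs) simp_all
  ultimately show ?thesis
    unfolding d_context_def enc_icgs_components[OF G] enc_context_def[OF G]
    by (simp add: enc_names_def dzip_same)
qed

theorem theorem3p4:
  fixes L :: atl_logic
  shows "\<exists>f. polytime_computable (icgs_instances L) enc_icgs_instance enc_vcgs_instance f \<and>
     (\<forall>G \<phi>. (G, \<phi>) \<in> icgs_instances L \<longrightarrow>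
        (\<exists>D \<phi>'. f (G, \<phi>) = (D, \<phi>') \<and> (D, \<phi>') \<in> vcgs_instances L \<and>
           (icgs_game G \<Turnstile> \<phi> \<longleftrightarrow> vcgs_game D \<Turnstile> \<phi>')))"
proof -
  define f where "f = (\<lambda>(G, \<phi>). (vcgs_of G, trans_sfm G \<phi>))"
  \<comment> \<open>\<open>df\<close> acts on arbitrary trees in polynomial time; it has to agree
    with \<open>f\<close> only on encodings of instances.\<close>
  define df where "df z = Node (d_vcgs (dhd z)) (d_trans (d_context (dhd z)) (dtl z))" for z
  have "poly_time df"
    unfolding df_def by (intro poly_time_intros)
  then obtain P and p :: "nat poly" where P: "\<And>x. \<exists>t. runs P x (df x) t \<and> t \<le> poly p (size x)"
    using poly_time_runs by blast
  have "df (enc_icgs_instance x) = enc_vcgs_instance (f x)" if inst: "x \<in> icgs_instances L" for x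
  proof -
    obtain G \<phi> where x: "x = (G, \<phi>)" "finite_icgs G" "sfm_over (Props G) (Ag G) \<phi>"
      using inst unfolding icgs_instances_def by (cases x) auto
    then show ?thesis
      by (simp add: df_def f_def enc_icgs_instance_def enc_vcgs_instance_def d_vcgs_enc d_context_enc
          d_trans_enc)
  qed
  then have "polytime_computable (icgs_instances L) enc_icgs_instance enc_vcgs_instance f"
    unfolding polytime_computable_def using P by metis
  moreover have "(vcgs_of G, trans_sfm G \<phi>) \<in> vcgs_instances L"
    "icgs_game G \<Turnstile> \<phi> \<longleftrightarrow> vcgs_game (vcgs_of G) \<Turnstile> trans_sfm G \<phi>"
    if "(G, \<phi>) \<in> icgs_instances L" for G \<phi>
  proof -
    have \<phi>: "finite_icgs G" "sfm_over (Props G) (Ag G) \<phi>" "in_logic L \<phi>"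
      using that unfolding icgs_instances_def by auto
    then show "(vcgs_of G, trans_sfm G \<phi>) \<in> vcgs_instances L"
      using wf_vcgs_of sfm_over_trans_sfm(1) is_ATL_trans_sfm
      by (auto simp: vcgs_instances_def in_logic_def simp del: vAg_vcgs_of split: atl_logic.splits)
    show "icgs_game G \<Turnstile> \<phi> \<longleftrightarrow> vcgs_game (vcgs_of G) \<Turnstile> trans_sfm G \<phi>"
      using models_trans \<phi> by blast
  qed
  ultimately show ?thesis
    by (intro exI[of _ f]) (auto simp: f_def)
qed

end
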